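(* Let $(E,X,\pi_X)$ and $(F,Y,\pi_Y)$ be smooth vector bundles. (i) Let $u\in\Gamma_{\mathcal G}(X,E)$. Then $u=0$ in $\Gamma_{\mathcal G}(X,E)$ if and only if $u(\tilde p)=0_{\tilde p}$ in $E_c^{\sim_{vb}}$ for all $\tilde p\in\widetilde X_c$. (ii) Let $(v_\varepsilon)_\varepsilon,(v'_\varepsilon)_\varepsilon\in\mathcal E_M^{\mathrm{VB}}[E,F]$ be such that for each of the nets $(w_\varepsilon)_\varepsilon=(v_\varepsilon)_\varepsilon$ and $(w_\varepsilon)_\varepsilon=(v'_\varepsilon)_\varepsilon$ the following holds: for every $K\subset\subset X$ there exist $\varepsilon_0>0$ and a vector bundle chart $(W,\Psi)$ of $F$ with $\overline{\bigcup_{\varepsilon<\varepsilon_0}\underline{w_\varepsilon}(K)}\subset\subset W$. Let $v=\mathrm{cl}[(v_\varepsilon)_\varepsilon]$ and $v'=\mathrm{cl}[(v'_\varepsilon)_\varepsilon]$ in $\mathrm{Hom}_{\mathcal G}[E,F]$. Then $(v_\varepsilon)_\varepsilon\sim_{vb0}(v'_\varepsilon)_\varepsilon$ if and only if $v(\tilde e)=v'(\tilde e)$ in $F_c^{\sim_{vb}}$ for all $\tilde e\in E_c^{\sim_{vb}}$.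
   Context: Manifolds are smooth, paracompact, Hausdorff and finite-dimensional. $I=(0,1]$, $\mathbb N=\{1,2,\dots\}$, $\mathbb N_0=\mathbb N\cup\{0\}$; $O(\cdot)$ refers to $\varepsilon\to0$. $K\subset\subset X$ means that $K$ is a compact subset of $X$. A supremum over the empty set is $0$. $D^{(k)}$ is the total derivative of order $k$ ($D^{(0)}f=f$); norms on finite-dimensional spaces are arbitrary. $d_h$ is the distance function of a Riemannian metric $h$, with $d_h(p,q)=\infty$ if $p,q$ lie in different components. **Bundles.** Vector bundles have typical fibers $\mathbb K^{n'}$ (for $E$) and $\mathbb K^{m'}$ (for $F$), $\mathbb K=\mathbb R$ or $\mathbb C$. A vector bundle chart $(V,\Phi)$ over a chart $(V,\varphi)$ of the base is written $\Phi(z)=(\varphi(p),\boldsymbol\varphi(z))\in\varphi(V)\times\mathbb K^{n'}$, $p=\pi(z)$ (similarly $\Psi=(\psi,\boldsymbol\psi)$). For a smooth vector bundle homomorphism $f\in\mathrm{Hom}(E,F)$, $\underline f:X\to Y$ is the induced base map ($\pi_Y\circ f=\underline f\circ\pi_X$), and $f_{\Psi\Phi}:=\Psi\circ f\circ\Phi^{-1}$ is written $f_{\Psi\Phi}(x,\xi)=(f^{(1)}_{\Psi\Phi}(x),f^{(2)}_{\Psi\Phi}(x)\cdot\xi)$ on $\varphi(V\cap\underline f^{-1}(W))\times\mathbb K^{n'}$. **Manifold-valued generalized functions.** $\mathcal E_M[X,Y]$ is the set of nets $(u_\varepsilon)_\varepsilon\in C^\infty(X,Y)^I$ such that (i) $\forall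 K\subset\subset X\ \exists\varepsilon_0>0\ \exists K'\subset\subset Y\ \forall\varepsilon<\varepsilon_0:u_\varepsilon(K)\subseteq K'$; (ii) for all $k\in\mathbb N$, charts $(V,\varphi)$ in $X$, $(W,\psi)$ in $Y$, $L\subset\subset V$, $L'\subset\subset W$ there is $N\in\mathbb N$ with $\sup_{p\in L\cap u_\varepsilon^{-1}(L')}\|D^{(k)}(\psi\circ u_\varepsilon\circ\varphi^{-1})(\varphi(p))\|=O(\varepsilon^{-N})$. In $\mathcal E_M[X,Y]$, $(u_\varepsilon)_\varepsilon\sim(v_\varepsilon)_\varepsilon$ means: (i) $\sup_{p\in K}d_h(u_\varepsilon(p),v_\varepsilon(p))\to0$ for all $K\subset\subset X$ and some (hence every) Riemannian metric $h$ on $Y$; (ii) for all $k\in\mathbb N_0$, $m\in\mathbb N$, and $(V,\varphi),(W,\psi),L,L'$ as before, $\sup_{p\in L\cap u_\varepsilon^{-1}(L')\cap v_\varepsilon^{-1}(L')}\|D^{(k)}(\psi\circ u_\varepsilon\circ\varphi^{-1}-\psi\circ v_\varepsilon\circ\varphi^{-1})(\varphi(p))\|=O(\varepsilon^m)$. $(u_\varepsilon)_\varepsilon\sim_0(v_\varepsilon)_\varepsilon$ means that (i) holds and (ii) holds for $k=0$. **Generalized homomorphisms.** $\mathcal E_M^{\mathrm{VB}}[E,F]$ is the set of nets $(u_\varepsilon)_\varepsilon\in\mathrm{Hom}(E,F)^I$ with (i) $(\underline{u_\varepsilon})_\varepsilon\in\mathcal E_M[X,Y]$; (ii) for all $k\in\mathbb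 N_0$, vector bundle charts $(V,\Phi)$ of $E$, $(W,\Psi)$ of $F$, $L\subset\subset V$, $L'\subset\subset W$ there are $N\in\mathbb N$, $\varepsilon_1>0$, $C>0$ with $\|D^{(k)}u^{(2)}_{\varepsilon\Psi\Phi}(\varphi(p))\|\le C\varepsilon^{-N}$ for all $\varepsilon<\varepsilon_1$ and $p\in L\cap\underline{u_\varepsilon}^{-1}(L')$. $(u_\varepsilon)_\varepsilon\sim_{vb}(v_\varepsilon)_\varepsilon$ means: (i) $(\underline{u_\varepsilon})_\varepsilon\sim(\underline{v_\varepsilon})_\varepsilon$ in $\mathcal E_M[X,Y]$; (ii) for all $k\in\mathbb N_0$, $m\in\mathbb N$, and $(V,\Phi),(W,\Psi),L,L'$ as before there are $\varepsilon_1>0$, $C>0$ with $\|D^{(k)}(u^{(2)}_{\varepsilon\Psi\Phi}-v^{(2)}_{\varepsilon\Psi\Phi})(\varphi(p))\|\le C\varepsilon^m$ for all $\varepsilon<\varepsilon_1$ and $p\in L\cap\underline{u_\varepsilon}^{-1}(L')\cap\underline{v_\varepsilon}^{-1}(L')$. $(u_\varepsilon)_\varepsilon\sim_{vb0}(v_\varepsilon)_\varepsilon$ means: $(\underline{u_\varepsilon})_\varepsilon\sim_0(\underline{v_\varepsilon})_\varepsilon$ and the latter condition (ii) holds for $k=0$. $\mathrm{Hom}_{\mathcal G}[E,F]:=\mathcal E_M^{\mathrm{VB}}[E,F]/\!\sim_{vb}$. **Generalized sections.** Let $\mathcal P(X,E)$ be the linear differential operators on the space $\Gamma(X,E)$ of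 smooth sections, and $\|\cdot\|_h$ the norm on fibers of $E$ induced by any Riemannian (fiber) metric $h$ on $E$. $\Gamma_{\mathcal E_M}(X,E)$ is the set of nets $(s_\varepsilon)_\varepsilon\in\Gamma(X,E)^I$ such that $\forall P\in\mathcal P(X,E)\ \forall K\subset\subset X\ \exists N\in\mathbb N:\sup_{p\in K}\|Ps_\varepsilon(p)\|_h=O(\varepsilon^{-N})$; $\Gamma_{\mathcal N}(X,E)$ is the set of those $(s_\varepsilon)_\varepsilon\in\Gamma_{\mathcal E_M}(X,E)$ with $\sup_{p\in K}\|s_\varepsilon(p)\|_h=O(\varepsilon^m)$ for all $K\subset\subset X$, $m\in\mathbb N$. $\Gamma_{\mathcal G}(X,E):=\Gamma_{\mathcal E_M}(X,E)/\Gamma_{\mathcal N}(X,E)$. **Generalized points.** $\widetilde X_c$ is the set of nets $(p_\varepsilon)_\varepsilon\in X^I$ that lie in some fixed compact set for all small $\varepsilon$, modulo $(p_\varepsilon)_\varepsilon\sim(q_\varepsilon)_\varepsilon:\Leftrightarrow d_g(p_\varepsilon,q_\varepsilon)=O(\varepsilon^m)$ for all $m>0$ (one, equivalently every, Riemannian metric $g$ on $X$). **Generalized vector bundle points.** A net $(e_\varepsilon)_\varepsilon\in E^I$ is $vb$-moderate if (i) there are $K\subset\subset X$, $\varepsilon_0>0$ with $\pi_X(e_\varepsilon)\in K$ for $\varepsilon<\varepsilon_0$; (ii) for some Riemannian (fiber) metric $h$ on $E$ there are $\varepsilon_1>0$, $N\in\mathbb N$, $C>0$ with $\|e_\varepsilon\|_h\le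 C\varepsilon^{-N}$ for $\varepsilon<\varepsilon_1$. Two such nets are $\sim_{vb}$-equivalent if (iii) $(\pi_X(e_\varepsilon))_\varepsilon\sim(\pi_X(e'_\varepsilon))_\varepsilon$, i.e. $d_g(\pi_X(e_\varepsilon),\pi_X(e'_\varepsilon))=O(\varepsilon^m)$ for all $m>0$ and one (equivalently every) Riemannian metric $g$ on $X$; (iv) for all $m\in\mathbb N$, vector bundle charts $(W,\Psi)$ of $E$ and $L'\subset\subset W$ there are $\varepsilon_1>0$, $C>0$ with $|\boldsymbol\psi(e_\varepsilon)-\boldsymbol\psi(e'_\varepsilon)|\le C\varepsilon^m$ for all $\varepsilon<\varepsilon_1$ for which both $\pi_X(e_\varepsilon)$ and $\pi_X(e'_\varepsilon)$ lie in $L'$. The set of classes is $E_c^{\sim_{vb}}$; $F_c^{\sim_{vb}}$ is defined likewise. In all cases $\mathrm{cl}[\cdot]$ denotes the equivalence class. **Point values.** For $u=\mathrm{cl}[(u_\varepsilon)_\varepsilon]\in\Gamma_{\mathcal G}(X,E)$ and $\tilde p=\mathrm{cl}[(p_\varepsilon)_\varepsilon]\in\widetilde X_c$, $u(\tilde p):=\mathrm{cl}[(u_\varepsilon(p_\varepsilon))_\varepsilon]\in E_c^{\sim_{vb}}$, and $0_{\tilde p}:=\mathrm{cl}[(0_{p_\varepsilon})_\varepsilon]$, where $0_{p}$ is the zero of the fiber $E_p$. For $v=\mathrm{cl}[(v_\varepsilon)_\varepsilon]\in\mathrm{Hom}_{\mathcal G}[E,F]$ with $(v_\varepsilon)_\varepsilon$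 satisfying the condition on base maps in part (ii) of the claim and $\tilde e=\mathrm{cl}[(e_\varepsilon)_\varepsilon]\in E_c^{\sim_{vb}}$, $v(\tilde e):=\mathrm{cl}[(v_\varepsilon(e_\varepsilon))_\varepsilon]\in F_c^{\sim_{vb}}$. (These are well defined.) *)

theory Defs
  imports "HOL-Analysis.Analysis"
begin

section \<open>Scalars and model spaces\<close>

text \<open>The scalar field: the axiom says that it is \<open>\<real>\<close> (if \<open>i = 0\<close>) or \<open>\<real> + \<real>i\<close> with
  \<open>i\<^sup>2 = -1\<close>, i.e. \<open>\<real>\<close> or \<open>\<complex>\<close> up to isomorphism.\<close>

class real_or_complex = real_normed_field +
  assumes real_or_complex:
    "\<exists>i. (i = 0 \<or> i * i = - 1) \<and> (\<forall>z. \<exists>a b. z = a *\<^sub>R 1 + b *\<^sub>R i)"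

instance real :: real_or_complex
proof
  show "\<exists>i::real. (i = 0 \<or> i * i = - 1) \<and> (\<forall>z. \<exists>a b. z = a *\<^sub>R 1 + b *\<^sub>R i)"
    by (rule exI[of _ 0]) auto
qed

instance complex :: real_or_complex
proof
  show "\<exists>i::complex. (i = 0 \<or> i * i = - 1) \<and> (\<forall>z. \<exists>a b. z = a *\<^sub>R 1 + b *\<^sub>R i)"
    by (rule exI[of _ \<i>]) (auto simp: complex_eq_iff)
qed

text \<open>Finite-dimensional real normed spaces. In contrast to \<^class>\<open>euclidean_space\<close> the norm is
  arbitrary and dimension \<open>0\<close> is included (the type \<^typ>\<open>unit\<close> below), so that manifolds of
  dimension \<open>0\<close> and vector bundles of rank \<open>0\<close> are covered. The superclasses \<^class>\<open>banach\<close>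
  and \<^class>\<open>heine_borel\<close> follow from finite dimension and exclude nothing.\<close>

class fin_dim_normed = banach + heine_borel +
  assumes finite_dimensional:
    "\<exists>B. finite B \<and> (\<forall>x. \<exists>c. x = (\<Sum>b\<in>B. c b *\<^sub>R b))"

instance euclidean_space \<subseteq> fin_dim_normed
proof
  show "\<exists>B::'a set. finite B \<and> (\<forall>x. \<exists>c. x = (\<Sum>b\<in>B. c b *\<^sub>R b))"
    by (rule exI[of _ Basis]) (metis euclidean_representation finite_Basis)
qed

instantiation unit :: real_normed_vector
begin
definition plus_unit :: "unit \<Rightarrow> unit \<Rightarrow> unit" where "plus_unit x y = ()"
definition zero_unit :: unit where "zero_unit = ()"
definition scaleR_unit :: "real \<Rightarrow> unit \<Rightarrow> unit" where "scaleR_unit r x = ()"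
definition norm_unit :: "unit \<Rightarrow> real" where "norm_unit x = 0"
definition dist_unit :: "unit \<Rightarrow> unit \<Rightarrow> real" where "dist_unit x y = 0"
definition sgn_unit :: "unit \<Rightarrow> unit" where "sgn_unit x = ()"
definition uniformity_unit :: "(unit \<times> unit) filter"
  where "uniformity_unit = (INF e\<in>{0<..}. principal {(x, y). dist x y < e})"
definition open_unit :: "unit set \<Rightarrow> bool"
  where "open_unit U = (\<forall>x\<in>U. eventually (\<lambda>(x', y). x' = x \<longrightarrow> y \<in> U) uniformity)"
instance
proof
  show "uniformity = (INF e\<in>{0<..}. principal {(x, y::unit). dist x y < e})"
    by (rule uniformity_unit_def)
  show "open U \<longleftrightarrow> (\<forall>x\<in>U. eventually (\<lambda>(x', y). x' = x \<longrightarrow> y \<in> U) uniformity)"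
    for U :: "unit set"
    by (rule open_unit_def)
qed (simp_all add: norm_unit_def dist_unit_def)
end

instance unit :: banach
proof
  show "convergent X" for X :: "nat \<Rightarrow> unit"
  proof -
    have "X = (\<lambda>_. ())"
      by (simp add: fun_eq_iff)
    then show ?thesis
      by (metis convergent_const)
  qed
qed

instance unit :: fin_dim_normed
proof
  show "\<exists>B::unit set. finite B \<and> (\<forall>x. \<exists>c. x = (\<Sum>b\<in>B. c b *\<^sub>R b))"
    by (rule exI[of _ "{}"]) auto
  show "\<exists>l r. strict_mono r \<and> (f \<circ> r) \<longlonglongrightarrow> l" for f :: "nat \<Rightarrow> unit"
  proof (intro exI conjI)
    show "strict_mono (id :: nat \<Rightarrow> nat)"
      by (rule strict_mono_id)
    show "(f \<circ> id) \<longlonglongrightarrow> ()"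
      using tendsto_const[of "()" sequentially] by (simp add: o_def)
  qed
qed


section \<open>Higher derivatives\<close>

text \<open>\<open>iter_deriv f [v\<^sub>1, \<dots>, v\<^sub>k] x\<close> is the value \<open>D\<^sup>(\<^sup>k\<^sup>) f(x)(v\<^sub>1, \<dots>, v\<^sub>k)\<close> of the total derivative
  of order \<open>k\<close>, for \<open>f\<close> smooth near \<open>x\<close>.\<close>

fun iter_deriv ::
  "('a::real_normed_vector \<Rightarrow> 'b::real_normed_vector) \<Rightarrow> 'a list \<Rightarrow> 'a \<Rightarrow> 'b" where
  "iter_deriv f [] = f"
| "iter_deriv f (v # vs) = (\<lambda>x. frechet_derivative (iter_deriv f vs) (at x) v)"

text \<open>Only used for open \<open>S\<close> in finite-dimensional spaces, where it says that \<open>f\<close> is \<open>C\<^sup>\<infinity>\<close> on \<open>S\<close>.\<close>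

definition smooth_on ::
  "'a::real_normed_vector set \<Rightarrow> ('a \<Rightarrow> 'b::real_normed_vector) \<Rightarrow> bool" where
  "smooth_on S f \<longleftrightarrow> (\<forall>vs. \<forall>x\<in>S. iter_deriv f vs differentiable (at x))"

text \<open>The norm of the \<open>k\<close>-linear map \<open>D\<^sup>(\<^sup>k\<^sup>) f(x)\<close>. Norms and distances that enter suprema take
  values in \<^typ>\<open>ennreal\<close>, where the supremum over the empty set is \<open>0\<close>.\<close>

definition deriv_norm ::
  "nat \<Rightarrow> ('a::real_normed_vector \<Rightarrow> 'b::real_normed_vector) \<Rightarrow> 'a \<Rightarrow> ennreal" where
  "deriv_norm k f x =
    (SUP vs \<in> {vs. length vs = k \<and> (\<forall>v\<in>set vs. norm v \<le> 1)}. ennreal (norm (iter_deriv f vs x)))"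

text \<open>The same for a map \<open>F\<close> into a space of linear maps, given as a function of two arguments:
  \<open>D\<^sup>(\<^sup>k\<^sup>) F(x)\<close> is regarded as a \<open>(k+1)\<close>-linear map.\<close>

definition hom_deriv_norm ::
  "nat \<Rightarrow> ('a::real_normed_vector \<Rightarrow> 'e::real_normed_vector \<Rightarrow> 'f::real_normed_vector)
    \<Rightarrow> 'a \<Rightarrow> ennreal" where
  "hom_deriv_norm k F x = (SUP \<xi> \<in> {\<xi>. norm \<xi> \<le> 1}. deriv_norm k (\<lambda>y. F y \<xi>) x)"


section \<open>Smooth manifolds\<close>

text \<open>Charts are pairs \<open>(V, \<phi>)\<close>; the values of \<open>\<phi>\<close> outside \<open>V\<close> are irrelevant.\<close>

type_synonym ('x, 'a) chart = "'x set \<times> ('x \<Rightarrow> 'a)"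

definition is_chart :: "'x topology \<Rightarrow> ('x, 'a::real_normed_vector) chart \<Rightarrow> bool" where
  "is_chart X = (\<lambda>(V, \<phi>). openin X V \<and> open (\<phi> ` V) \<and>
     homeomorphic_map (subtopology X V) (top_of_set (\<phi> ` V)) \<phi>)"

definition compatible ::
  "('x, 'a::real_normed_vector) chart \<Rightarrow> ('x, 'a) chart \<Rightarrow> bool" where
  "compatible = (\<lambda>(V, \<phi>) (W, \<psi>).
     smooth_on (\<phi> ` (V \<inter> W)) (\<psi> \<circ> inv_into V \<phi>) \<and>
     smooth_on (\<psi> ` (V \<inter> W)) (\<phi> \<circ> inv_into W \<psi>))"

definition is_atlas :: "'x topology \<Rightarrow> ('x, 'a::real_normed_vector) chart set \<Rightarrow> bool" where
  "is_atlas X A \<longleftrightarrow> (\<forall>c\<in>A. is_chart X c) \<and> topspace X = (\<Union>(V, \<phi>)\<in>A. V) \<and>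
     (\<forall>c\<in>A. \<forall>d\<in>A. compatible c d)"

definition paracompact_space :: "'x topology \<Rightarrow> bool" where
  "paracompact_space X \<longleftrightarrow>
     (\<forall>\<U>. (\<forall>U\<in>\<U>. openin X U) \<and> \<Union>\<U> = topspace X \<longrightarrow>
        (\<exists>\<V>. (\<forall>V\<in>\<V>. openin X V \<and> (\<exists>U\<in>\<U>. V \<subseteq> U)) \<and> \<Union>\<V> = topspace X \<and> locally_finite_in X \<V>))"

record ('x, 'a) manifold =
  points :: "'x topology"
  charts :: "('x, 'a) chart set"

definition smooth_manifold :: "('x, 'a::fin_dim_normed) manifold \<Rightarrow> bool" where
  "smooth_manifold X \<longleftrightarrow> Hausdorff_space (points X) \<and> paracompact_space (points X) \<and>
     is_atlas (points X) (charts X) \<and>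
     (\<forall>c. is_chart (points X) c \<and> (\<forall>d\<in>charts X. compatible c d) \<longrightarrow> c \<in> charts X)"

definition smooth_map ::
  "'x topology \<Rightarrow> ('x, 'a::real_normed_vector) chart set \<Rightarrow>
   'y topology \<Rightarrow> ('y, 'b::real_normed_vector) chart set \<Rightarrow> ('x \<Rightarrow> 'y) \<Rightarrow> bool" where
  "smooth_map X A Y B f \<longleftrightarrow> continuous_map X Y f \<and>
     (\<forall>(V, \<phi>)\<in>A. \<forall>(W, \<psi>)\<in>B. smooth_on (\<phi> ` (V \<inter> f -` W)) (\<psi> \<circ> f \<circ> inv_into V \<phi>))"

text \<open>\<open>compact_in X L V\<close> is \<open>L \<subset>\<subset> V\<close> for a subset \<open>V\<close> of \<open>X\<close>.\<close>

definition compact_in :: "'x topology \<Rightarrow> 'x set \<Rightarrow> 'x set \<Rightarrow> bool" where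
  "compact_in X L V \<longleftrightarrow> compactin X L \<and> L \<subseteq> V"


subsection \<open>Riemannian metrics and distance\<close>

text \<open>A Riemannian metric is given by its components in all charts: \<open>g (V, \<phi>) x\<close> is the bilinear
  form at the point of \<open>V\<close> with coordinates \<open>x\<close>, and the components transform as a covariant
  tensor.\<close>

type_synonym ('x, 'a) metric_tensor = "('x, 'a) chart \<Rightarrow> 'a \<Rightarrow> 'a \<Rightarrow>\<^sub>L 'a \<Rightarrow>\<^sub>L real"

definition inner_form :: "('e::real_normed_vector \<Rightarrow>\<^sub>L 'e \<Rightarrow>\<^sub>L real) \<Rightarrow> bool" where
  "inner_form H \<longleftrightarrow> (\<forall>v w. H v w = H w v) \<and> (\<forall>v. v \<noteq> 0 \<longrightarrow> H v v > 0)"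

definition riemannian_metric ::
  "('x, 'a::fin_dim_normed) manifold \<Rightarrow> ('x, 'a) metric_tensor \<Rightarrow> bool" where
  "riemannian_metric X g \<longleftrightarrow>
     (\<forall>(V, \<phi>)\<in>charts X. smooth_on (\<phi> ` V) (g (V, \<phi>)) \<and> (\<forall>x\<in>\<phi> ` V. inner_form (g (V, \<phi>) x))) \<and>
     (\<forall>(V, \<phi>)\<in>charts X. \<forall>(W, \<psi>)\<in>charts X. \<forall>p\<in>V \<inter> W. \<forall>v w.
        g (V, \<phi>) (\<phi> p) v w =
        g (W, \<psi>) (\<psi> p)
          (frechet_derivative (\<psi> \<circ> inv_into V \<phi>) (at (\<phi> p)) v)
          (frechet_derivative (\<psi> \<circ> inv_into V \<phi>) (at (\<phi> p)) w))"

definition pw_C1_curve :: "('x, 'a::fin_dim_normed) manifold \<Rightarrow> (real \<Rightarrow> 'x) \<Rightarrow> bool" where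
  "pw_C1_curve X \<gamma> \<longleftrightarrow> pathin (points X) \<gamma> \<and>
     (\<exists>S. finite S \<and>
        (\<forall>(V, \<phi>)\<in>charts X. (\<phi> \<circ> \<gamma>) C1_differentiable_on {t \<in> {0..1} - S. \<gamma> t \<in> V}))"

text \<open>The speed does not depend on the chart wherever the curve is differentiable; the finitely
  many remaining parameters do not affect the length.\<close>

definition speed ::
  "('x, 'a::fin_dim_normed) manifold \<Rightarrow> ('x, 'a) metric_tensor \<Rightarrow> (real \<Rightarrow> 'x) \<Rightarrow> real \<Rightarrow> real" where
  "speed X g \<gamma> t = (THE r. \<exists>(V, \<phi>)\<in>charts X. \<gamma> t \<in> V \<and>
     r = sqrt (g (V, \<phi>) (\<phi> (\<gamma> t)) (vector_derivative (\<phi> \<circ> \<gamma>) (at t))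
                                     (vector_derivative (\<phi> \<circ> \<gamma>) (at t))))"

definition curve_length ::
  "('x, 'a::fin_dim_normed) manifold \<Rightarrow> ('x, 'a) metric_tensor \<Rightarrow> (real \<Rightarrow> 'x) \<Rightarrow> ennreal" where
  "curve_length X g \<gamma> = (\<integral>\<^sup>+t\<in>{0..1}. ennreal (speed X g \<gamma> t) \<partial>lborel)"

text \<open>The infimum over the empty set is \<open>\<infinity>\<close>, the distance of points in different components.\<close>

definition riem_dist ::
  "('x, 'a::fin_dim_normed) manifold \<Rightarrow> ('x, 'a) metric_tensor \<Rightarrow> 'x \<Rightarrow> 'x \<Rightarrow> ennreal" where
  "riem_dist X g p q =
     (INF \<gamma> \<in> {\<gamma>. pw_C1_curve X \<gamma> \<and> \<gamma> 0 = p \<and> \<gamma> 1 = q}. curve_length X g \<gamma>)"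


section \<open>Vector bundles\<close>

text \<open>A vector bundle chart \<open>\<Phi>(z) = (\<phi>(\<pi> z), \<eta> z)\<close> over the chart \<open>(V, \<phi>)\<close> is represented by the
  triple \<open>(V, \<phi>, \<eta>)\<close>; \<open>\<eta>\<close> is the fiber component, written as a bold \<open>\<phi>\<close> in the literature. The
  typical fiber is the type \<open>'e\<close> with scalar multiplication \<open>smul\<close>, that is, an arbitrary
  finite-dimensional vector space over \<open>'k\<close>.\<close>

type_synonym ('x, 'a, 'p, 'e) vb_chart = "'x set \<times> ('x \<Rightarrow> 'a) \<times> ('p \<Rightarrow> 'e)"

record ('x, 'a, 'p, 'e, 'k) vbundle =
  base :: "('x, 'a) manifold"
  total :: "'p topology"
  proj :: "'p \<Rightarrow> 'x"
  smul :: "'k \<Rightarrow> 'e \<Rightarrow> 'e"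
  vb_charts :: "('x, 'a, 'p, 'e) vb_chart set"

definition scalar_mult :: "('k::real_or_complex \<Rightarrow> 'e::fin_dim_normed \<Rightarrow> 'e) \<Rightarrow> bool" where
  "scalar_mult s \<longleftrightarrow> vector_space s \<and> (\<forall>r \<xi>. s (of_real r) \<xi> = r *\<^sub>R \<xi>)"

definition over :: "('x, 'a, 'p, 'e, 'k) vbundle \<Rightarrow> 'x set \<Rightarrow> 'p set" where
  "over E V = {z \<in> topspace (total E). proj E z \<in> V}"

definition total_chart ::
  "('x, 'a, 'p, 'e, 'k) vbundle \<Rightarrow> ('x, 'a, 'p, 'e) vb_chart \<Rightarrow> ('p, 'a \<times> 'e) chart" where
  "total_chart E = (\<lambda>(V, \<phi>, \<eta>). (over E V, \<lambda>z. (\<phi> (proj E z), \<eta> z)))"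

text \<open>The point of the total space with coordinates \<open>(x, \<xi>)\<close>, i.e. \<open>\<Phi>\<^sup>-\<^sup>1(x, \<xi>)\<close>.\<close>

definition vb_point ::
  "('x, 'a, 'p, 'e, 'k) vbundle \<Rightarrow> ('x, 'a, 'p, 'e) vb_chart \<Rightarrow> 'a \<Rightarrow> 'e \<Rightarrow> 'p" where
  "vb_point E c x \<xi> = inv_into (fst (total_chart E c)) (snd (total_chart E c)) (x, \<xi>)"

definition is_vb_chart ::
  "('x, 'a::fin_dim_normed, 'p, 'e::fin_dim_normed, 'k) vbundle
    \<Rightarrow> ('x, 'a, 'p, 'e) vb_chart \<Rightarrow> bool" where
  "is_vb_chart E = (\<lambda>(V, \<phi>, \<eta>). (V, \<phi>) \<in> charts (base E) \<and>
     is_chart (total E) (total_chart E (V, \<phi>, \<eta>)) \<and>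
     (\<lambda>z. (\<phi> (proj E z), \<eta> z)) ` over E V = \<phi> ` V \<times> UNIV)"

definition vb_compatible ::
  "('x, 'a::fin_dim_normed, 'p, 'e::fin_dim_normed, 'k::real_or_complex) vbundle
    \<Rightarrow> ('x, 'a, 'p, 'e) vb_chart \<Rightarrow> ('x, 'a, 'p, 'e) vb_chart \<Rightarrow> bool" where
  "vb_compatible E = (\<lambda>(V, \<phi>, \<eta>) (W, \<psi>, \<theta>).
     compatible (total_chart E (V, \<phi>, \<eta>)) (total_chart E (W, \<psi>, \<theta>)) \<and>
     (\<forall>p\<in>V \<inter> W. Vector_Spaces.linear (smul E) (smul E) (\<lambda>\<xi>. \<theta> (vb_point E (V, \<phi>, \<eta>) (\<phi> p) \<xi>))))"

text \<open>The smooth structure of the total space and the vector space structure of the fibers are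
  those induced by the vector bundle charts; the total space is then automatically Hausdorff and
  paracompact.\<close>

definition vector_bundle ::
  "('x, 'a::fin_dim_normed, 'p, 'e::fin_dim_normed, 'k::real_or_complex) vbundle \<Rightarrow> bool" where
  "vector_bundle E \<longleftrightarrow>
     smooth_manifold (base E) \<and> scalar_mult (smul E) \<and>
     continuous_map (total E) (points (base E)) (proj E) \<and>
     (\<forall>c\<in>vb_charts E. is_vb_chart E c) \<and>
     topspace (points (base E)) = (\<Union>(V, \<phi>, \<eta>)\<in>vb_charts E. V) \<and>
     (\<forall>c\<in>vb_charts E. \<forall>d\<in>vb_charts E. vb_compatible E c d) \<and>
     (\<forall>c. is_vb_chart E c \<and> (\<forall>d\<in>vb_charts E. vb_compatible E c d) \<longrightarrow> c \<in> vb_charts E)"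

abbreviation total_charts ::
  "('x, 'a, 'p, 'e, 'k) vbundle \<Rightarrow> ('p, 'a \<times> 'e) chart set" where
  "total_charts E \<equiv> total_chart E ` vb_charts E"

definition vb_zero ::
  "('x, 'a, 'p, 'e::fin_dim_normed, 'k) vbundle \<Rightarrow> 'x \<Rightarrow> 'p" where
  "vb_zero E p = (THE z. z \<in> topspace (total E) \<and> proj E z = p \<and>
     (\<forall>(V, \<phi>, \<eta>)\<in>vb_charts E. p \<in> V \<longrightarrow> \<eta> z = 0))"

definition vb_minus ::
  "('x, 'a, 'p, 'e::fin_dim_normed, 'k) vbundle \<Rightarrow> 'p \<Rightarrow> 'p \<Rightarrow> 'p" where
  "vb_minus E z z' = (THE w. w \<in> topspace (total E) \<and> proj E w = proj E z \<and>
     (\<forall>(V, \<phi>, \<eta>)\<in>vb_charts E. proj E z \<in> V \<longrightarrow> \<eta> w = \<eta> z - \<eta> z'))"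

text \<open>Fiber metrics are smoothly varying real inner products on the fibers; for complex bundles
  this includes the real parts of Hermitian metrics, which induce the same norms. The value
  \<open>h z z'\<close> is only relevant if \<open>z\<close> and \<open>z'\<close> lie in the same fiber.\<close>

definition fiber_metric ::
  "('x, 'a::fin_dim_normed, 'p, 'e::fin_dim_normed, 'k) vbundle \<Rightarrow> ('p \<Rightarrow> 'p \<Rightarrow> real) \<Rightarrow> bool" where
  "fiber_metric E h \<longleftrightarrow>
     (\<forall>(V, \<phi>, \<eta>)\<in>vb_charts E. \<exists>H :: 'a \<Rightarrow> 'e \<Rightarrow>\<^sub>L 'e \<Rightarrow>\<^sub>L real.
        smooth_on (\<phi> ` V) H \<and> (\<forall>x\<in>\<phi> ` V. inner_form (H x)) \<and>
        (\<forall>z\<in>over E V. \<forall>z'\<in>over E V. proj E z = proj E z' \<longrightarrow>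
           h z z' = H (\<phi> (proj E z)) (\<eta> z) (\<eta> z')))"

definition fiber_norm :: "('p \<Rightarrow> 'p \<Rightarrow> real) \<Rightarrow> 'p \<Rightarrow> real" where
  "fiber_norm h z = sqrt (h z z)"

definition sections ::
  "('x, 'a::fin_dim_normed, 'p, 'e::fin_dim_normed, 'k) vbundle \<Rightarrow> ('x \<Rightarrow> 'p) set" where
  "sections E = {s. smooth_map (points (base E)) (charts (base E)) (total E) (total_charts E) s \<and>
     (\<forall>p\<in>topspace (points (base E)). proj E (s p) = p)}"

text \<open>Linear differential operators (of finite order). In every vector bundle chart they are finite
  sums of iterated directional derivatives with smooth coefficients with values in the linear
  endomorphisms of the typical fiber; in particular they are linear.\<close>

definition diff_operators ::
  "('x, 'a::fin_dim_normed, 'p, 'e::fin_dim_normed, 'k::real_or_complex) vbundle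
    \<Rightarrow> (('x \<Rightarrow> 'p) \<Rightarrow> ('x \<Rightarrow> 'p)) set" where
  "diff_operators E = {P. (\<forall>s\<in>sections E. P s \<in> sections E) \<and>
     (\<exists>k. \<forall>(V, \<phi>, \<eta>)\<in>vb_charts E. \<exists>D (a :: 'a list \<Rightarrow> 'a \<Rightarrow> 'e \<Rightarrow> 'e).
        finite D \<and> (\<forall>vs\<in>D. length vs \<le> k) \<and>
        (\<forall>vs\<in>D. (\<forall>x\<in>\<phi> ` V. Vector_Spaces.linear (smul E) (smul E) (a vs x)) \<and>
                (\<forall>\<xi>. smooth_on (\<phi> ` V) (\<lambda>x. a vs x \<xi>))) \<and>
        (\<forall>s\<in>sections E. \<forall>p\<in>V.
           \<eta> (P s p) = (\<Sum>vs\<in>D. a vs (\<phi> p) (iter_deriv (\<eta> \<circ> s \<circ> inv_into V \<phi>) vs (\<phi> p)))))}"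

text \<open>The induced base map of a fiber preserving map.\<close>

definition base_map ::
  "('x, 'a, 'p, 'e::fin_dim_normed, 'k) vbundle \<Rightarrow> ('y, 'b, 'q, 'f, 'k) vbundle
    \<Rightarrow> ('p \<Rightarrow> 'q) \<Rightarrow> 'x \<Rightarrow> 'y" where
  "base_map E F f p = proj F (f (vb_zero E p))"

text \<open>\<open>hom_rep E F c d f x \<xi>\<close> is the fiber component \<open>f\<^sup>(\<^sup>2\<^sup>)(x) \<cdot> \<xi>\<close> of the representative of \<open>f\<close> in
  the vector bundle charts \<open>c\<close> and \<open>d\<close>.\<close>

definition hom_rep ::
  "('x, 'a, 'p, 'e, 'k) vbundle \<Rightarrow> ('y, 'b, 'q, 'f, 'k) vbundle \<Rightarrow>
   ('x, 'a, 'p, 'e) vb_chart \<Rightarrow> ('y, 'b, 'q, 'f) vb_chart \<Rightarrow> ('p \<Rightarrow> 'q) \<Rightarrow> 'a \<Rightarrow> 'e \<Rightarrow> 'f" where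
  "hom_rep E F c d f x \<xi> = snd (snd d) (f (vb_point E c x \<xi>))"

definition vb_homs ::
  "('x, 'a::fin_dim_normed, 'p, 'e::fin_dim_normed, 'k::real_or_complex) vbundle \<Rightarrow>
   ('y, 'b::fin_dim_normed, 'q, 'f::fin_dim_normed, 'k) vbundle \<Rightarrow> ('p \<Rightarrow> 'q) set" where
  "vb_homs E F = {f. smooth_map (total E) (total_charts E) (total F) (total_charts F) f \<and>
     (\<forall>z\<in>topspace (total E). proj F (f z) = base_map E F f (proj E z)) \<and>
     (\<forall>(V, \<phi>, \<eta>)\<in>vb_charts E. \<forall>(W, \<psi>, \<theta>)\<in>vb_charts F. \<forall>p\<in>V. base_map E F f p \<in> W \<longrightarrow>
        Vector_Spaces.linear (smul E) (smul F) (hom_rep E F (V, \<phi>, \<eta>) (W, \<psi>, \<theta>) f (\<phi> p)))}"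


section \<open>Nets\<close>

text \<open>Nets indexed by \<open>I = (0,1]\<close> are functions on \<^typ>\<open>real\<close> of which only the values at
  \<open>\<epsilon> \<in> I\<close> matter, and conditions "for all small \<open>\<epsilon>\<close>" are stated as
  \<open>\<forall>\<^sub>F \<epsilon> in at_right 0\<close>. The Riemannian metrics \<open>g\<close> and fiber metrics \<open>h\<close> on which the
  definitions below formally depend are parameters; the resulting notions do not depend on their
  choice.\<close>

abbreviation idx :: "real set" where "idx \<equiv> {0<..1}"

definition net_bigo :: "(real \<Rightarrow> ennreal) \<Rightarrow> (real \<Rightarrow> real) \<Rightarrow> bool" where
  "net_bigo f b \<longleftrightarrow> (\<exists>C>0. \<forall>\<^sub>F \<epsilon> in at_right 0. f \<epsilon> \<le> ennreal (C * b \<epsilon>))"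

definition moderate :: "(real \<Rightarrow> ennreal) \<Rightarrow> bool" where
  "moderate f \<longleftrightarrow> (\<exists>N::nat. net_bigo f (\<lambda>\<epsilon>. 1 / \<epsilon> ^ N))"

definition negligible_net :: "(real \<Rightarrow> ennreal) \<Rightarrow> bool" where
  "negligible_net f \<longleftrightarrow> (\<forall>m::nat. net_bigo f (\<lambda>\<epsilon>. \<epsilon> ^ m))"


section \<open>Manifold-valued generalized functions\<close>

definition moderate_maps ::
  "('x, 'a::fin_dim_normed) manifold \<Rightarrow> ('y, 'b::fin_dim_normed) manifold
    \<Rightarrow> (real \<Rightarrow> 'x \<Rightarrow> 'y) set" where
  "moderate_maps X Y = {u.
     (\<forall>\<epsilon>\<in>idx. smooth_map (points X) (charts X) (points Y) (charts Y) (u \<epsilon>)) \<and>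
     (\<forall>K. compactin (points X) K \<longrightarrow>
        (\<exists>K'. compactin (points Y) K' \<and> (\<forall>\<^sub>F \<epsilon> in at_right 0. u \<epsilon> ` K \<subseteq> K'))) \<and>
     (\<forall>k\<ge>1. \<forall>(V, \<phi>)\<in>charts X. \<forall>(W, \<psi>)\<in>charts Y. \<forall>L L'.
        compact_in (points X) L V \<and> compact_in (points Y) L' W \<longrightarrow>
        moderate (\<lambda>\<epsilon>. SUP p \<in> L \<inter> u \<epsilon> -` L'. deriv_norm k (\<psi> \<circ> u \<epsilon> \<circ> inv_into V \<phi>) (\<phi> p)))}"

text \<open>The relation \<open>\<sim>\<close> is obtained for \<open>J = UNIV\<close>, the relation \<open>\<sim>\<^sub>0\<close> for \<open>J = {0}\<close>, where \<open>J\<close> is the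
  set of orders of derivatives in condition (ii).\<close>

definition maps_equiv ::
  "('x, 'a::fin_dim_normed) manifold \<Rightarrow> ('y, 'b::fin_dim_normed) manifold \<Rightarrow>
   ('y, 'b) metric_tensor \<Rightarrow> nat set \<Rightarrow> (real \<Rightarrow> 'x \<Rightarrow> 'y) \<Rightarrow> (real \<Rightarrow> 'x \<Rightarrow> 'y) \<Rightarrow> bool" where
  "maps_equiv X Y g J u v \<longleftrightarrow>
     (\<forall>K. compactin (points X) K \<longrightarrow>
        ((\<lambda>\<epsilon>. SUP p\<in>K. riem_dist Y g (u \<epsilon> p) (v \<epsilon> p)) \<longlongrightarrow> 0) (at_right 0)) \<and>
     (\<forall>k\<in>J. \<forall>(V, \<phi>)\<in>charts X. \<forall>(W, \<psi>)\<in>charts Y. \<forall>L L'.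
        compact_in (points X) L V \<and> compact_in (points Y) L' W \<longrightarrow>
        negligible_net (\<lambda>\<epsilon>. SUP p \<in> L \<inter> u \<epsilon> -` L' \<inter> v \<epsilon> -` L'.
          deriv_norm k (\<lambda>x. (\<psi> \<circ> u \<epsilon> \<circ> inv_into V \<phi>) x - (\<psi> \<circ> v \<epsilon> \<circ> inv_into V \<phi>) x) (\<phi> p)))"


section \<open>Generalized vector bundle homomorphisms\<close>

definition moderate_homs ::
  "('x, 'a::fin_dim_normed, 'p, 'e::fin_dim_normed, 'k::real_or_complex) vbundle \<Rightarrow>
   ('y, 'b::fin_dim_normed, 'q, 'f::fin_dim_normed, 'k) vbundle \<Rightarrow> (real \<Rightarrow> 'p \<Rightarrow> 'q) set" where
  "moderate_homs E F = {u.
     (\<forall>\<epsilon>\<in>idx. u \<epsilon> \<in> vb_homs E F) \<and>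
     (\<lambda>\<epsilon>. base_map E F (u \<epsilon>)) \<in> moderate_maps (base E) (base F) \<and>
     (\<forall>k. \<forall>(V, \<phi>, \<eta>)\<in>vb_charts E. \<forall>(W, \<psi>, \<theta>)\<in>vb_charts F. \<forall>L L'.
        compact_in (points (base E)) L V \<and> compact_in (points (base F)) L' W \<longrightarrow>
        moderate (\<lambda>\<epsilon>. SUP p \<in> L \<inter> base_map E F (u \<epsilon>) -` L'.
          hom_deriv_norm k (hom_rep E F (V, \<phi>, \<eta>) (W, \<psi>, \<theta>) (u \<epsilon>)) (\<phi> p)))}"

text \<open>The relation \<open>\<sim>\<^sub>v\<^sub>b\<close> is obtained for \<open>J = UNIV\<close>, the relation \<open>\<sim>\<^sub>v\<^sub>b\<^sub>0\<close> for \<open>J = {0}\<close>.\<close>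

definition homs_equiv ::
  "('x, 'a::fin_dim_normed, 'p, 'e::fin_dim_normed, 'k::real_or_complex) vbundle \<Rightarrow>
   ('y, 'b::fin_dim_normed, 'q, 'f::fin_dim_normed, 'k) vbundle \<Rightarrow>
   ('y, 'b) metric_tensor \<Rightarrow> nat set \<Rightarrow> (real \<Rightarrow> 'p \<Rightarrow> 'q) \<Rightarrow> (real \<Rightarrow> 'p \<Rightarrow> 'q) \<Rightarrow> bool" where
  "homs_equiv E F g J u v \<longleftrightarrow>
     maps_equiv (base E) (base F) g J (\<lambda>\<epsilon>. base_map E F (u \<epsilon>)) (\<lambda>\<epsilon>. base_map E F (v \<epsilon>)) \<and>
     (\<forall>k\<in>J. \<forall>(V, \<phi>, \<eta>)\<in>vb_charts E. \<forall>(W, \<psi>, \<theta>)\<in>vb_charts F. \<forall>L L'.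
        compact_in (points (base E)) L V \<and> compact_in (points (base F)) L' W \<longrightarrow>
        negligible_net (\<lambda>\<epsilon>. SUP p \<in> L \<inter> base_map E F (u \<epsilon>) -` L' \<inter> base_map E F (v \<epsilon>) -` L'.
          hom_deriv_norm k (\<lambda>x \<xi>. hom_rep E F (V, \<phi>, \<eta>) (W, \<psi>, \<theta>) (u \<epsilon>) x \<xi>
                                - hom_rep E F (V, \<phi>, \<eta>) (W, \<psi>, \<theta>) (v \<epsilon>) x \<xi>) (\<phi> p)))"

definition vb_equiv ::
  "('x, 'a::fin_dim_normed, 'p, 'e::fin_dim_normed, 'k::real_or_complex) vbundle \<Rightarrow>
   ('y, 'b::fin_dim_normed, 'q, 'f::fin_dim_normed, 'k) vbundle \<Rightarrow>
   ('y, 'b) metric_tensor \<Rightarrow> ((real \<Rightarrow> 'p \<Rightarrow> 'q) \<times> (real \<Rightarrow> 'p \<Rightarrow> 'q)) set" where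
  "vb_equiv E F g =
     {(u, v). u \<in> moderate_homs E F \<and> v \<in> moderate_homs E F \<and> homs_equiv E F g UNIV u v}"

text \<open>Elements of the quotient \<open>Hom\<^sub>\<G>[E,F]\<close> are classes \<open>hom_class E F g u\<close> of moderate nets \<open>u\<close>.\<close>

definition hom_class ::
  "('x, 'a::fin_dim_normed, 'p, 'e::fin_dim_normed, 'k::real_or_complex) vbundle \<Rightarrow>
   ('y, 'b::fin_dim_normed, 'q, 'f::fin_dim_normed, 'k) vbundle \<Rightarrow>
   ('y, 'b) metric_tensor \<Rightarrow> (real \<Rightarrow> 'p \<Rightarrow> 'q) \<Rightarrow> (real \<Rightarrow> 'p \<Rightarrow> 'q) set" where
  "hom_class E F g u = vb_equiv E F g `` {u}"


section \<open>Generalized sections\<close>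

definition moderate_sections ::
  "('x, 'a::fin_dim_normed, 'p, 'e::fin_dim_normed, 'k::real_or_complex) vbundle \<Rightarrow>
   ('p \<Rightarrow> 'p \<Rightarrow> real) \<Rightarrow> (real \<Rightarrow> 'x \<Rightarrow> 'p) set" where
  "moderate_sections E h = {s. (\<forall>\<epsilon>\<in>idx. s \<epsilon> \<in> sections E) \<and>
     (\<forall>P\<in>diff_operators E. \<forall>K. compactin (points (base E)) K \<longrightarrow>
        moderate (\<lambda>\<epsilon>. SUP p\<in>K. ennreal (fiber_norm h (P (s \<epsilon>) p))))}"

definition negligible_sections ::
  "('x, 'a::fin_dim_normed, 'p, 'e::fin_dim_normed, 'k::real_or_complex) vbundle \<Rightarrow>
   ('p \<Rightarrow> 'p \<Rightarrow> real) \<Rightarrow> (real \<Rightarrow> 'x \<Rightarrow> 'p) set" where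
  "negligible_sections E h = {s \<in> moderate_sections E h.
     \<forall>K. compactin (points (base E)) K \<longrightarrow>
        negligible_net (\<lambda>\<epsilon>. SUP p\<in>K. ennreal (fiber_norm h (s \<epsilon> p)))}"

definition section_equiv ::
  "('x, 'a::fin_dim_normed, 'p, 'e::fin_dim_normed, 'k::real_or_complex) vbundle \<Rightarrow>
   ('p \<Rightarrow> 'p \<Rightarrow> real) \<Rightarrow> ((real \<Rightarrow> 'x \<Rightarrow> 'p) \<times> (real \<Rightarrow> 'x \<Rightarrow> 'p)) set" where
  "section_equiv E h = {(s, t). s \<in> moderate_sections E h \<and> t \<in> moderate_sections E h \<and>
     (\<lambda>\<epsilon> p. vb_minus E (s \<epsilon> p) (t \<epsilon> p)) \<in> negligible_sections E h}"

definition gen_sections ::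
  "('x, 'a::fin_dim_normed, 'p, 'e::fin_dim_normed, 'k::real_or_complex) vbundle \<Rightarrow>
   ('p \<Rightarrow> 'p \<Rightarrow> real) \<Rightarrow> (real \<Rightarrow> 'x \<Rightarrow> 'p) set set" where
  "gen_sections E h = moderate_sections E h // section_equiv E h"

definition gen_section_zero ::
  "('x, 'a::fin_dim_normed, 'p, 'e::fin_dim_normed, 'k::real_or_complex) vbundle \<Rightarrow>
   ('p \<Rightarrow> 'p \<Rightarrow> real) \<Rightarrow> (real \<Rightarrow> 'x \<Rightarrow> 'p) set" where
  "gen_section_zero E h = section_equiv E h `` {\<lambda>\<epsilon> p. vb_zero E p}"


section \<open>Generalized points\<close>

definition point_nets :: "('x, 'a::fin_dim_normed) manifold \<Rightarrow> (real \<Rightarrow> 'x) set" where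
  "point_nets X = {p. (\<forall>\<epsilon>\<in>idx. p \<epsilon> \<in> topspace (points X)) \<and>
     (\<exists>K. compactin (points X) K \<and> (\<forall>\<^sub>F \<epsilon> in at_right 0. p \<epsilon> \<in> K))}"

definition point_close ::
  "('x, 'a::fin_dim_normed) manifold \<Rightarrow> ('x, 'a) metric_tensor
    \<Rightarrow> (real \<Rightarrow> 'x) \<Rightarrow> (real \<Rightarrow> 'x) \<Rightarrow> bool" where
  "point_close X g p q \<longleftrightarrow> negligible_net (\<lambda>\<epsilon>. riem_dist X g (p \<epsilon>) (q \<epsilon>))"

definition point_equiv ::
  "('x, 'a::fin_dim_normed) manifold \<Rightarrow> ('x, 'a) metric_tensor
    \<Rightarrow> ((real \<Rightarrow> 'x) \<times> (real \<Rightarrow> 'x)) set" where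
  "point_equiv X g = {(p, q). p \<in> point_nets X \<and> q \<in> point_nets X \<and> point_close X g p q}"

definition gen_points ::
  "('x, 'a::fin_dim_normed) manifold \<Rightarrow> ('x, 'a) metric_tensor \<Rightarrow> (real \<Rightarrow> 'x) set set" where
  "gen_points X g = point_nets X // point_equiv X g"


section \<open>Generalized vector bundle points\<close>

definition vb_moderate ::
  "('x, 'a::fin_dim_normed, 'p, 'e::fin_dim_normed, 'k) vbundle \<Rightarrow> ('p \<Rightarrow> 'p \<Rightarrow> real)
    \<Rightarrow> (real \<Rightarrow> 'p) set" where
  "vb_moderate E h = {e. (\<forall>\<epsilon>\<in>idx. e \<epsilon> \<in> topspace (total E)) \<and>
     (\<exists>K. compactin (points (base E)) K \<and> (\<forall>\<^sub>F \<epsilon> in at_right 0. proj E (e \<epsilon>) \<in> K)) \<and>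
     (\<exists>N::nat. \<exists>C>0. \<forall>\<^sub>F \<epsilon> in at_right 0. fiber_norm h (e \<epsilon>) \<le> C / \<epsilon> ^ N)}"

definition vb_point_equiv ::
  "('x, 'a::fin_dim_normed, 'p, 'e::fin_dim_normed, 'k) vbundle \<Rightarrow> ('x, 'a) metric_tensor
    \<Rightarrow> ('p \<Rightarrow> 'p \<Rightarrow> real) \<Rightarrow> ((real \<Rightarrow> 'p) \<times> (real \<Rightarrow> 'p)) set" where
  "vb_point_equiv E g h = {(e, e'). e \<in> vb_moderate E h \<and> e' \<in> vb_moderate E h \<and>
     point_close (base E) g (\<lambda>\<epsilon>. proj E (e \<epsilon>)) (\<lambda>\<epsilon>. proj E (e' \<epsilon>)) \<and>
     (\<forall>m::nat. \<forall>(W, \<psi>, \<theta>)\<in>vb_charts E. \<forall>L'. compact_in (points (base E)) L' W \<longrightarrow>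
        (\<exists>C>0. \<forall>\<^sub>F \<epsilon> in at_right 0. proj E (e \<epsilon>) \<in> L' \<and> proj E (e' \<epsilon>) \<in> L' \<longrightarrow>
           norm (\<theta> (e \<epsilon>) - \<theta> (e' \<epsilon>)) \<le> C * \<epsilon> ^ m))}"

definition vb_class ::
  "('x, 'a::fin_dim_normed, 'p, 'e::fin_dim_normed, 'k) vbundle \<Rightarrow> ('x, 'a) metric_tensor
    \<Rightarrow> ('p \<Rightarrow> 'p \<Rightarrow> real) \<Rightarrow> (real \<Rightarrow> 'p) \<Rightarrow> (real \<Rightarrow> 'p) set" where
  "vb_class E g h e = vb_point_equiv E g h `` {e}"

definition gen_vb_points ::
  "('x, 'a::fin_dim_normed, 'p, 'e::fin_dim_normed, 'k) vbundle \<Rightarrow> ('x, 'a) metric_tensor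
    \<Rightarrow> ('p \<Rightarrow> 'p \<Rightarrow> real) \<Rightarrow> (real \<Rightarrow> 'p) set set" where
  "gen_vb_points E g h = vb_moderate E h // vb_point_equiv E g h"


section \<open>Point values\<close>

text \<open>Operations on classes are lifted as in \<^theory>\<open>HOL.Equiv_Relations\<close>: the union of the
  classes obtained from all representatives. Point values being well defined, all of these classes
  coincide, so the union is the class obtained from any representatives.\<close>

definition section_value ::
  "('x, 'a::fin_dim_normed, 'p, 'e::fin_dim_normed, 'k) vbundle \<Rightarrow> ('x, 'a) metric_tensor \<Rightarrow>
   ('p \<Rightarrow> 'p \<Rightarrow> real) \<Rightarrow> (real \<Rightarrow> 'x \<Rightarrow> 'p) set \<Rightarrow> (real \<Rightarrow> 'x) set \<Rightarrow> (real \<Rightarrow> 'p) set" where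
  "section_value E g h u P = (\<Union>s\<in>u. \<Union>p\<in>P. vb_class E g h (\<lambda>\<epsilon>. s \<epsilon> (p \<epsilon>)))"

definition zero_value ::
  "('x, 'a::fin_dim_normed, 'p, 'e::fin_dim_normed, 'k) vbundle \<Rightarrow> ('x, 'a) metric_tensor \<Rightarrow>
   ('p \<Rightarrow> 'p \<Rightarrow> real) \<Rightarrow> (real \<Rightarrow> 'x) set \<Rightarrow> (real \<Rightarrow> 'p) set" where
  "zero_value E g h P = (\<Union>p\<in>P. vb_class E g h (\<lambda>\<epsilon>. vb_zero E (p \<epsilon>)))"

definition base_localized ::
  "('x, 'a::fin_dim_normed, 'p, 'e::fin_dim_normed, 'k) vbundle \<Rightarrow>
   ('y, 'b::fin_dim_normed, 'q, 'f::fin_dim_normed, 'k) vbundle \<Rightarrow> (real \<Rightarrow> 'p \<Rightarrow> 'q) \<Rightarrow> bool" where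
  "base_localized E F w \<longleftrightarrow> (\<forall>K. compactin (points (base E)) K \<longrightarrow>
     (\<exists>\<epsilon>\<^sub>0>0. \<exists>(W, \<psi>, \<theta>)\<in>vb_charts F.
        compact_in (points (base F))
          (points (base F) closure_of (\<Union>\<epsilon>\<in>idx \<inter> {..<\<epsilon>\<^sub>0}. base_map E F (w \<epsilon>) ` K)) W))"

definition hom_value ::
  "('x, 'a::fin_dim_normed, 'p, 'e::fin_dim_normed, 'k) vbundle \<Rightarrow>
   ('y, 'b::fin_dim_normed, 'q, 'f::fin_dim_normed, 'k) vbundle \<Rightarrow>
   ('y, 'b) metric_tensor \<Rightarrow> ('q \<Rightarrow> 'q \<Rightarrow> real) \<Rightarrow>
   (real \<Rightarrow> 'p \<Rightarrow> 'q) set \<Rightarrow> (real \<Rightarrow> 'p) set \<Rightarrow> (real \<Rightarrow> 'q) set" where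
  "hom_value E F g h v P =
     (\<Union>w\<in>{w \<in> v. base_localized E F w}. \<Union>e\<in>P. vb_class F g h (\<lambda>\<epsilon>. w \<epsilon> (e \<epsilon>)))"

end

theory Submission
  imports Defs
begin

text \<open>Two observations carry the proof. First, on a compact subset of a chart the Riemannian distance
  is comparable to the distance of coordinates, and points that are close to the compact set stay in a
  slightly larger one; so all conditions can be read off in charts, and equivalent nets of points that
  remain in one chart are just nets with negligibly close coordinates. Second, a supremum over a
  compact set is negligible as soon as the values along every net selected from that set are, since a
  net can be chosen that almost attains the supremum.

  For sections this gives the claim directly. For homomorphisms, the point value does not depend on
  the representatives: changing the point costs a moderate derivative times a negligible distance,
  estimated along a segment in a chart of the source, and changing the homomorphism is controlled by
  the zeroth order condition alone. The latter estimate is one implication; the selected nets of zero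
  vectors and of vectors in the unit ball of a chart give the converse.\<close>

section \<open>Moderate and negligible nets\<close>

text \<open>A net of points in a compact set can change charts again and again as \<epsilon> tends
  to 0, so no single chart describes it. Every estimate is therefore made only for those \<epsilon>
  at which the points lie in a fixed compact part of one chart, and finitely many such estimates are
  glued. An estimate along a segment also needs the whole segment inside the set on which
  derivatives are bounded; hence the enlarged compact sets come with balls contained in their
  coordinate images.

  In the target, equivalence of bundle points compares fiber components only if both base points lie
  in one compact part of a chart. \<open>base_localized\<close> provides a chart of \<open>F\<close>
  that contains, for small \<epsilon>, all base values of one net over a compact set; closeness of
  the base maps forces the other net into the same chart. The comparison of
  \<open>v \<epsilon> (e \<epsilon>)\<close> with \<open>w \<epsilon> (e' \<epsilon>)\<close> goes
  through the representative of \<open>v\<close> at the base point of \<open>e' \<epsilon>\<close>,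
  so that \<open>w\<close> is never differentiated; this is why the zeroth order relation
  suffices.\<close>

definition negl_on :: "(real \<Rightarrow> bool) \<Rightarrow> (real \<Rightarrow> real) \<Rightarrow> bool" where
  "negl_on P r \<longleftrightarrow> (\<forall>m::nat. \<exists>C>0. \<forall>\<^sub>F \<epsilon> in at_right 0. P \<epsilon> \<longrightarrow> r \<epsilon> \<le> C * \<epsilon> ^ m)"

text \<open>In both predicates the condition \<open>P\<close> is typically that a point of the net
  lies in a given compact set; along the other \<epsilon> the bound says nothing. The nets are real
  and bounded from above only, so products ask for nonnegativity separately. This keeps the
  arithmetic out of \<open>ennreal\<close>, to which one returns only for suprema.\<close>

definition mod_on :: "(real \<Rightarrow> bool) \<Rightarrow> (real \<Rightarrow> real) \<Rightarrow> bool" where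
  "mod_on P r \<longleftrightarrow> (\<exists>N::nat. \<exists>C>0. \<forall>\<^sub>F \<epsilon> in at_right 0. P \<epsilon> \<longrightarrow> r \<epsilon> \<le> C / \<epsilon> ^ N)"

lemma eventually_idx: "\<forall>\<^sub>F \<epsilon> in at_right (0::real). \<epsilon> \<in> idx"
  unfolding eventually_at_right_field by (auto intro!: exI[of _ 1])

section \<open>Arithmetic of conditional bounds\<close>

lemma negl_on_mono:
  assumes "negl_on P r" and "\<forall>\<^sub>F \<epsilon> in at_right 0. P' \<epsilon> \<longrightarrow> P \<epsilon> \<and> r' \<epsilon> \<le> r \<epsilon>"
  shows "negl_on P' r'"
  unfolding negl_on_def
proof
  fix m :: nat
  obtain C where C: "C > 0" "\<forall>\<^sub>F \<epsilon> in at_right 0. P \<epsilon> \<longrightarrow> r \<epsilon> \<le> C * \<epsilon> ^ m"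
    using assms(1) unfolding negl_on_def by blast
  show "\<exists>C>0. \<forall>\<^sub>F \<epsilon> in at_right 0. P' \<epsilon> \<longrightarrow> r' \<epsilon> \<le> C * \<epsilon> ^ m"
    by (rule exI[of _ C], rule conjI[OF C(1)], use C(2) assms(2) in eventually_elim) auto
qed

lemma mod_on_mono:
  assumes "mod_on P r" and "\<forall>\<^sub>F \<epsilon> in at_right 0. P' \<epsilon> \<longrightarrow> P \<epsilon> \<and> r' \<epsilon> \<le> r \<epsilon>"
  shows "mod_on P' r'"
proof -
  obtain N C where C: "C > 0" "\<forall>\<^sub>F \<epsilon> in at_right 0. P \<epsilon> \<longrightarrow> r \<epsilon> \<le> C / \<epsilon> ^ N"
    using assms(1) unfolding mod_on_def by blast
  have "\<forall>\<^sub>F \<epsilon> in at_right 0. P' \<epsilon> \<longrightarrow> r' \<epsilon> \<le> C / \<epsilon> ^ N"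
    using C(2) assms(2) by eventually_elim auto
  then show ?thesis
    unfolding mod_on_def using C(1) by blast
qed

lemma negl_on_add:
  assumes "negl_on P r" and "negl_on P s"
  shows "negl_on P (\<lambda>\<epsilon>. r \<epsilon> + s \<epsilon>)"
  unfolding negl_on_def
proof
  fix m :: nat
  obtain C where C: "C > 0" "\<forall>\<^sub>F \<epsilon> in at_right 0. P \<epsilon> \<longrightarrow> r \<epsilon> \<le> C * \<epsilon> ^ m"
    using assms(1) unfolding negl_on_def by blast
  obtain D where D: "D > 0" "\<forall>\<^sub>F \<epsilon> in at_right 0. P \<epsilon> \<longrightarrow> s \<epsilon> \<le> D * \<epsilon> ^ m"
    using assms(2) unfolding negl_on_def by blast
  have "\<forall>\<^sub>F \<epsilon> in at_right 0. P \<epsilon> \<longrightarrow> r \<epsilon> + s \<epsilon> \<le> (C + D) * \<epsilon> ^ m"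
    using C(2) D(2) by eventually_elim (auto simp: distrib_right)
  then show "\<exists>C>0. \<forall>\<^sub>F \<epsilon> in at_right 0. P \<epsilon> \<longrightarrow> r \<epsilon> + s \<epsilon> \<le> C * \<epsilon> ^ m"
    using C(1) D(1) by (intro exI[of _ "C + D"]) auto
qed

lemma negl_on_mod_mult:
  assumes s: "mod_on P s" and r: "negl_on P r"
    and "\<And>\<epsilon>. 0 \<le> r \<epsilon>"
  shows "negl_on P (\<lambda>\<epsilon>. s \<epsilon> * r \<epsilon>)"
  unfolding negl_on_def
proof
  fix m :: nat
  obtain N D where D: "D > 0" "\<forall>\<^sub>F \<epsilon> in at_right 0. P \<epsilon> \<longrightarrow> s \<epsilon> \<le> D / \<epsilon> ^ N"
    using s unfolding mod_on_def by blast
  \<comment> \<open>The exponent \<open>m + N\<close> pays for the growth of order \<open>N\<close>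
    of the moderate factor and leaves \<epsilon> to the power \<open>m\<close>.\<close>
  obtain C where C: "C > 0" "\<forall>\<^sub>F \<epsilon> in at_right 0. P \<epsilon> \<longrightarrow> r \<epsilon> \<le> C * \<epsilon> ^ (m + N)"
    using r unfolding negl_on_def by blast
  have "\<forall>\<^sub>F \<epsilon> in at_right 0. P \<epsilon> \<longrightarrow> s \<epsilon> * r \<epsilon> \<le> (D * C) * \<epsilon> ^ m"
    using C(2) D(2) eventually_idx
  proof eventually_elim
    case (elim \<epsilon>)
    show ?case
    proof
      assume "P \<epsilon>"
      then have "s \<epsilon> * r \<epsilon> \<le> (D / \<epsilon> ^ N) * (C * \<epsilon> ^ (m + N))"
        using elim assms(3) D(1) by (intro mult_mono) auto
      also have "\<dots> = (D * C) * \<epsilon> ^ m"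
        using elim by (auto simp: power_add field_simps)
      finally show "s \<epsilon> * r \<epsilon> \<le> (D * C) * \<epsilon> ^ m" .
    qed
  qed
  then show "\<exists>C>0. \<forall>\<^sub>F \<epsilon> in at_right 0. P \<epsilon> \<longrightarrow> s \<epsilon> * r \<epsilon> \<le> C * \<epsilon> ^ m"
    using C(1) D(1) by (intro exI[of _ "D * C"]) auto
qed

lemma mod_on_mult:
  assumes s: "mod_on P s" and r: "mod_on P r"
    and "\<And>\<epsilon>. 0 \<le> r \<epsilon>"
  shows "mod_on P (\<lambda>\<epsilon>. s \<epsilon> * r \<epsilon>)"
proof -
  obtain N D where D: "D > 0" "\<forall>\<^sub>F \<epsilon> in at_right 0. P \<epsilon> \<longrightarrow> s \<epsilon> \<le> D / \<epsilon> ^ N"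
    using s unfolding mod_on_def by blast
  obtain M C where C: "C > 0" "\<forall>\<^sub>F \<epsilon> in at_right 0. P \<epsilon> \<longrightarrow> r \<epsilon> \<le> C / \<epsilon> ^ M"
    using r unfolding mod_on_def by blast
  have "\<forall>\<^sub>F \<epsilon> in at_right 0. P \<epsilon> \<longrightarrow> s \<epsilon> * r \<epsilon> \<le> (D * C) / \<epsilon> ^ (N + M)"
    using C(2) D(2) eventually_idx
  proof eventually_elim
    case (elim \<epsilon>)
    show ?case
    proof
      assume "P \<epsilon>"
      then have "s \<epsilon> * r \<epsilon> \<le> (D / \<epsilon> ^ N) * (C / \<epsilon> ^ M)"
        using elim assms(3) D(1) by (intro mult_mono) auto
      then show "s \<epsilon> * r \<epsilon> \<le> (D * C) / \<epsilon> ^ (N + M)"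
        by (simp add: power_add)
    qed
  qed
  then show ?thesis
    unfolding mod_on_def using C(1) D(1) by (intro exI[of _ "N + M"] exI[of _ "D * C"]) auto
qed

lemma mod_on_const: "mod_on P (\<lambda>_. c)"
  unfolding mod_on_def by (rule exI[of _ 0], rule exI[of _ "\<bar>c\<bar> + 1"]) auto

lemma negl_on_zero: "negl_on P (\<lambda>_. 0)"
  unfolding negl_on_def
proof
  fix m :: nat
  have "\<forall>\<^sub>F \<epsilon> in at_right 0. P \<epsilon> \<longrightarrow> 0 \<le> (1::real) * \<epsilon> ^ m"
    using eventually_idx by eventually_elim simp
  then show "\<exists>C>0. \<forall>\<^sub>F \<epsilon> in at_right 0. P \<epsilon> \<longrightarrow> 0 \<le> (C::real) * \<epsilon> ^ m"
    using zero_less_one by blast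
qed

lemma negl_on_cmult:
  assumes "negl_on P r" and "\<And>\<epsilon>. 0 \<le> r \<epsilon>"
  shows "negl_on P (\<lambda>\<epsilon>. c * r \<epsilon>)"
  using negl_on_mod_mult[OF mod_on_const assms] .

text \<open>The gluing step for finitely many charts. Which condition \<open>Q i\<close> holds may
  change with \<epsilon>, but finiteness gives one constant for all of them and lets "for all small
  \<epsilon>" commute with the quantifier over \<open>I\<close>.\<close>

lemma negl_on_finite:
  assumes "finite I" and ev: "\<forall>\<^sub>F \<epsilon> in at_right 0. P \<epsilon> \<longrightarrow> (\<exists>i\<in>I. Q i \<epsilon>)"
    and "\<And>i. i \<in> I \<Longrightarrow> negl_on (Q i) r"
  shows "negl_on P r"
  unfolding negl_on_def
proof
  fix m :: nat
  have "\<forall>i. \<exists>C. i \<in> I \<longrightarrow> C > 0 \<and> (\<forall>\<^sub>F \<epsilon> in at_right 0. Q i \<epsilon> \<longrightarrow> r \<epsilon> \<le> C * \<epsilon> ^ m)"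
    using assms(3) unfolding negl_on_def by blast
  then obtain C where C: "\<And>i. i \<in> I \<Longrightarrow> C i > 0 \<and> (\<forall>\<^sub>F \<epsilon> in at_right 0. Q i \<epsilon> \<longrightarrow> r \<epsilon> \<le> C i * \<epsilon> ^ m)"
    by metis
  \<comment> \<open>The sum dominates each positive \<open>C i\<close>; the added 1 keeps
    \<open>D\<close> positive when \<open>I\<close> is empty.\<close>
  define D where "D = sum C I + 1"
  have D: "C i \<le> D" if "i \<in> I" for i
    using member_le_sum[OF that, of C] C \<open>finite I\<close> that unfolding D_def by (force simp: less_imp_le)
  have "D > 0"
    unfolding D_def using C by (intro add_nonneg_pos sum_nonneg) (auto simp: less_imp_le)
  have "\<forall>\<^sub>F \<epsilon> in at_right 0. \<forall>i\<in>I. Q i \<epsilon> \<longrightarrow> r \<epsilon> \<le> C i * \<epsilon> ^ m"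
    using \<open>finite I\<close> C by (simp add: eventually_ball_finite_distrib)
  with ev eventually_idx have "\<forall>\<^sub>F \<epsilon> in at_right 0. P \<epsilon> \<longrightarrow> r \<epsilon> \<le> D * \<epsilon> ^ m"
  proof eventually_elim
    case (elim \<epsilon>)
    then show ?case
      using D by (smt (verit, best) greaterThanAtMost_iff mult_right_mono zero_le_power)
  qed
  with \<open>D > 0\<close> show "\<exists>C>0. \<forall>\<^sub>F \<epsilon> in at_right 0. P \<epsilon> \<longrightarrow> r \<epsilon> \<le> C * \<epsilon> ^ m"
    by blast
qed

lemma negl_on_small:
  assumes "negl_on P r" and "\<delta> > 0"
  shows "\<forall>\<^sub>F \<epsilon> in at_right 0. P \<epsilon> \<longrightarrow> r \<epsilon> < \<delta>"
proof -
  obtain C where C: "C > 0" "\<forall>\<^sub>F \<epsilon> in at_right 0. P \<epsilon> \<longrightarrow> r \<epsilon> \<le> C * \<epsilon> ^ 1"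
    using assms(1) unfolding negl_on_def by blast
  have "\<forall>\<^sub>F \<epsilon> in at_right 0. \<epsilon> < \<delta> / C"
    using C(1) assms(2) unfolding eventually_at_right_field by (intro exI[of _ "\<delta> / C"]) auto
  with C(2) show ?thesis
    by eventually_elim (use C(1) in \<open>auto simp: field_simps\<close>)
qed

section \<open>Passing between extended real nets and real bounds\<close>

lemma negligible_netI:
  assumes "negl_on (\<lambda>_. True) r" and "\<forall>\<^sub>F \<epsilon> in at_right 0. f \<epsilon> \<le> ennreal (r \<epsilon>)"
  shows "negligible_net f"
  unfolding negligible_net_def net_bigo_def
proof
  fix m :: nat
  obtain C where C: "C > 0" "\<forall>\<^sub>F \<epsilon> in at_right 0. True \<longrightarrow> r \<epsilon> \<le> C * \<epsilon> ^ m"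
    using assms(1) unfolding negl_on_def by blast
  have "\<forall>\<^sub>F \<epsilon> in at_right 0. f \<epsilon> \<le> ennreal (C * \<epsilon> ^ m)"
    using C(2) assms(2) by eventually_elim (meson ennreal_leI order_trans)
  with C(1) show "\<exists>C>0. \<forall>\<^sub>F \<epsilon> in at_right 0. f \<epsilon> \<le> ennreal (C * \<epsilon> ^ m)"
    by blast
qed

lemma negligible_netD:
  assumes "negligible_net f" and "\<forall>\<^sub>F \<epsilon> in at_right 0. P \<epsilon> \<longrightarrow> ennreal (r \<epsilon>) \<le> f \<epsilon>"
  shows "negl_on P r"
  unfolding negl_on_def
proof
  fix m :: nat
  obtain C where C: "C > 0" "\<forall>\<^sub>F \<epsilon> in at_right 0. f \<epsilon> \<le> ennreal (C * \<epsilon> ^ m)"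
    using assms(1) unfolding negligible_net_def net_bigo_def by blast
  have "\<forall>\<^sub>F \<epsilon> in at_right 0. P \<epsilon> \<longrightarrow> r \<epsilon> \<le> C * \<epsilon> ^ m"
    using C(2) assms(2) eventually_idx
  proof eventually_elim
    case (elim \<epsilon>)
    then show ?case
      using C(1) by (metis ennreal_le_iff greaterThanAtMost_iff less_imp_le mult_nonneg_nonneg
          order_trans zero_le_power)
  qed
  with C(1) show "\<exists>C>0. \<forall>\<^sub>F \<epsilon> in at_right 0. P \<epsilon> \<longrightarrow> r \<epsilon> \<le> C * \<epsilon> ^ m"
    by blast
qed

lemma moderateD:
  assumes "moderate f" and "\<forall>\<^sub>F \<epsilon> in at_right 0. P \<epsilon> \<longrightarrow> ennreal (r \<epsilon>) \<le> f \<epsilon>"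
  shows "mod_on P r"
proof -
  obtain N C where C: "C > 0" "\<forall>\<^sub>F \<epsilon> in at_right 0. f \<epsilon> \<le> ennreal (C * (1 / \<epsilon> ^ N))"
    using assms(1) unfolding moderate_def net_bigo_def by blast
  have "\<forall>\<^sub>F \<epsilon> in at_right 0. P \<epsilon> \<longrightarrow> r \<epsilon> \<le> C / \<epsilon> ^ N"
    using C(2) assms(2) eventually_idx
  proof eventually_elim
    case (elim \<epsilon>)
    have "0 \<le> C * (1 / \<epsilon> ^ N)"
      using C(1) elim by auto
    with elim show ?case
      by (metis ennreal_le_iff order_trans mult.right_neutral times_divide_eq_right)
  qed
  with C(1) show ?thesis
    unfolding mod_on_def by blast
qed

lemma moderate_bound:
  assumes "moderate f"
  obtains M where "mod_on (\<lambda>_. True) M" "\<And>\<epsilon>. 0 \<le> M \<epsilon>" "\<forall>\<^sub>F \<epsilon> in at_right 0. f \<epsilon> \<le> ennreal (M \<epsilon>)"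
proof -
  obtain N C where C: "C > 0" "\<forall>\<^sub>F \<epsilon> in at_right 0. f \<epsilon> \<le> ennreal (C * (1 / \<epsilon> ^ N))"
    using assms(1) unfolding moderate_def net_bigo_def by blast
  \<comment> \<open>The absolute value makes the bound nonnegative for every real \<epsilon>, as the
    product rules demand, and changes nothing on \<open>idx\<close>.\<close>
  show ?thesis
  proof (rule that[of "\<lambda>\<epsilon>. C / \<bar>\<epsilon>\<bar> ^ N"])
    have "\<forall>\<^sub>F \<epsilon> in at_right 0. True \<longrightarrow> C / \<bar>\<epsilon>\<bar> ^ N \<le> C / \<epsilon> ^ N"
      using eventually_idx by eventually_elim auto
    then show "mod_on (\<lambda>_. True) (\<lambda>\<epsilon>. C / \<bar>\<epsilon>\<bar> ^ N)"
      unfolding mod_on_def using C(1) by blast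
    show "0 \<le> C / \<bar>\<epsilon>\<bar> ^ N" for \<epsilon>
      using C(1) by simp
    show "\<forall>\<^sub>F \<epsilon> in at_right 0. f \<epsilon> \<le> ennreal (C / \<bar>\<epsilon>\<bar> ^ N)"
      using C(2) eventually_idx by eventually_elim auto
  qed
qed

lemma moderateI:
  assumes "mod_on (\<lambda>_. True) r" and "\<forall>\<^sub>F \<epsilon> in at_right 0. f \<epsilon> \<le> ennreal (r \<epsilon>)"
  shows "moderate f"
proof -
  obtain N C where C: "C > 0" "\<forall>\<^sub>F \<epsilon> in at_right 0. True \<longrightarrow> r \<epsilon> \<le> C / \<epsilon> ^ N"
    using assms(1) unfolding mod_on_def by blast
  have "\<forall>\<^sub>F \<epsilon> in at_right 0. f \<epsilon> \<le> ennreal (C * (1 / \<epsilon> ^ N))"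
    using C(2) assms(2) by eventually_elim (simp, meson ennreal_leI order_trans)
  with C(1) show ?thesis
    unfolding moderate_def net_bigo_def by blast
qed

lemma mod_on_add:
  assumes "mod_on P r" and "mod_on P s"
  shows "mod_on P (\<lambda>\<epsilon>. r \<epsilon> + s \<epsilon>)"
proof -
  obtain N C where C: "C > 0" "\<forall>\<^sub>F \<epsilon> in at_right 0. P \<epsilon> \<longrightarrow> r \<epsilon> \<le> C / \<epsilon> ^ N"
    using assms(1) unfolding mod_on_def by blast
  obtain M D where D: "D > 0" "\<forall>\<^sub>F \<epsilon> in at_right 0. P \<epsilon> \<longrightarrow> s \<epsilon> \<le> D / \<epsilon> ^ M"
    using assms(2) unfolding mod_on_def by blast
  \<comment> \<open>For \<epsilon> \<le> 1 both bounds weaken to the common exponent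
    \<open>N + M\<close>.\<close>
  have "\<forall>\<^sub>F \<epsilon> in at_right 0. P \<epsilon> \<longrightarrow> r \<epsilon> + s \<epsilon> \<le> (C + D) / \<epsilon> ^ (N + M)"
    using C(2) D(2) eventually_idx
  proof eventually_elim
    case (elim \<epsilon>)
    then have "\<epsilon> ^ (N + M) \<le> \<epsilon> ^ N" "\<epsilon> ^ (N + M) \<le> \<epsilon> ^ M" "0 < \<epsilon> ^ (N + M)"
      by (auto intro: power_decreasing)
    then have "C / \<epsilon> ^ N \<le> C / \<epsilon> ^ (N + M)" "D / \<epsilon> ^ M \<le> D / \<epsilon> ^ (N + M)"
      using C(1) D(1) elim by (auto intro!: divide_left_mono mult_pos_pos)
    with elim show ?case
      unfolding add_divide_distrib by linarith
  qed
  then show ?thesis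
    unfolding mod_on_def using C(1) D(1) by (intro exI[of _ "N + M"] exI[of _ "C + D"]) auto
qed

lemma negligible_net_tendsto:
  assumes "negligible_net f"
  shows "(f \<longlongrightarrow> 0) (at_right 0)"
proof -
  obtain C where C: "C > 0" "\<forall>\<^sub>F \<epsilon> in at_right 0. f \<epsilon> \<le> ennreal (C * \<epsilon> ^ 1)"
    using assms unfolding negligible_net_def net_bigo_def by blast
  have "((\<lambda>\<epsilon>. C * \<epsilon> ^ 1) \<longlongrightarrow> C * 0 ^ 1) (at_right 0)"
    by (intro tendsto_intros)
  then have "((\<lambda>\<epsilon>. ennreal (C * \<epsilon> ^ 1)) \<longlongrightarrow> ennreal 0) (at_right 0)"
    by (intro tendsto_ennrealI) simp
  then show ?thesis
    by (intro tendsto_sandwich[OF _ C(2) tendsto_const]) auto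
qed

text \<open>One selection serves for all orders: take one that attains at least half of the supremum,
  truncated at 1 because the supremum may be infinite.\<close>

lemma negligible_net_SUP:
  fixes g :: "real \<Rightarrow> 's \<Rightarrow> ennreal"
  assumes "\<And>a. (\<And>\<epsilon>. A \<epsilon> \<noteq> {} \<Longrightarrow> a \<epsilon> \<in> A \<epsilon>) \<Longrightarrow>
      \<exists>r. negl_on (\<lambda>\<epsilon>. A \<epsilon> \<noteq> {}) r \<and> (\<forall>\<^sub>F \<epsilon> in at_right 0. A \<epsilon> \<noteq> {} \<longrightarrow> g \<epsilon> (a \<epsilon>) \<le> ennreal (r \<epsilon>))"
  shows "negligible_net (\<lambda>\<epsilon>. SUP a\<in>A \<epsilon>. g \<epsilon> a)"
proof -
  let ?f = "\<lambda>\<epsilon>. SUP a\<in>A \<epsilon>. g \<epsilon> a"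
  have "\<exists>a. A \<epsilon> \<noteq> {} \<longrightarrow> a \<in> A \<epsilon> \<and> min (?f \<epsilon>) 1 \<le> 2 * g \<epsilon> a" for \<epsilon>
  proof (cases "A \<epsilon> = {} \<or> ?f \<epsilon> = 0")
    case True
    then show ?thesis
      by (metis ex_in_conv min.coboundedI1 zero_le)
  next
    case False
    \<comment> \<open>Being positive and finite, the truncated supremum strictly exceeds its half,
      so some member of the set exceeds that half.\<close>
    have "min (?f \<epsilon>) 1 \<noteq> 0" "min (?f \<epsilon>) 1 < top"
      using False by (auto simp: min_def le_less_trans)
    then obtain c where c: "0 < c" "min (?f \<epsilon>) 1 = ennreal c"
      by (cases "min (?f \<epsilon>) 1") (auto simp: less_le)
    have "ennreal (c / 2) < ennreal c"
      using c(1) by (intro ennreal_lessI) auto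
    also have "\<dots> \<le> ?f \<epsilon>"
      unfolding c(2)[symmetric] by simp
    finally obtain a where "a \<in> A \<epsilon>" "ennreal (c / 2) < g \<epsilon> a"
      unfolding less_SUP_iff by blast
    moreover have "min (?f \<epsilon>) 1 = 2 * ennreal (c / 2)"
      unfolding c(2) using c(1) by (subst ennreal_numeral[symmetric], subst ennreal_mult[symmetric]) auto
    ultimately show ?thesis
      by (metis less_imp_le mult_left_mono zero_le)
  qed
  then obtain a where a: "\<And>\<epsilon>. A \<epsilon> \<noteq> {} \<Longrightarrow> a \<epsilon> \<in> A \<epsilon>"
      "\<And>\<epsilon>. A \<epsilon> \<noteq> {} \<Longrightarrow> min (?f \<epsilon>) 1 \<le> 2 * g \<epsilon> (a \<epsilon>)"
    by metis
  obtain r where r: "negl_on (\<lambda>\<epsilon>. A \<epsilon> \<noteq> {}) r"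
      "\<forall>\<^sub>F \<epsilon> in at_right 0. A \<epsilon> \<noteq> {} \<longrightarrow> g \<epsilon> (a \<epsilon>) \<le> ennreal (r \<epsilon>)"
    using assms[of a] a(1) by blast
  have negr: "negl_on (\<lambda>\<epsilon>. A \<epsilon> \<noteq> {}) (\<lambda>\<epsilon>. max (r \<epsilon>) 0)"
  proof (unfold negl_on_def, intro allI)
    fix m :: nat
    obtain C where C: "C > 0" "\<forall>\<^sub>F \<epsilon> in at_right 0. A \<epsilon> \<noteq> {} \<longrightarrow> r \<epsilon> \<le> C * \<epsilon> ^ m"
      using r(1) unfolding negl_on_def by blast
    have "\<forall>\<^sub>F \<epsilon> in at_right 0. A \<epsilon> \<noteq> {} \<longrightarrow> max (r \<epsilon>) 0 \<le> C * \<epsilon> ^ m"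
      using C(2) eventually_idx by eventually_elim (use C(1) in auto)
    with C(1) show "\<exists>C>0. \<forall>\<^sub>F \<epsilon> in at_right 0. A \<epsilon> \<noteq> {} \<longrightarrow> max (r \<epsilon>) 0 \<le> C * \<epsilon> ^ m"
      by blast
  qed
  \<comment> \<open>The value 0 matches the supremum over an empty \<open>A \<epsilon>\<close>; the
    factor 2 makes up for the half lost in the selection.\<close>
  define s where "s = (\<lambda>\<epsilon>. if A \<epsilon> = {} then 0 else 2 * max (r \<epsilon>) 0)"
  have s: "negl_on (\<lambda>_. True) s"
  proof (rule negl_on_finite[of "{True, False}" _ "\<lambda>b \<epsilon>. (A \<epsilon> \<noteq> {}) = b"])
    fix b
    show "negl_on (\<lambda>\<epsilon>. (A \<epsilon> \<noteq> {}) = b) s"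
    proof (cases b)
      case True
      then show ?thesis
        by (intro negl_on_mono[OF negl_on_cmult[OF negr, of 2]]) (auto simp: s_def)
    next
      case False
      then show ?thesis
        by (intro negl_on_mono[OF negl_on_zero[of "\<lambda>_. True"]]) (auto simp: s_def)
    qed
  qed auto
  \<comment> \<open>Being negligible, \<open>s\<close> is eventually below 1. From then on the
    truncation at 1 cannot be active, and the bound for the minimum is a bound for the supremum
    itself.\<close>
  have "\<forall>\<^sub>F \<epsilon> in at_right 0. ?f \<epsilon> \<le> ennreal (s \<epsilon>)"
    using r(2) negl_on_small[OF s zero_less_one]
  proof eventually_elim
    case (elim \<epsilon>)
    show ?case
    proof (cases "A \<epsilon> = {}")
      case False
      have "2 * g \<epsilon> (a \<epsilon>) \<le> 2 * ennreal (max (r \<epsilon>) 0)"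
        using elim False by (intro mult_left_mono) (auto intro: order_trans[OF _ ennreal_leI])
      also have "\<dots> = ennreal (s \<epsilon>)"
        using False by (simp add: s_def ennreal_mult)
      finally have "min (?f \<epsilon>) 1 \<le> ennreal (s \<epsilon>)"
        using a(2)[OF False] by order
      moreover have "ennreal (s \<epsilon>) < 1"
        using elim by simp
      ultimately show ?thesis
        by (metis leD min_def)
    qed (simp add: bot_ennreal)
  qed
  then show ?thesis
    by (rule negligible_netI[OF s])
qed

lemma negligible_net_cmult:
  assumes "negligible_net f" and "0 < c"
  shows "negligible_net (\<lambda>\<epsilon>. ennreal c * f \<epsilon>)"
  unfolding negligible_net_def net_bigo_def
proof
  fix m :: nat
  obtain C where C: "C > 0" "\<forall>\<^sub>F \<epsilon> in at_right 0. f \<epsilon> \<le> ennreal (C * \<epsilon> ^ m)"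
    using assms(1) unfolding negligible_net_def net_bigo_def by blast
  have "\<forall>\<^sub>F \<epsilon> in at_right 0. ennreal c * f \<epsilon> \<le> ennreal (c * C * \<epsilon> ^ m)"
    using C(2)
  proof eventually_elim
    case (elim \<epsilon>)
    then have "ennreal c * f \<epsilon> \<le> ennreal c * ennreal (C * \<epsilon> ^ m)"
      by (rule mult_left_mono) simp
    then show ?case
      using assms(2) by (simp add: ennreal_mult'[symmetric] mult.assoc)
  qed
  then show "\<exists>C>0. \<forall>\<^sub>F \<epsilon> in at_right 0. ennreal c * f \<epsilon> \<le> ennreal (C * \<epsilon> ^ m)"
    using C(1) assms(2) by (intro exI[of _ "c * C"]) auto
qed

lemma negligible_bound:
  assumes "negligible_net f"
  obtains r where "negl_on (\<lambda>_. True) r" "\<And>\<epsilon>. 0 \<le> r \<epsilon>" "\<forall>\<^sub>F \<epsilon> in at_right 0. f \<epsilon> \<le> ennreal (r \<epsilon>)"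
proof (rule that[of "\<lambda>\<epsilon>. enn2real (f \<epsilon>)"])
  show "negl_on (\<lambda>_. True) (\<lambda>\<epsilon>. enn2real (f \<epsilon>))"
  proof (rule negligible_netD[OF assms])
    have "ennreal (enn2real x) \<le> x" for x
      by (cases x) auto
    then show "\<forall>\<^sub>F \<epsilon> in at_right 0. True \<longrightarrow> ennreal (enn2real (f \<epsilon>)) \<le> f \<epsilon>"
      by simp
  qed
  \<comment> \<open>\<open>enn2real\<close> sends infinity to 0, so it gives an upper bound only
    where \<open>f\<close> is finite; convergence to 0 guarantees this for small \<epsilon>.\<close>
  have "\<forall>\<^sub>F \<epsilon> in at_right 0. f \<epsilon> < top"
    using order_tendstoD(2)[OF negligible_net_tendsto[OF assms], of top] by simp
  then show "\<forall>\<^sub>F \<epsilon> in at_right 0. f \<epsilon> \<le> ennreal (enn2real (f \<epsilon>))"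
    by eventually_elim simp
qed simp

lemma negl_imp_mod: "negl_on P r \<Longrightarrow> mod_on P r"
  unfolding negl_on_def mod_on_def by (drule spec[of _ 0], rule exI[of _ 0]) simp

lemma mod_on_finite:
  assumes "finite I" and "\<forall>\<^sub>F \<epsilon> in at_right 0. P \<epsilon> \<longrightarrow> (\<exists>i\<in>I. Q i \<epsilon>)"
    and "\<And>i. i \<in> I \<Longrightarrow> mod_on (Q i) r" and "\<And>\<epsilon>. 0 \<le> r \<epsilon>"
  shows "mod_on P r"
proof -
  have "mod_on (\<lambda>\<epsilon>. \<exists>i\<in>I. Q i \<epsilon>) r"
    using assms(1,3)
  proof (induction I rule: finite_induct)
    case empty
    show ?case
      by (rule mod_on_mono[OF mod_on_const[of "\<lambda>_. True"]]) simp
  next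
    case (insert j I)
    \<comment> \<open>The exponents differ from one condition to the next. Extending
      \<open>r\<close> by 0 outside a condition makes its bound unconditional, so that
      \<open>mod_on_add\<close> can combine exponents; as \<open>r\<close> is nonnegative, the sum
      of the extensions dominates \<open>r\<close> wherever one of the conditions holds.\<close>
    have split: "mod_on (\<lambda>_. True) (\<lambda>\<epsilon>. if A \<epsilon> then r \<epsilon> else 0)"
      if A: "mod_on A r" for A
    proof -
      obtain N C where C: "C > 0" "\<forall>\<^sub>F \<epsilon> in at_right 0. A \<epsilon> \<longrightarrow> r \<epsilon> \<le> C / \<epsilon> ^ N"
        using A unfolding mod_on_def by blast
      have "\<forall>\<^sub>F \<epsilon> in at_right 0. (if A \<epsilon> then r \<epsilon> else 0) \<le> C / \<epsilon> ^ N"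
        using C(2) eventually_idx by eventually_elim (use C(1) in auto)
      then show ?thesis
        using C(1) unfolding mod_on_def by (intro exI[of _ N] exI[of _ C]) simp
    qed
    let ?B = "\<lambda>\<epsilon>. \<exists>i\<in>I. Q i \<epsilon>"
    have "mod_on (\<lambda>_. True) (\<lambda>\<epsilon>. (if Q j \<epsilon> then r \<epsilon> else 0) + (if ?B \<epsilon> then r \<epsilon> else 0))"
      using split[of "Q j"] split[of ?B] insert by (intro mod_on_add) auto
    then show ?case
      by (rule mod_on_mono) (use assms(4) in \<open>auto intro!: always_eventually\<close>)
  qed
  then show ?thesis
    by (rule mod_on_mono) (use assms(2) in simp)
qed

lemma negligible_net_mono:
  assumes "negligible_net g" and "\<And>\<epsilon>. f \<epsilon> \<le> g \<epsilon>"
  shows "negligible_net f"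
  unfolding negligible_net_def net_bigo_def
proof
  fix m :: nat
  obtain C where C: "C > 0" "\<forall>\<^sub>F \<epsilon> in at_right 0. g \<epsilon> \<le> ennreal (C * \<epsilon> ^ m)"
    using assms(1) unfolding negligible_net_def net_bigo_def by blast
  have "\<forall>\<^sub>F \<epsilon> in at_right 0. f \<epsilon> \<le> ennreal (C * \<epsilon> ^ m)"
    using C(2) by eventually_elim (use assms(2) order_trans in blast)
  with C(1) show "\<exists>C>0. \<forall>\<^sub>F \<epsilon> in at_right 0. f \<epsilon> \<le> ennreal (C * \<epsilon> ^ m)"
    by blast
qed

section \<open>Derivatives on finite-dimensional spaces\<close>

lemma norm_diff_triangle:
  fixes a b c :: "'a::real_normed_vector"
  shows "norm (a - c) \<le> norm (a - b) + norm (b - c)"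
  using dist_triangle[of a c b] by (simp add: dist_norm)

text \<open>\<open>frechet_derivative\<close> is a choice among all derivatives at the point.
  Functions that agree near the point have the same derivatives, so the choices agree even where
  nothing is differentiable.\<close>

lemma frechet_derivative_cong_open:
  assumes "open S" and "\<And>x. x \<in> S \<Longrightarrow> f x = g x" and "x \<in> S"
  shows "frechet_derivative f (at x) = frechet_derivative g (at x)"
proof -
  have "(f has_derivative D) (at x) \<longleftrightarrow> (g has_derivative D) (at x)" for D
    using has_derivative_transform_within_open[of f D x UNIV S g]
      has_derivative_transform_within_open[of g D x UNIV S f] assms by auto
  then show ?thesis
    unfolding frechet_derivative_def by simp
qed

lemma iter_deriv_cong:
  assumes "open S" and "\<And>x. x \<in> S \<Longrightarrow> f x = g x" and "x \<in> S"
  shows "iter_deriv f vs x = iter_deriv g vs x"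
  using assms(3)
proof (induction vs arbitrary: x)
  case (Cons v vs)
  then show ?case
    using frechet_derivative_cong_open[OF assms(1) Cons.IH Cons.prems] by simp
qed (simp add: assms(2))

lemma smooth_on_cong:
  assumes "open S" and "\<And>x. x \<in> S \<Longrightarrow> f x = g x" and "smooth_on S f"
  shows "smooth_on S g"
  unfolding smooth_on_def
proof (intro allI ballI)
  fix vs x assume x: "x \<in> S"
  obtain D where D: "(iter_deriv f vs has_derivative D) (at x)"
    using assms(3) x unfolding smooth_on_def differentiable_def by blast
  have "(iter_deriv g vs has_derivative D) (at x)"
    by (rule has_derivative_transform_within_open[OF D assms(1) x])
      (rule iter_deriv_cong[OF assms(1,2)])
  then show "iter_deriv g vs differentiable (at x)"
    unfolding differentiable_def by blast
qed

lemma smooth_on_differentiable: "smooth_on S f \<Longrightarrow> x \<in> S \<Longrightarrow> f differentiable (at x)"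
  unfolding smooth_on_def by (metis iter_deriv.simps(1))

lemma smooth_on_continuous: "smooth_on S f \<Longrightarrow> continuous_on S f"
  by (meson continuous_at_imp_continuous_on differentiable_imp_continuous_within
      smooth_on_differentiable)

lemma smooth_on_continuous_derivative:
  assumes "smooth_on S f"
  shows "continuous_on S (\<lambda>x. frechet_derivative f (at x) v)"
proof -
  have "iter_deriv f [v] differentiable (at x)" if "x \<in> S" for x
    using assms that unfolding smooth_on_def by blast
  then show ?thesis
    by (auto intro!: continuous_at_imp_continuous_on differentiable_imp_continuous_within)
qed

text \<open>One more differentiation uses the identity for the shorter list on a whole
  neighbourhood; this is why \<open>S\<close> is open and the induction ranges over all of its
  points.\<close>

lemma iter_deriv_bounded_linear:
  assumes A: "bounded_linear A" and S: "open S" and f: "smooth_on S f" and "x \<in> S"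
  shows "iter_deriv (\<lambda>x. A (f x)) vs x = A (iter_deriv f vs x)"
  using \<open>x \<in> S\<close>
proof (induction vs arbitrary: x)
  case (Cons v vs)
  have "iter_deriv f vs differentiable (at x)"
    using f Cons.prems unfolding smooth_on_def by blast
  then have "((\<lambda>x. A (iter_deriv f vs x)) has_derivative
      (\<lambda>v. A (frechet_derivative (iter_deriv f vs) (at x) v))) (at x)"
    by (intro bounded_linear.has_derivative[OF A]) (simp add: frechet_derivative_works)
  from frechet_derivative_at[OF this] show ?case
    using frechet_derivative_cong_open[OF S Cons.IH Cons.prems] by (simp add: fun_eq_iff)
qed simp

lemma iter_deriv_diff:
  assumes S: "open S" and f: "smooth_on S f" and g: "smooth_on S g" and "x \<in> S"
  shows "iter_deriv (\<lambda>x. f x - g x) vs x = iter_deriv f vs x - iter_deriv g vs x"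
  using \<open>x \<in> S\<close>
proof (induction vs arbitrary: x)
  case (Cons v vs)
  have "iter_deriv f vs differentiable (at x)" "iter_deriv g vs differentiable (at x)"
    using f g Cons.prems unfolding smooth_on_def by blast+
  then have "((\<lambda>x. iter_deriv f vs x - iter_deriv g vs x) has_derivative
      (\<lambda>v. frechet_derivative (iter_deriv f vs) (at x) v
         - frechet_derivative (iter_deriv g vs) (at x) v)) (at x)"
    by (intro has_derivative_diff) (simp_all add: frechet_derivative_works)
  from frechet_derivative_at[OF this] show ?case
    using frechet_derivative_cong_open[OF S Cons.IH Cons.prems] by (simp add: fun_eq_iff)
qed simp

lemma differentiable_cong_open:
  assumes "open S" and "\<And>x. x \<in> S \<Longrightarrow> f x = g x" and "x \<in> S" and "f differentiable (at x)"
  shows "g differentiable (at x)"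
  using assms has_derivative_transform_within_open[of f _ x UNIV S g]
  unfolding differentiable_def by blast

lemma smooth_on_bounded_linear:
  assumes "bounded_linear A" and "open S" and "smooth_on S f"
  shows "smooth_on S (\<lambda>x. A (f x))"
  unfolding smooth_on_def
proof (intro allI ballI)
  fix vs x assume x: "x \<in> S"
  have "(\<lambda>x. A (iter_deriv f vs x)) differentiable (at x)"
    using assms(3) x bounded_linear.has_derivative[OF assms(1)]
    unfolding smooth_on_def differentiable_def by blast
  then show "iter_deriv (\<lambda>x. A (f x)) vs differentiable (at x)"
    by (rule differentiable_cong_open[OF assms(2) _ x, rotated])
      (simp add: iter_deriv_bounded_linear[OF assms])
qed

lemma smooth_on_diff:
  assumes "open S" and "smooth_on S f" and "smooth_on S g"
  shows "smooth_on S (\<lambda>x. f x - g x)"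
  unfolding smooth_on_def
proof (intro allI ballI)
  fix vs x assume x: "x \<in> S"
  have "(\<lambda>x. iter_deriv f vs x - iter_deriv g vs x) differentiable (at x)"
    using assms(2,3) x differentiable_diff unfolding smooth_on_def by blast
  then show "iter_deriv (\<lambda>x. f x - g x) vs differentiable (at x)"
    by (rule differentiable_cong_open[OF assms(1) _ x, rotated]) (simp add: iter_deriv_diff[OF assms])
qed

lemma iter_deriv_zero: "iter_deriv (\<lambda>_. 0) vs = (\<lambda>_. 0)"
  by (induction vs) (simp_all add: frechet_derivative_const)

lemma deriv_norm_zero: "deriv_norm k (\<lambda>_. 0) x = 0"
  unfolding deriv_norm_def iter_deriv_zero
  by (simp add: bot_ennreal SUP_eq_const le_zero_eq[symmetric] del: le_zero_eq)
    (rule SUP_least, simp)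

lemma deriv_norm_0: "deriv_norm 0 f x = ennreal (norm (f x))"
  unfolding deriv_norm_def by (simp add: conj_commute cong: conj_cong)

section \<open>Mean value inequalities and bounds on compact sets\<close>

lemma frechet_derivative_le_deriv_norm:
  fixes f :: "'a::real_normed_vector \<Rightarrow> 'b::real_normed_vector"
  assumes "f differentiable (at x)" and "deriv_norm 1 f x \<le> ennreal M" and "0 \<le> M"
  shows "norm (frechet_derivative f (at x) v) \<le> M * norm v"
proof (cases "v = 0")
  case False
  have lin: "bounded_linear (frechet_derivative f (at x))"
    using assms(1) frechet_derivative_works has_derivative_bounded_linear by blast
  have "ennreal (norm (iter_deriv f [sgn v] x)) \<le> deriv_norm 1 f x"
    unfolding deriv_norm_def by (rule SUP_upper) (simp add: norm_sgn)
  then have "ennreal (norm (frechet_derivative f (at x) (sgn v))) \<le> ennreal M"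
    using assms(2) by (simp add: order.trans)
  then have "norm (frechet_derivative f (at x) (sgn v)) \<le> M"
    using assms(3) by simp
  moreover have "frechet_derivative f (at x) v = norm v *\<^sub>R frechet_derivative f (at x) (sgn v)"
    by (subst linear_scale[OF bounded_linear.linear[OF lin], symmetric]) (simp add: sgn_div_norm False)
  ultimately show ?thesis
    using mult_right_mono[of "norm (frechet_derivative f (at x) (sgn v))" M "norm v"]
    by (simp add: mult.commute)
next
  case True
  have lin: "bounded_linear (frechet_derivative f (at x))"
    using assms(1) frechet_derivative_works has_derivative_bounded_linear by blast
  with True show ?thesis
    by (simp add: linear_0[OF bounded_linear.linear])
qed

lemma norm_diff_le_frechet_derivative:
  fixes f :: "'a::real_normed_vector \<Rightarrow> 'b::real_normed_vector"
  assumes "convex S" and diff: "\<And>x. x \<in> S \<Longrightarrow> f differentiable (at x)"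
    and bd: "\<And>x v. x \<in> S \<Longrightarrow> norm (frechet_derivative f (at x) v) \<le> M * norm v"
    and "0 \<le> M" and "x \<in> S" "y \<in> S"
  shows "norm (f x - f y) \<le> M * norm (x - y)"
proof (rule differentiable_bound[OF \<open>convex S\<close> _ _ \<open>x \<in> S\<close> \<open>y \<in> S\<close>])
  show "(f has_derivative frechet_derivative f (at x)) (at x within S)" if "x \<in> S" for x
    using diff[OF that] by (simp add: frechet_derivative_works has_derivative_at_withinI)
  show "onorm (frechet_derivative f (at x)) \<le> M" if "x \<in> S" for x
    by (rule onorm_bound[OF \<open>0 \<le> M\<close> bd[OF that]])
qed

text \<open>A special case of the uniform boundedness principle; Baire's theorem applies because bounded
  closed sets are compact.\<close>

lemma pointwise_bounded_imp_uniformly_bounded: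
  fixes D :: "'i \<Rightarrow> 'a::{real_normed_vector,heine_borel} \<Rightarrow> 'b::real_normed_vector"
  assumes lin: "\<And>i. i \<in> I \<Longrightarrow> bounded_linear (D i)"
    and pw: "\<And>v. \<exists>C. \<forall>i\<in>I. norm (D i v) \<le> C"
  shows "\<exists>M>0. \<forall>i\<in>I. \<forall>v. norm (D i v) \<le> M * norm v"
proof -
  define A where "A n = {v. \<forall>i\<in>I. norm (D i v) \<le> real n}" for n
  have cl: "closed (A n)" for n
  proof -
    have "A n = (\<Inter>i\<in>I. {v. norm (D i v) \<le> real n})"
      unfolding A_def by auto
    moreover have "closed {v. norm (D i v) \<le> real n}" if "i \<in> I" for i
      using lin[OF that]
      by (intro closed_Collect_le continuous_on_norm continuous_on_const linear_continuous_on)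
    ultimately show ?thesis
      by auto
  qed
  have "\<exists>n. interior (A n) \<noteq> {}"
  proof (rule ccontr)
    assume "\<not> ?thesis"
    then have int: "interior (A n) = {}" for n
      by blast
    have "UNIV \<subseteq> closure (\<Inter>(range (\<lambda>n. - A n)))"
    proof (rule Baire)
      fix T assume "T \<in> range (\<lambda>n. - A n)"
      then obtain n where "T = - A n"
        by blast
      then show "openin (top_of_set UNIV) T \<and> UNIV \<subseteq> closure T"
        using cl[of n] int[of n] by (simp add: closure_complement open_Compl)
    qed auto
    moreover have "(\<Inter>(range (\<lambda>n. - A n))) = {}"
    proof -
      have "\<exists>n. v \<in> A n" for v
      proof -
        obtain C where "\<forall>i\<in>I. norm (D i v) \<le> C"
          using pw by blast
        moreover obtain n :: nat where "C \<le> real n"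
          using real_arch_simple by blast
        ultimately show ?thesis
          unfolding A_def by (auto intro: order_trans)
      qed
      then show ?thesis
        by blast
    qed
    ultimately show False
      by simp
  qed
  then obtain n a where "a \<in> interior (A n)"
    by blast
  then obtain r where r: "r > 0" "cball a r \<subseteq> A n"
    using mem_interior_cball by blast
  \<comment> \<open>With \<open>v\<close> rescaled to a vector \<open>w\<close> of norm
    \<open>r\<close>, \<open>D i w\<close> is the difference of the values at \<open>a + w\<close>
    and \<open>a\<close>, each of norm at most \<open>n\<close>; this gives the factor
    \<open>2 * n / r\<close>. The summand 1 keeps the constant positive when
    \<open>n = 0\<close>.\<close>
  have "norm (D i v) \<le> (2 * real n / r + 1) * norm v" if i: "i \<in> I" for i v
  proof (cases "v = 0")
    case True
    then show ?thesis
      using lin[OF i] by (simp add: linear_0[OF bounded_linear.linear])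
  next
    case False
    interpret bounded_linear "D i"
      by (rule lin[OF i])
    define w where "w = (r / norm v) *\<^sub>R v"
    have "a + w \<in> A n" "a \<in> A n"
      using r False by (auto simp: w_def dist_norm)
    then have "norm (D i (a + w)) \<le> real n" "norm (D i a) \<le> real n"
      using i unfolding A_def by auto
    then have "norm (D i (a + w) - D i a) \<le> 2 * real n"
      using norm_triangle_ineq4[of "D i (a + w)" "D i a"] by linarith
    then have "r / norm v * norm (D i v) \<le> 2 * real n"
      unfolding diff[symmetric] using r(1) by (simp add: w_def scale)
    then have "norm (D i v) \<le> 2 * real n / r * norm v"
      using r(1) False by (simp add: field_simps)
    then show ?thesis
      by (simp add: distrib_right add_increasing2)
  qed
  moreover have "2 * real n / r + 1 > 0"
    using r(1) by (simp add: add_nonneg_pos)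
  ultimately show ?thesis
    by blast
qed

text \<open>The closed neighbourhood is the sum of \<open>K\<close> and a closed ball, both compact.
  It is used whenever a compact set of coordinates has to be enlarged inside a chart.\<close>

lemma compact_cball_nbhd:
  fixes K :: "'a::{real_normed_vector,heine_borel} set"
  assumes "compact K" and "open U" and "K \<subseteq> U"
  obtains r where "r > 0" "compact {x. \<exists>y\<in>K. dist y x \<le> r}" "{x. \<exists>y\<in>K. dist y x \<le> r} \<subseteq> U"
proof -
  obtain r where r: "r > 0" "(\<Union>x\<in>K. cball x r) \<subseteq> U"
    using compact_subset_open_imp_cball_epsilon_subset[OF assms] by blast
  have eq: "{x. \<exists>y\<in>K. dist y x \<le> r} = (\<Union>x\<in>K. \<Union>y\<in>cball 0 r. {x + y})"
  proof safe
    fix x y assume "y \<in> K" "dist y x \<le> r"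
    then have "x = y + (x - y)" "x - y \<in> cball 0 r"
      by (auto simp: dist_norm norm_minus_commute)
    with \<open>y \<in> K\<close> show "x \<in> (\<Union>x\<in>K. \<Union>y\<in>cball 0 r. {x + y})"
      by blast
  next
    fix x y :: 'a assume "x \<in> K" "y \<in> cball 0 r"
    then show "\<exists>z\<in>K. dist z (x + y) \<le> r"
      by (intro bexI[of _ x]) (auto simp: dist_norm)
  qed
  show ?thesis
  proof
    show "compact {x. \<exists>y\<in>K. dist y x \<le> r}"
      unfolding eq by (rule compact_sums'[OF assms(1) compact_cball])
    show "{x. \<exists>y\<in>K. dist y x \<le> r} \<subseteq> U"
      using r(2) by (force simp: mem_cball)
  qed (rule r(1))
qed

text \<open>\<open>K\<close> need not be convex, so the mean value inequality covers only pairs at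
  distance at most \<open>r\<close>, joined inside a ball in the neighbourhood \<open>N\<close>. For
  the other pairs boundedness of \<open>f\<close> suffices, because their distance exceeds
  \<open>r\<close>; the constant adds the two contributions.\<close>

lemma smooth_on_lipschitz_compact:
  fixes f :: "'a::{real_normed_vector,heine_borel} \<Rightarrow> 'b::real_normed_vector"
  assumes f: "smooth_on S f" and S: "open S" and K: "compact K" "K \<subseteq> S"
  shows "\<exists>C>0. \<forall>x\<in>K. \<forall>y\<in>K. norm (f x - f y) \<le> C * norm (x - y)"
proof -
  obtain r where r: "r > 0" and N: "compact {x. \<exists>y\<in>K. dist y x \<le> r}"
      and NS: "{x. \<exists>y\<in>K. dist y x \<le> r} \<subseteq> S"
    by (rule compact_cball_nbhd[OF K(1) S K(2)])
  define N where "N = {x. \<exists>y\<in>K. dist y x \<le> r}"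
  have diff: "f differentiable (at x)" if "x \<in> N" for x
    using smooth_on_differentiable[OF f] that NS unfolding N_def by blast
  \<comment> \<open>Continuity of the derivative is known only for each fixed direction
    \<open>v\<close>, so compactness bounds it direction by direction; uniform boundedness makes the
    bound independent of the direction.\<close>
  have "\<exists>M>0. \<forall>x\<in>N. \<forall>v. norm (frechet_derivative f (at x) v) \<le> M * norm v"
  proof (rule pointwise_bounded_imp_uniformly_bounded)
    show "bounded_linear (frechet_derivative f (at x))" if "x \<in> N" for x
      using diff[OF that] frechet_derivative_works has_derivative_bounded_linear by blast
    show "\<exists>C. \<forall>x\<in>N. norm (frechet_derivative f (at x) v) \<le> C" for v
    proof -
      have "compact ((\<lambda>x. frechet_derivative f (at x) v) ` N)"
        using smooth_on_continuous_derivative[OF f] N NS unfolding N_def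
        by (intro compact_continuous_image) (auto intro: continuous_on_subset)
      then show ?thesis
        by (auto dest!: compact_imp_bounded simp: bounded_iff)
    qed
  qed
  then obtain M where M: "M > 0" "\<And>x v. x \<in> N \<Longrightarrow> norm (frechet_derivative f (at x) v) \<le> M * norm v"
    by blast
  have "bounded (f ` K)"
    using continuous_on_subset[OF smooth_on_continuous[OF f] K(2)] K(1)
    by (simp add: compact_continuous_image compact_imp_bounded)
  then obtain B where B: "B > 0" "\<And>x. x \<in> K \<Longrightarrow> norm (f x) \<le> B"
    using bounded_pos by (metis imageI)
  have "norm (f x - f y) \<le> (M + 2 * B / r) * norm (x - y)" if "x \<in> K" "y \<in> K" for x y
  proof (cases "dist x y \<le> r")
    case True
    have "norm (f x - f y) \<le> M * norm (x - y)"
      by (rule norm_diff_le_frechet_derivative[of "cball x r"])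
        (use diff M True r that in \<open>auto simp: N_def\<close>)
    then show ?thesis
      using B(1) r by (simp add: distrib_right add_increasing2)
  next
    case False
    have "norm (f x - f y) \<le> 2 * B"
      using norm_triangle_ineq4[of "f x" "f y"] B(2)[OF that(1)] B(2)[OF that(2)] by linarith
    also have "\<dots> \<le> 2 * B / r * norm (x - y)"
      using False r B(1) by (simp add: dist_norm field_simps)
    finally show ?thesis
      using M(1) by (simp add: distrib_right add_increasing)
  qed
  moreover have "M + 2 * B / r > 0"
    using M(1) B(1) r by (simp add: add_pos_nonneg)
  ultimately show ?thesis
    by blast
qed

text \<open>The upper bound comes from the operator norm of \<open>H\<close> on the compact
  \<open>K\<close>, the lower one from the positive minimum of the quadratic form on the product of
  \<open>K\<close> and the unit sphere. All comparisons of metrics with coordinates rest on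
  this.\<close>

lemma inner_form_bounds:
  fixes H :: "'a::metric_space \<Rightarrow> 'e::{real_normed_vector,heine_borel} \<Rightarrow>\<^sub>L 'e \<Rightarrow>\<^sub>L real"
  assumes K: "compact K" and H: "continuous_on K H" and pos: "\<And>x. x \<in> K \<Longrightarrow> inner_form (H x)"
  obtains c C where "c > 0" "C > 0"
    "\<And>x v. x \<in> K \<Longrightarrow> c * norm v \<le> sqrt (H x v v)" "\<And>x v. x \<in> K \<Longrightarrow> sqrt (H x v v) \<le> C * norm v"
proof -
  have "bounded (H ` K)"
    using K H by (simp add: compact_continuous_image compact_imp_bounded)
  then obtain B where B: "B > 0" "\<And>x. x \<in> K \<Longrightarrow> norm (H x) \<le> B"
    using bounded_pos by (metis imageI)
  have upper: "sqrt (H x v v) \<le> sqrt B * norm v" if "x \<in> K" for x v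
  proof -
    have "H x v v \<le> norm (H x v) * norm v"
      by (rule order_trans[OF _ norm_blinfun]) simp
    also have "\<dots> \<le> (norm (H x) * norm v) * norm v"
      by (intro mult_right_mono norm_blinfun) simp
    also have "\<dots> \<le> (B * norm v) * norm v"
      using B(2)[OF that] by (intro mult_right_mono) auto
    also have "\<dots> = (sqrt B * norm v)\<^sup>2"
      using B(1) by (simp add: power_mult_distrib power2_eq_square)
    finally show ?thesis
      using B(1) by (intro real_le_lsqrt) auto
  qed
  \<comment> \<open>The unit sphere of the zero space is empty and so may be \<open>K\<close>. Then
    there is no minimum to take, but a given \<open>x\<close> in \<open>K\<close> leaves only
    \<open>v = 0\<close>, and \<open>c = 1\<close> works.\<close>
  have "\<exists>c>0. \<forall>x\<in>K. \<forall>v. c * norm v \<le> sqrt (H x v v)"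
  proof (cases "K \<times> sphere (0::'e) 1 = {}")
    case True
    have "1 * norm v \<le> sqrt (H x v v)" if "x \<in> K" for x v
    proof -
      have "v = 0"
        using True that norm_sgn[of v] by (cases "v = 0") auto
      then show ?thesis
        by (simp add: blinfun.zero_right)
    qed
    then show ?thesis
      using zero_less_one by blast
  next
    case False
    have "continuous_on (K \<times> sphere 0 1) (\<lambda>z. H (fst z) (snd z) (snd z))"
      by (intro blinfun.continuous_on continuous_on_snd continuous_on_id
          continuous_on_compose2[OF H continuous_on_fst[OF continuous_on_id]]) auto
    moreover have "compact (sphere (0::'e) 1)"
    proof -
      have "closed {v::'e. norm v = 1}"
        by (intro closed_Collect_eq continuous_on_norm continuous_on_id continuous_on_const)
      moreover have "sphere (0::'e) 1 = {v. norm v = 1}"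
        by auto
      ultimately show ?thesis
        unfolding compact_eq_bounded_closed
        by (metis bounded_cball bounded_subset sphere_cball)
    qed
    ultimately
    obtain z where z: "z \<in> K \<times> sphere 0 1"
        "\<And>y. y \<in> K \<times> sphere 0 1 \<Longrightarrow> H (fst z) (snd z) (snd z) \<le> H (fst y) (snd y) (snd y)"
      using continuous_attains_inf[OF compact_Times[OF K] False] by blast
    define c where "c = H (fst z) (snd z) (snd z)"
    have "snd z \<noteq> 0" "fst z \<in> K"
      using z(1) by auto
    then have c: "c > 0"
      using pos unfolding c_def inner_form_def by blast
    have "sqrt c * norm v \<le> sqrt (H x v v)" if "x \<in> K" for x v
    proof (cases "v = 0")
      case False
      have "c \<le> H x (sgn v) (sgn v)"
        using z(2)[of "(x, sgn v)"] that False unfolding c_def by (simp add: norm_sgn)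
      then have "c * (norm v)\<^sup>2 \<le> H x (sgn v) (sgn v) * (norm v)\<^sup>2"
        by (intro mult_right_mono) auto
      also have "\<dots> = H x v v"
        using False by (simp add: sgn_div_norm blinfun.scaleR_right blinfun.scaleR_left
            power2_eq_square field_simps)
      finally have "sqrt (c * (norm v)\<^sup>2) \<le> sqrt (H x v v)"
        by simp
      then show ?thesis
        by (simp add: real_sqrt_mult)
    qed (simp add: blinfun.zero_right)
    with c show ?thesis
      by (intro exI[of _ "sqrt c"]) auto
  qed
  with upper B(1) show ?thesis
    using that[of _ "sqrt B"] by auto
qed

lemma linear_bound_unit_ball:
  assumes f: "linear f" and M: "\<And>\<xi>. norm \<xi> \<le> 1 \<Longrightarrow> norm (f \<xi>) \<le> M"
  shows "norm (f \<xi>) \<le> M * norm \<xi>"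
proof (cases "\<xi> = 0")
  case False
  have "f \<xi> = norm \<xi> *\<^sub>R f (sgn \<xi>)"
    using False by (simp add: linear_scale[OF f, symmetric] sgn_div_norm)
  then have "norm (f \<xi>) = norm (f (sgn \<xi>)) * norm \<xi>"
    by simp
  also have "\<dots> \<le> M * norm \<xi>"
    using M[of "sgn \<xi>"] by (intro mult_right_mono) (auto simp: norm_sgn)
  finally show ?thesis .
qed (simp add: linear_0[OF f])

section \<open>Charts\<close>

lemma is_chart_open: "is_chart X (V, \<phi>) \<Longrightarrow> openin X V"
  unfolding is_chart_def by simp

lemma is_chart_subset: "is_chart X (V, \<phi>) \<Longrightarrow> V \<subseteq> topspace X"
  by (simp add: is_chart_open openin_subset)

lemma is_chart_inj: "is_chart X (V, \<phi>) \<Longrightarrow> inj_on \<phi> V"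
  using homeomorphic_imp_injective_map topspace_subtopology_subset[OF is_chart_subset[of X V \<phi>]]
  unfolding is_chart_def by fastforce

lemma is_chart_inv:
  assumes "is_chart X (V, \<phi>)" and "p \<in> V"
  shows "inv_into V \<phi> (\<phi> p) = p"
  using assms by (simp add: is_chart_inj)

lemma is_chart_continuous:
  assumes "is_chart X (V, \<phi>)"
  shows "continuous_map (subtopology X V) euclidean \<phi>"
  using assms homeomorphic_imp_continuous_map continuous_map_into_fulltopology
  unfolding is_chart_def by fastforce

lemma is_chart_continuous_inv:
  assumes "is_chart X (V, \<phi>)"
  shows "continuous_map (top_of_set (\<phi> ` V)) X (inv_into V \<phi>)"
proof -
  have VX: "V \<subseteq> topspace X"
    using is_chart_subset[OF assms] .
  have "homeomorphic_map (subtopology X V) (top_of_set (\<phi> ` V)) \<phi>"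
    using assms unfolding is_chart_def by simp
  then obtain g where g: "homeomorphic_maps (subtopology X V) (top_of_set (\<phi> ` V)) \<phi> g"
    unfolding homeomorphic_map_maps by blast
  then have "continuous_map (top_of_set (\<phi> ` V)) (subtopology X V) g"
    unfolding homeomorphic_maps_def by blast
  moreover have "g x = inv_into V \<phi> x" if "x \<in> \<phi> ` V" for x
    using g that VX is_chart_inj[OF assms] unfolding homeomorphic_maps_def
    by (auto simp: topspace_subtopology_subset)
  ultimately have "continuous_map (top_of_set (\<phi> ` V)) (subtopology X V) (inv_into V \<phi>)"
    using continuous_map_eq[of "top_of_set (\<phi> ` V)" "subtopology X V" g] by simp
  then show ?thesis
    by (rule continuous_map_into_fulltopology)
qed

lemma is_chart_openin_preimage:
  assumes "is_chart X (V, \<phi>)" and "open U"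
  shows "openin X {p \<in> V. \<phi> p \<in> U}"
proof -
  have "openin (subtopology X V) {p \<in> topspace (subtopology X V). \<phi> p \<in> U}"
    using is_chart_continuous[OF assms(1)] assms(2) openin_continuous_map_preimage by fastforce
  then show ?thesis
    using is_chart_open[OF assms(1)] is_chart_subset[OF assms(1)]
    by (simp add: topspace_subtopology_subset openin_open_subtopology del: topspace_subtopology)
qed

lemma is_chart_open_image:
  assumes "is_chart X (V, \<phi>)" and "openin X U"
  shows "open (\<phi> ` (V \<inter> U))"
proof -
  have V: "openin X V" "open (\<phi> ` V)"
    and hom: "homeomorphic_map (subtopology X V) (top_of_set (\<phi> ` V)) \<phi>"
    using assms(1) unfolding is_chart_def by auto
  have "openin (subtopology X V) (V \<inter> U)"
    using assms(2) by (metis Int_commute openin_subtopology)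
  then have "openin (top_of_set (\<phi> ` V)) (\<phi> ` (V \<inter> U))"
    using hom homeomorphic_map_openness_eq by blast
  then show ?thesis
    using V(2) openin_open_eq by blast
qed

lemma compact_in_chart_image:
  assumes "is_chart X (V, \<phi>)" and "compact_in X L V"
  shows "compact (\<phi> ` L)" "\<phi> ` L \<subseteq> \<phi> ` V"
proof -
  have "compactin (subtopology X V) L"
    using assms(2) unfolding compact_in_def by (simp add: compactin_subtopology)
  then have "compactin euclidean (\<phi> ` L)"
    using image_compactin is_chart_continuous[OF assms(1)] by blast
  then show "compact (\<phi> ` L)"
    by simp
  show "\<phi> ` L \<subseteq> \<phi> ` V"
    using assms(2) unfolding compact_in_def by auto
qed

lemma compact_in_chart_inv_image:
  assumes "is_chart X (V, \<phi>)" and "compact C" and "C \<subseteq> \<phi> ` V"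
  shows "compact_in X (inv_into V \<phi> ` C) V"
proof -
  have "compactin (top_of_set (\<phi> ` V)) C"
    using assms by (simp add: compactin_subtopology)
  then have "compactin X (inv_into V \<phi> ` C)"
    using image_compactin is_chart_continuous_inv[OF assms(1)] by blast
  then show ?thesis
    using assms(3) unfolding compact_in_def by (auto simp: inv_into_into)
qed

text \<open>Each point has an open coordinate ball whose closed version pulls back to a compact
  subset of the chart; a finite subcover by the open balls gives the compact sets. Charts are given
  by functions \<open>V\<close> and \<open>\<phi>\<close> of an index so that vector bundle charts
  can serve as indices.\<close>

lemma compactin_cover_charts:
  fixes \<phi> :: "'c \<Rightarrow> 'x \<Rightarrow> 'a::{real_normed_vector,heine_borel}"
  assumes "compactin X K" and "\<And>c. c \<in> A \<Longrightarrow> is_chart X (V c, \<phi> c)"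
    and "\<And>p. p \<in> K \<Longrightarrow> \<exists>c\<in>A. p \<in> V c"
  obtains I where "finite I" "\<And>c L. (c, L) \<in> I \<Longrightarrow> c \<in> A \<and> compact_in X L (V c)"
    "\<And>p. p \<in> K \<Longrightarrow> \<exists>(c, L)\<in>I. p \<in> L"
proof -
  have "\<exists>c L U. c \<in> A \<and> compact_in X L (V c) \<and> openin X U \<and> p \<in> U \<and> U \<subseteq> L" if p: "p \<in> K" for p
  proof -
    obtain c where c: "c \<in> A" "p \<in> V c"
      using assms(3)[OF p] by blast
    note ch = assms(2)[OF c(1)]
    have "open (\<phi> c ` V c)"
      using ch unfolding is_chart_def by simp
    then obtain r where r: "r > 0" "cball (\<phi> c p) r \<subseteq> \<phi> c ` V c"
      using c(2) open_contains_cball by blast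
    have "compact_in X (inv_into (V c) (\<phi> c) ` cball (\<phi> c p) r) (V c)"
      using compact_in_chart_inv_image[OF ch compact_cball r(2)] .
    moreover have "openin X {q \<in> V c. \<phi> c q \<in> ball (\<phi> c p) r}"
      using is_chart_openin_preimage[OF ch open_ball] .
    moreover have "{q \<in> V c. \<phi> c q \<in> ball (\<phi> c p) r} \<subseteq> inv_into (V c) (\<phi> c) ` cball (\<phi> c p) r"
    proof
      fix q assume "q \<in> {q \<in> V c. \<phi> c q \<in> ball (\<phi> c p) r}"
      then have "q = inv_into (V c) (\<phi> c) (\<phi> c q)" "\<phi> c q \<in> cball (\<phi> c p) r"
        using is_chart_inv[OF ch] by auto
      then show "q \<in> inv_into (V c) (\<phi> c) ` cball (\<phi> c p) r"
        by blast
    qed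
    ultimately show ?thesis
      using c r(1) by (intro exI conjI) auto
  qed
  then obtain c L U where clu: "\<And>p. p \<in> K \<Longrightarrow> c p \<in> A \<and> compact_in X (L p) (V (c p)) \<and>
      openin X (U p) \<and> p \<in> U p \<and> U p \<subseteq> L p"
    by metis
  obtain F where F: "finite F" "F \<subseteq> U ` K" "K \<subseteq> \<Union>F"
    using assms(1) clu unfolding compactin_def
    by (metis (no_types, lifting) UN_I imageE subsetI)
  obtain K' where K': "finite K'" "K' \<subseteq> K" "F = U ` K'"
    using finite_subset_image[OF F(1,2)] by blast
  show ?thesis
  proof (rule that[of "(\<lambda>p. (c p, L p)) ` K'"])
    show "\<exists>(c, L)\<in>(\<lambda>p. (c p, L p)) ` K'. p \<in> L" if "p \<in> K" for p
    proof -
      obtain q where "q \<in> K'" "p \<in> U q"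
        using F(3) K'(3) \<open>p \<in> K\<close> by blast
      moreover have "U q \<subseteq> L q"
        using clu K'(2) \<open>q \<in> K'\<close> by blast
      ultimately show ?thesis
        by auto
    qed
  qed (use K' clu in auto)
qed

lemma smooth_manifold_chart:
  "smooth_manifold X \<Longrightarrow> (V, \<phi>) \<in> charts X \<Longrightarrow> is_chart (points X) (V, \<phi>)"
  unfolding smooth_manifold_def is_atlas_def by blast

lemma smooth_manifold_transition:
  "smooth_manifold X \<Longrightarrow> (V, \<phi>) \<in> charts X \<Longrightarrow> (W, \<psi>) \<in> charts X \<Longrightarrow>
    smooth_on (\<phi> ` (V \<inter> W)) (\<psi> \<circ> inv_into V \<phi>)"
  unfolding smooth_manifold_def is_atlas_def compatible_def by fast

lemma smooth_manifold_covered: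
  "smooth_manifold X \<Longrightarrow> p \<in> topspace (points X) \<Longrightarrow> \<exists>(V, \<phi>)\<in>charts X. p \<in> V"
  unfolding smooth_manifold_def is_atlas_def by auto

section \<open>Riemannian distance in charts\<close>

text \<open>\<open>speed\<close> is a definite description over all charts, hence meaningful only if
  every chart yields the same number. By the chain rule the velocity in another chart is the image
  under the derivative of the transition map, and the metric components transform in just the way
  that compensates for this.\<close>

lemma speed_eq:
  assumes X: "smooth_manifold X" and g: "riemannian_metric X g"
    and \<gamma>: "pathin (points X) \<gamma>" and t: "t \<in> {0<..<1}"
    and ch: "(V, \<phi>) \<in> charts X" "\<gamma> t \<in> V"
    and d: "((\<phi> \<circ> \<gamma>) has_vector_derivative d) (at t)"
  shows "speed X g \<gamma> t = sqrt (g (V, \<phi>) (\<phi> (\<gamma> t)) d d)"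
proof -
  have key: "sqrt (g (W, \<psi>) (\<psi> (\<gamma> t)) (vector_derivative (\<psi> \<circ> \<gamma>) (at t)) (vector_derivative (\<psi> \<circ> \<gamma>) (at t)))
      = sqrt (g (V, \<phi>) (\<phi> (\<gamma> t)) d d)"
    if W: "(W, \<psi>) \<in> charts X" "\<gamma> t \<in> W" for W \<psi>
  proof -
    let ?\<tau> = "\<psi> \<circ> inv_into V \<phi>"
    have chV: "is_chart (points X) (V, \<phi>)" and chW: "is_chart (points X) (W, \<psi>)"
      using smooth_manifold_chart[OF X] ch W by auto
    have "?\<tau> differentiable (at (\<phi> (\<gamma> t)))"
      using smooth_on_differentiable[OF smooth_manifold_transition[OF X ch(1) W(1)]] ch(2) W(2) by blast
    then have D: "(?\<tau> has_derivative frechet_derivative ?\<tau> (at (\<phi> (\<gamma> t)))) (at ((\<phi> \<circ> \<gamma>) t))"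
      by (simp add: frechet_derivative_works)
    have "((?\<tau> \<circ> (\<phi> \<circ> \<gamma>)) has_vector_derivative frechet_derivative ?\<tau> (at (\<phi> (\<gamma> t))) d) (at t)"
    proof -
      have "((?\<tau> \<circ> (\<phi> \<circ> \<gamma>)) has_derivative
          (frechet_derivative ?\<tau> (at (\<phi> (\<gamma> t))) \<circ> (\<lambda>h. h *\<^sub>R d))) (at t)"
        using d D unfolding has_vector_derivative_def by (rule diff_chain_at)
      moreover have "frechet_derivative ?\<tau> (at (\<phi> (\<gamma> t))) \<circ> (\<lambda>h. h *\<^sub>R d)
          = (\<lambda>h. h *\<^sub>R frechet_derivative ?\<tau> (at (\<phi> (\<gamma> t))) d)"
        using linear_scale[OF has_derivative_linear[OF D]] by (simp add: fun_eq_iff)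
      ultimately show ?thesis
        unfolding has_vector_derivative_def by simp
    qed
    \<comment> \<open>The path is continuous on the unit interval only. Intersecting with the open
      interval gives a neighbourhood of \<open>t\<close> in the line on which the curve stays in
      both charts, as two-sided derivatives require.\<close>
    moreover have "openin (top_of_set {0..1}) {s \<in> {0..1}. \<gamma> s \<in> V \<inter> W}"
      using \<gamma> openin_continuous_map_preimage[of "top_of_set {0..1}" "points X" \<gamma> "V \<inter> W"]
        is_chart_open[OF chV] is_chart_open[OF chW] unfolding pathin_def by auto
    then obtain O1 where O1: "open O1" "{s \<in> {0..1}. \<gamma> s \<in> V \<inter> W} = {0..1} \<inter> O1"
      by (auto simp: openin_open)
    ultimately have "((\<psi> \<circ> \<gamma>) has_vector_derivative frechet_derivative ?\<tau> (at (\<phi> (\<gamma> t))) d) (at t)"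
    proof (elim has_vector_derivative_transform_within_open)
      show "open (O1 \<inter> {0<..<1})" "t \<in> O1 \<inter> {0<..<1}"
        using O1(1) t ch(2) W(2) IntD2[of t "{0..1}" O1, folded O1(2)] by auto
      show "(?\<tau> \<circ> (\<phi> \<circ> \<gamma>)) s = (\<psi> \<circ> \<gamma>) s" if "s \<in> O1 \<inter> {0<..<1}" for s
      proof -
        have "s \<in> {0..1} \<inter> O1"
          using that by auto
        then have "\<gamma> s \<in> V"
          unfolding O1(2)[symmetric] by simp
        then show ?thesis
          using is_chart_inv[OF chV] by simp
      qed
    qed
    then have "vector_derivative (\<psi> \<circ> \<gamma>) (at t) = frechet_derivative ?\<tau> (at (\<phi> (\<gamma> t))) d"
      by (rule vector_derivative_at)
    moreover have "g (V, \<phi>) (\<phi> (\<gamma> t)) d d = g (W, \<psi>) (\<psi> (\<gamma> t))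
        (frechet_derivative ?\<tau> (at (\<phi> (\<gamma> t))) d) (frechet_derivative ?\<tau> (at (\<phi> (\<gamma> t))) d)"
      using g ch W unfolding riemannian_metric_def by fast
    ultimately show ?thesis
      by simp
  qed
  show ?thesis
    unfolding speed_def
  proof (rule the_equality)
    show "\<exists>(W, \<psi>)\<in>charts X. \<gamma> t \<in> W \<and> sqrt (g (V, \<phi>) (\<phi> (\<gamma> t)) d d) =
        sqrt (g (W, \<psi>) (\<psi> (\<gamma> t)) (vector_derivative (\<psi> \<circ> \<gamma>) (at t)) (vector_derivative (\<psi> \<circ> \<gamma>) (at t)))"
      by (rule bexI[OF _ ch(1)]) (simp only: split ch(2) key[OF ch] simp_thms)
  next
    fix r assume "\<exists>(W, \<psi>)\<in>charts X. \<gamma> t \<in> W \<and> r =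
        sqrt (g (W, \<psi>) (\<psi> (\<gamma> t)) (vector_derivative (\<psi> \<circ> \<gamma>) (at t)) (vector_derivative (\<psi> \<circ> \<gamma>) (at t)))"
    then obtain W \<psi> where "(W, \<psi>) \<in> charts X" "\<gamma> t \<in> W" "r =
        sqrt (g (W, \<psi>) (\<psi> (\<gamma> t)) (vector_derivative (\<psi> \<circ> \<gamma>) (at t)) (vector_derivative (\<psi> \<circ> \<gamma>) (at t)))"
      by blast
    then show "r = sqrt (g (V, \<phi>) (\<phi> (\<gamma> t)) d d)"
      using key by simp
  qed
qed

section \<open>Lengths of curves and the comparison of distances with coordinates\<close>

lemma riem_dist_self:
  assumes X: "smooth_manifold X" and p: "p \<in> topspace (points X)"
  shows "riem_dist X g p p = 0"
proof -
  have "pw_C1_curve X (\<lambda>_. p)"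
    unfolding pw_C1_curve_def
  proof (intro conjI exI[of _ "{}"] ballI)
    show "pathin (points X) (\<lambda>_. p)"
      using p by (simp add: pathin_const)
  qed (auto simp: o_def)
  moreover have "speed X g (\<lambda>_. p) t = 0" for t
    unfolding speed_def using smooth_manifold_covered[OF X p]
    by (intro the_equality) (auto simp: o_def blinfun.zero_right)
  then have "curve_length X g (\<lambda>_. p) = 0"
    unfolding curve_length_def by simp
  ultimately have "riem_dist X g p p \<le> 0"
    unfolding riem_dist_def by (intro INF_lower2[of "\<lambda>_. p"]) auto
  then show ?thesis
    by simp
qed

text \<open>The fundamental theorem of calculus in coordinates, combined with the lower bound for
  the metric. The end time \<open>T\<close> is free because the curve may leave the chart later; the
  estimate is applied up to its first exit from a ball.\<close>

lemma norm_le_curve_length: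
  assumes X: "smooth_manifold X" and g: "riemannian_metric X g"
    and \<gamma>: "pw_C1_curve X \<gamma>" and ch: "(V, \<phi>) \<in> charts X"
    and T: "0 \<le> T" "T \<le> 1" and inV: "\<And>t. t \<in> {0..T} \<Longrightarrow> \<gamma> t \<in> V"
    and c: "0 < c" "\<And>t v. t \<in> {0..T} \<Longrightarrow> c * norm v \<le> sqrt (g (V, \<phi>) (\<phi> (\<gamma> t)) v v)"
  shows "ennreal (c * norm (\<phi> (\<gamma> T) - \<phi> (\<gamma> 0))) \<le> curve_length X g \<gamma>"
proof (cases "curve_length X g \<gamma> = \<infinity>")
  case False
  have path: "pathin (points X) \<gamma>"
    using \<gamma> unfolding pw_C1_curve_def by simp
  obtain S where S: "finite S" "(\<phi> \<circ> \<gamma>) C1_differentiable_on {t \<in> {0..1} - S. \<gamma> t \<in> V}"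
    using \<gamma> ch unfolding pw_C1_curve_def by fast
  obtain D where D: "\<And>t. t \<in> {0..1} - S \<Longrightarrow> \<gamma> t \<in> V \<Longrightarrow> ((\<phi> \<circ> \<gamma>) has_vector_derivative D t) (at t)"
    and contD: "continuous_on {t \<in> {0..1} - S. \<gamma> t \<in> V} D"
    using S(2) unfolding C1_differentiable_on_def by auto
  define A where "A = {0<..<T} - S"
  have AV: "t \<in> {0<..<1} - S \<and> \<gamma> t \<in> V" if "t \<in> A" for t
    using that inV T unfolding A_def by auto
  have A_borel: "A \<in> sets borel"
    unfolding A_def using S(1) by (intro sets.Diff) (auto intro: borel_closed finite_imp_closed)
  \<comment> \<open>The derivative is continuous only off the exceptional points. Cut off by the
    indicator of a Borel set on which it is continuous, its norm becomes measurable on the whole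
    line.\<close>
  define h where "h t = indicator A t * norm (D t)" for t
  have "continuous_on A (\<lambda>t. norm (D t))"
    using AV by (intro continuous_on_norm continuous_on_subset[OF contD]) fastforce
  then have "(\<lambda>t. indicator A t *\<^sub>R norm (D t)) \<in> borel_measurable borel"
    using A_borel by (intro borel_measurable_continuous_on_indicator) auto
  then have h_meas: "h \<in> borel_measurable lborel"
    by (simp add: h_def[abs_def])
  have le: "(\<integral>\<^sup>+t. ennreal (c * h t) \<partial>lborel) \<le> curve_length X g \<gamma>"
    unfolding curve_length_def
  proof (rule nn_integral_mono)
    fix t :: real
    show "ennreal (c * h t) \<le> ennreal (speed X g \<gamma> t) * indicator {0..1} t"
    proof (cases "t \<in> A")
      case True
      have "speed X g \<gamma> t = sqrt (g (V, \<phi>) (\<phi> (\<gamma> t)) (D t) (D t))"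
        using AV[OF True] by (intro speed_eq[OF X g path _ ch _ D]) auto
      moreover have "c * norm (D t) \<le> sqrt (g (V, \<phi>) (\<phi> (\<gamma> t)) (D t) (D t))"
        using True by (intro c(2)) (auto simp: A_def)
      ultimately show ?thesis
        using True AV[OF True] by (auto simp: h_def intro!: ennreal_leI)
    qed (simp add: h_def)
  qed
  \<comment> \<open>A continuous derivative off \<open>S\<close> may be unbounded near the
    exceptional points; integrability of its norm is deduced from the finite length of the
    curve.\<close>
  have ch_int: "integrable lborel (\<lambda>t. c * h t)"
  proof (rule integrableI_bounded)
    show "(\<lambda>t. c * h t) \<in> borel_measurable lborel"
      using h_meas by simp
    have "(\<integral>\<^sup>+t. ennreal (norm (c * h t)) \<partial>lborel) = (\<integral>\<^sup>+t. ennreal (c * h t) \<partial>lborel)"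
      using c(1) by (simp add: h_def)
    also have "\<dots> < \<infinity>"
      using le False by (simp add: less_top le_less_trans)
    finally show "(\<integral>\<^sup>+t. ennreal (norm (c * h t)) \<partial>lborel) < \<infinity>" .
  qed
  define I where "I = integral\<^sup>L lborel (\<lambda>t. c * h t)"
  have I: "((\<lambda>t. c * h t) has_integral I) UNIV"
    unfolding I_def by (rule has_integral_integral_lborel[OF ch_int])
  have Ile: "ennreal I \<le> curve_length X g \<gamma>"
  proof -
    have "(\<integral>\<^sup>+t. ennreal (c * h t) \<partial>lborel) = ennreal I"
      unfolding I_def using ch_int c(1) by (intro nn_integral_eq_integral) (auto simp: h_def)
    then show ?thesis
      using le by simp
  qed
  have "((\<lambda>t. if t \<in> {0..T} then c * h t else 0) has_integral I) UNIV"
    using I by (rule has_integral_eq[rotated]) (auto simp: h_def A_def)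
  then have "((\<lambda>t. c * h t) has_integral I) {0..T}"
    unfolding has_integral_restrict_UNIV .
  \<comment> \<open>The cut-off is undone at the finitely many points where it changed the
    integrand.\<close>
  then have I': "((\<lambda>t. c * norm (D t)) has_integral I) {0..T}"
    by (rule has_integral_spike_finite[of "S \<union> {0, T}", rotated 2])
      (use S(1) in \<open>auto simp: h_def A_def\<close>)
  have cont: "continuous_on {0..T} (\<phi> \<circ> \<gamma>)"
  proof -
    have "continuous_map (top_of_set {0..T}) (points X) \<gamma>"
      using path T unfolding pathin_def
      by (metis atLeastatMost_subset_iff continuous_map_from_subtopology_mono order_refl)
    then have "continuous_map (top_of_set {0..T}) (subtopology (points X) V) \<gamma>"
      using inV by (auto intro: continuous_map_into_subtopology)
    from continuous_map_compose[OF this is_chart_continuous[OF smooth_manifold_chart[OF X ch]]]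
    show ?thesis
      by simp
  qed
  have "((\<phi> \<circ> \<gamma>) has_vector_derivative D t) (at t)" if "t \<in> {0<..<T} - S" for t
    by (rule D) (use AV[of t] that in \<open>auto simp: A_def\<close>)
  then have FTC: "(D has_integral ((\<phi> \<circ> \<gamma>) T - (\<phi> \<circ> \<gamma>) 0)) {0..T}"
    by (intro fundamental_theorem_of_calculus_interior_strong[OF S(1) T(1) _ cont])
  have cD: "((\<lambda>t. c *\<^sub>R D t) has_integral c *\<^sub>R ((\<phi> \<circ> \<gamma>) T - (\<phi> \<circ> \<gamma>) 0)) {0..T}"
    using has_integral_cmul[OF FTC] .
  have "norm (integral {0..T} (\<lambda>t. c *\<^sub>R D t)) \<le> integral {0..T} (\<lambda>t. c * norm (D t))"
    using cD I' c(1) by (intro integral_norm_bound_integral) auto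
  then have "norm (c *\<^sub>R ((\<phi> \<circ> \<gamma>) T - (\<phi> \<circ> \<gamma>) 0)) \<le> I"
    unfolding integral_unique[OF cD] integral_unique[OF I'] .
  then have "c * norm (\<phi> (\<gamma> T) - \<phi> (\<gamma> 0)) \<le> I"
    using c(1) by simp
  then show ?thesis
    using Ile ennreal_leI order_trans by blast
qed simp

lemma pathin_closed_preimage:
  assumes "pathin X \<gamma>" and "closedin X C"
  shows "closed {t \<in> {0..1}. \<gamma> t \<in> C}"
proof -
  have "closedin (top_of_set {0..1}) {t \<in> topspace (top_of_set {0..1}). \<gamma> t \<in> C}"
    using assms unfolding pathin_def by (rule closedin_continuous_map_preimage)
  then show ?thesis
    by (auto intro: closedin_closed_trans)
qed

lemma riemannian_metric_chart:
  assumes "riemannian_metric X g" and "(V, \<phi>) \<in> charts X"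
  shows "smooth_on (\<phi> ` V) (g (V, \<phi>))" "\<And>x. x \<in> \<phi> ` V \<Longrightarrow> inner_form (g (V, \<phi>) x)"
  using assms unfolding riemannian_metric_def by fast+

text \<open>A first exit argument: at the first time outside the open ball the coordinates are at
  distance at least \<open>r\<close> from the start, so the part travelled so far already has length
  at least \<open>c * r\<close>. Curves shorter than that cannot leave, and the length estimate
  applies up to time 1.\<close>

lemma short_curve_in_chart:
  assumes X: "smooth_manifold X" and g: "riemannian_metric X g"
    and \<gamma>: "pw_C1_curve X \<gamma>" and ch: "(V, \<phi>) \<in> charts X" "\<gamma> 0 \<in> V"
    and r: "0 < r" "cball (\<phi> (\<gamma> 0)) r \<subseteq> \<phi> ` V"
    and c: "0 < c" "\<And>x v. x \<in> cball (\<phi> (\<gamma> 0)) r \<Longrightarrow> c * norm v \<le> sqrt (g (V, \<phi>) x v v)"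
    and short: "curve_length X g \<gamma> < ennreal (c * r)"
  shows "\<gamma> 1 \<in> V" "\<phi> (\<gamma> 1) \<in> cball (\<phi> (\<gamma> 0)) r"
    "ennreal (c * norm (\<phi> (\<gamma> 1) - \<phi> (\<gamma> 0))) \<le> curve_length X g \<gamma>"
proof -
  note chart = smooth_manifold_chart[OF X ch(1)]
  have path: "pathin (points X) \<gamma>"
    using \<gamma> unfolding pw_C1_curve_def by simp
  have \<gamma>X: "\<gamma> t \<in> topspace (points X)" if "t \<in> {0..1}" for t
    using path that unfolding pathin_def continuous_map_def by auto
  define B where "B = {y \<in> V. \<phi> y \<in> ball (\<phi> (\<gamma> 0)) r}"
  define K where "K = inv_into V \<phi> ` cball (\<phi> (\<gamma> 0)) r"
  have K: "y \<in> K \<longleftrightarrow> y \<in> V \<and> \<phi> y \<in> cball (\<phi> (\<gamma> 0)) r" for y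
  proof
    assume "y \<in> K"
    then obtain x where "y = inv_into V \<phi> x" "x \<in> cball (\<phi> (\<gamma> 0)) r"
      unfolding K_def by blast
    then show "y \<in> V \<and> \<phi> y \<in> cball (\<phi> (\<gamma> 0)) r"
      using r(2) by (metis f_inv_into_f inv_into_into subsetD)
  next
    assume "y \<in> V \<and> \<phi> y \<in> cball (\<phi> (\<gamma> 0)) r"
    then show "y \<in> K"
      unfolding K_def using is_chart_inv[OF chart] by (metis imageI)
  qed
  \<comment> \<open>Here the Hausdorff property enters: the compact set \<open>K\<close> is closed
    in \<open>X\<close>. A curve that stays in the ball before time \<open>T\<close> is then still
    in \<open>K\<close>, hence in the chart, at time \<open>T\<close>; it cannot escape from the
    chart without reaching the coordinate sphere.\<close>
  have "closedin (points X) K"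
    using compact_in_chart_inv_image[OF chart compact_cball r(2)] X
    unfolding K_def compact_in_def smooth_manifold_def by (blast intro: compactin_imp_closedin)
  have bound: "ennreal (c * norm (\<phi> (\<gamma> T) - \<phi> (\<gamma> 0))) \<le> curve_length X g \<gamma>"
    if "0 \<le> T" "T \<le> 1" "\<And>t. t \<in> {0..T} \<Longrightarrow> \<gamma> t \<in> K" for T
    using that K c by (intro norm_le_curve_length[OF X g \<gamma> ch(1)]) auto
  have "\<gamma> t \<in> B" if "t \<in> {0..1}" for t
  proof (rule ccontr)
    assume "\<gamma> t \<notin> B"
    define Z where "Z = {t \<in> {0..1}. \<gamma> t \<in> topspace (points X) - B}"
    have "openin (points X) B"
      unfolding B_def using is_chart_openin_preimage[OF chart open_ball] .
    then have "closed Z"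
      unfolding Z_def using pathin_closed_preimage[OF path] by blast
    have "t \<in> Z"
      using that \<open>\<gamma> t \<notin> B\<close> \<gamma>X unfolding Z_def by auto
    have "bdd_below Z"
      unfolding Z_def by (rule bdd_belowI[of _ 0]) auto
    \<comment> \<open>The first exit time. It belongs to \<open>Z\<close> because \<open>Z\<close>
      is closed, and it is positive because the curve starts in \<open>B\<close>; so all of the
      interval before it is spent in \<open>B\<close>.\<close>
    define T where "T = Inf Z"
    have "T \<in> Z"
      unfolding T_def using \<open>t \<in> Z\<close> \<open>bdd_below Z\<close> \<open>closed Z\<close> by (intro closed_contains_Inf) auto
    then have T: "0 \<le> T" "T \<le> 1" "\<gamma> T \<notin> B"
      unfolding Z_def by auto
    have before: "\<gamma> s \<in> B" if "s \<in> {0..<T}" for s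
    proof (rule ccontr)
      assume "\<gamma> s \<notin> B"
      then have "s \<in> Z"
        using that T \<gamma>X unfolding Z_def by auto
      then show False
        using cInf_lower[OF _ \<open>bdd_below Z\<close>] that unfolding T_def by fastforce
    qed
    have "\<gamma> 0 \<in> B"
      unfolding B_def using ch(2) r(1) by simp
    then have "T > 0"
      using T by (cases "T = 0") auto
    have BK: "B \<subseteq> K"
    proof
      fix y assume "y \<in> B"
      then show "y \<in> K"
        unfolding K[of y] B_def by auto
    qed
    have "closure {0..<T} \<subseteq> {t \<in> {0..1}. \<gamma> t \<in> K}"
      using before BK T by (intro closure_minimal pathin_closed_preimage[OF path \<open>closedin (points X) K\<close>]) auto
    then have inK: "\<gamma> s \<in> K" if "s \<in> {0..T}" for s
      using that \<open>T > 0\<close> by auto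
    have "r \<le> norm (\<phi> (\<gamma> T) - \<phi> (\<gamma> 0))"
    proof -
      have "\<gamma> T \<in> V"
        using inK[of T] T(1) K[of "\<gamma> T"] by simp
      then have "\<phi> (\<gamma> T) \<notin> ball (\<phi> (\<gamma> 0)) r"
        using T(3) unfolding B_def by blast
      then show ?thesis
        by (simp add: dist_norm norm_minus_commute)
    qed
    then have "ennreal (c * r) \<le> ennreal (c * norm (\<phi> (\<gamma> T) - \<phi> (\<gamma> 0)))"
      using c(1) by (intro ennreal_leI) auto
    also have "\<dots> \<le> curve_length X g \<gamma>"
      using bound T inK by blast
    finally show False
      using short by simp
  qed
  then have inK: "\<gamma> t \<in> K" if "t \<in> {0..1}" for t
    using that K unfolding B_def by fastforce
  then show "\<gamma> 1 \<in> V" "\<phi> (\<gamma> 1) \<in> cball (\<phi> (\<gamma> 0)) r"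
    using K by auto
  show "ennreal (c * norm (\<phi> (\<gamma> 1) - \<phi> (\<gamma> 0))) \<le> curve_length X g \<gamma>"
    using bound[of 1] inK by auto
qed

text \<open>Curves from \<open>p\<close> shorter than \<delta> cannot leave the coordinate ball of
  radius \<open>r\<close>, uniformly for \<open>p\<close> in \<open>L\<close>. The compact set
  \<open>L'\<close> collects these balls. That its image contains them is recorded because they are
  later the convex sets on which the mean value inequality is used.\<close>

lemma riem_dist_lower:
  assumes X: "smooth_manifold X" and g: "riemannian_metric X g"
    and ch: "(V, \<phi>) \<in> charts X" and L: "compact_in (points X) L V"
  obtains L' \<delta> C r where "0 < \<delta>" "0 < C" "0 < r" "compact_in (points X) L' V" "L \<subseteq> L'"
    "\<And>p x. p \<in> L \<Longrightarrow> dist (\<phi> p) x \<le> r \<Longrightarrow> x \<in> \<phi> ` L'"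
    "\<And>p q. p \<in> L \<Longrightarrow> riem_dist X g p q < ennreal \<delta> \<Longrightarrow>
      q \<in> L' \<and> dist (\<phi> p) (\<phi> q) \<le> r \<and> ennreal (dist (\<phi> p) (\<phi> q)) \<le> ennreal C * riem_dist X g p q"
proof -
  note chart = smooth_manifold_chart[OF X ch]
  have "open (\<phi> ` V)"
    using chart unfolding is_chart_def by simp
  obtain r where r: "r > 0" and N: "compact {x. \<exists>y\<in>\<phi> ` L. dist y x \<le> r}"
      "{x. \<exists>y\<in>\<phi> ` L. dist y x \<le> r} \<subseteq> \<phi> ` V"
    by (rule compact_cball_nbhd[OF compact_in_chart_image(1)[OF chart L] \<open>open (\<phi> ` V)\<close>
          compact_in_chart_image(2)[OF chart L]])
  define N where "N = {x. \<exists>y\<in>\<phi> ` L. dist y x \<le> r}"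
  have g': "continuous_on N (g (V, \<phi>))" "\<And>x. x \<in> N \<Longrightarrow> inner_form (g (V, \<phi>) x)"
    using riemannian_metric_chart[OF g ch] N(2) unfolding N_def
    by (auto intro: continuous_on_subset smooth_on_continuous)
  obtain c C where c: "c > 0" "\<And>x v. x \<in> N \<Longrightarrow> c * norm v \<le> sqrt (g (V, \<phi>) x v v)"
    using inner_form_bounds[OF N(1)[folded N_def] g'] by metis
  define L' where "L' = inv_into V \<phi> ` N"
  have L': "compact_in (points X) L' V"
    unfolding L'_def N_def by (rule compact_in_chart_inv_image[OF chart N])
  have \<phi>L': "\<phi> ` L' = N"
    unfolding L'_def using N(2)[folded N_def] by (simp add: image_inv_into_cancel)
  have inL': "q \<in> L'" if "q \<in> V" "\<phi> q \<in> N" for q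
    unfolding L'_def using that is_chart_inv[OF chart] by (metis imageI)
  have LV: "L \<subseteq> V"
    using L unfolding compact_in_def by simp
  show ?thesis
  proof
    \<comment> \<open>\<delta> is \<open>c * r\<close>, the length needed to reach the boundary of a
      ball of radius \<open>r\<close>, and \<open>C\<close> is the reciprocal of the lower bound
      \<open>c\<close> of the metric.\<close>
    show "0 < c * r" "0 < 1 / c" "0 < r" "compact_in (points X) L' V"
      using c(1) r L' by auto
    show "L \<subseteq> L'"
    proof
      fix p assume "p \<in> L"
      then show "p \<in> L'"
        using LV r by (intro inL') (auto simp: N_def intro!: bexI[of _ p])
    qed
    show "x \<in> \<phi> ` L'" if "p \<in> L" "dist (\<phi> p) x \<le> r" for p x
      unfolding \<phi>L' N_def using that by auto
    show "q \<in> L' \<and> dist (\<phi> p) (\<phi> q) \<le> r \<and>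
        ennreal (dist (\<phi> p) (\<phi> q)) \<le> ennreal (1 / c) * riem_dist X g p q"
      if p: "p \<in> L" and d: "riem_dist X g p q < ennreal (c * r)" for p q
    proof -
      have cb: "cball (\<phi> p) r \<subseteq> N"
        unfolding N_def using p by auto
      have curve: "q \<in> V \<and> \<phi> q \<in> cball (\<phi> p) r \<and> ennreal (c * norm (\<phi> q - \<phi> p)) \<le> curve_length X g \<gamma>"
        if "pw_C1_curve X \<gamma>" "\<gamma> 0 = p" "\<gamma> 1 = q" "curve_length X g \<gamma> < ennreal (c * r)" for \<gamma>
        using short_curve_in_chart[OF X g that(1) ch, of r c] that(2-4) p LV r cb N(2)[folded N_def] c
        by (auto simp: subset_iff)
      obtain \<gamma> where "pw_C1_curve X \<gamma>" "\<gamma> 0 = p" "\<gamma> 1 = q" "curve_length X g \<gamma> < ennreal (c * r)"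
        using d unfolding riem_dist_def INF_less_iff by blast
      then have q: "q \<in> V" "\<phi> q \<in> cball (\<phi> p) r"
        using curve by blast+
      have "ennreal (c * norm (\<phi> q - \<phi> p)) \<le> riem_dist X g p q"
        unfolding riem_dist_def
      proof (rule INF_greatest, safe)
        fix \<gamma> assume \<gamma>: "pw_C1_curve X \<gamma>" "p = \<gamma> 0" "q = \<gamma> 1"
        show "ennreal (c * norm (\<phi> (\<gamma> 1) - \<phi> (\<gamma> 0))) \<le> curve_length X g \<gamma>"
        proof (cases "curve_length X g \<gamma> < ennreal (c * r)")
          case True
          then show ?thesis
            using curve \<gamma> by blast
        next
          case False
          \<comment> \<open>The infimum also runs over long curves, to which the trapping argument
            does not apply. They satisfy the bound since \<open>q\<close> is already known to lie in
            the ball of radius \<open>r\<close>.\<close>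
          have "ennreal (c * norm (\<phi> q - \<phi> p)) \<le> ennreal (c * r)"
            using q(2) c(1) by (intro ennreal_leI mult_left_mono) (auto simp: dist_norm norm_minus_commute)
          then show ?thesis
            using False \<gamma> by (simp add: not_less)
        qed
      qed
      then have "ennreal (1 / c) * ennreal (c * norm (\<phi> q - \<phi> p)) \<le> ennreal (1 / c) * riem_dist X g p q"
        by (rule mult_left_mono) simp
      moreover have "ennreal (1 / c) * ennreal (c * norm (\<phi> q - \<phi> p)) = ennreal (dist (\<phi> p) (\<phi> q))"
        using c(1) by (simp add: ennreal_mult[symmetric] dist_norm norm_minus_commute)
      ultimately show ?thesis
        using q inL' cb by auto
    qed
  qed
qed

text \<open>The preimage of the coordinate segment is a competitor in the infimum. For nearby
  \<open>p\<close> and \<open>q\<close> the segment stays in the compact neighbourhood of the image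
  of \<open>L\<close>, where the upper bound of the metric limits its speed.\<close>

lemma riem_dist_upper:
  assumes X: "smooth_manifold X" and g: "riemannian_metric X g"
    and ch: "(V, \<phi>) \<in> charts X" and L: "compact_in (points X) L V"
  obtains \<delta> C where "0 < \<delta>" "0 < C"
    "\<And>p q. p \<in> L \<Longrightarrow> q \<in> V \<Longrightarrow> dist (\<phi> p) (\<phi> q) < \<delta> \<Longrightarrow>
      riem_dist X g p q \<le> ennreal (C * dist (\<phi> p) (\<phi> q))"
proof -
  note chart = smooth_manifold_chart[OF X ch]
  have "open (\<phi> ` V)"
    using chart unfolding is_chart_def by simp
  obtain r where r: "r > 0" and N: "compact {x. \<exists>y\<in>\<phi> ` L. dist y x \<le> r}"
      "{x. \<exists>y\<in>\<phi> ` L. dist y x \<le> r} \<subseteq> \<phi> ` V"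
    by (rule compact_cball_nbhd[OF compact_in_chart_image(1)[OF chart L] \<open>open (\<phi> ` V)\<close>
          compact_in_chart_image(2)[OF chart L]])
  define N where "N = {x. \<exists>y\<in>\<phi> ` L. dist y x \<le> r}"
  have g': "continuous_on N (g (V, \<phi>))" "\<And>x. x \<in> N \<Longrightarrow> inner_form (g (V, \<phi>) x)"
    using riemannian_metric_chart[OF g ch] N(2) unfolding N_def
    by (auto intro: continuous_on_subset smooth_on_continuous)
  obtain C where C: "C > 0" "\<And>x v. x \<in> N \<Longrightarrow> sqrt (g (V, \<phi>) x v v) \<le> C * norm v"
    using inner_form_bounds[OF N(1)[folded N_def] g'] by metis
  have LV: "L \<subseteq> V"
    using L unfolding compact_in_def by simp
  show ?thesis
  proof (rule that[OF r C(1)])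
    fix p q assume p: "p \<in> L" and q: "q \<in> V" and d: "dist (\<phi> p) (\<phi> q) < r"
    define l where "l t = \<phi> p + t *\<^sub>R (\<phi> q - \<phi> p)" for t
    define \<gamma> where "\<gamma> t = inv_into V \<phi> (l t)" for t
    have l_cball: "l t \<in> cball (\<phi> p) r" if "t \<in> {0..1}" for t
    proof -
      have "norm (t *\<^sub>R (\<phi> q - \<phi> p)) \<le> 1 * norm (\<phi> q - \<phi> p)"
        using that unfolding norm_scaleR by (intro mult_right_mono) auto
      then show ?thesis
        using d by (simp add: l_def dist_norm norm_minus_commute)
    qed
    have lN: "l t \<in> N" if "t \<in> {0..1}" for t
      using l_cball[OF that] p unfolding N_def by auto
    have lV: "l t \<in> \<phi> ` V" if "t \<in> {0..1}" for t
      using lN[OF that] N(2) unfolding N_def by blast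
    have \<phi>\<gamma>: "\<phi> (\<gamma> t) = l t" "\<gamma> t \<in> V" if "t \<in> {0..1}" for t
      unfolding \<gamma>_def using lV[OF that] by (auto simp: f_inv_into_f inv_into_into)
    have l_cont: "continuous_on A l" for A
      unfolding l_def by (intro continuous_intros)
    have l_deriv: "(l has_vector_derivative (\<phi> q - \<phi> p)) (at t)" for t
      unfolding l_def by (auto intro!: derivative_eq_intros)
    have ends: "\<gamma> 0 = p" "\<gamma> 1 = q"
      using is_chart_inv[OF chart] p q LV unfolding \<gamma>_def l_def by auto
    have path: "pathin (points X) \<gamma>"
    proof -
      have "continuous_map (top_of_set {0..1}) (top_of_set (\<phi> ` V)) l"
        using l_cont lV by auto
      from continuous_map_compose[OF this is_chart_continuous_inv[OF chart]] show ?thesis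
        unfolding pathin_def \<gamma>_def[abs_def] o_def .
    qed
    have curve: "pw_C1_curve X \<gamma>"
      unfolding pw_C1_curve_def
    proof (intro conjI path exI[of _ "{0, 1}"] ballI, simp, safe)
      fix W \<psi> assume W: "(W, \<psi>) \<in> charts X"
      let ?\<tau> = "\<psi> \<circ> inv_into V \<phi>" and ?T = "{t \<in> {0..1} - {0, 1}. \<gamma> t \<in> W}"
      note smooth = smooth_manifold_transition[OF X ch W]
      have "open (\<phi> ` (V \<inter> W))"
        using is_chart_open_image[OF chart] is_chart_open[OF smooth_manifold_chart[OF X W]] .
      have lVW: "l t \<in> \<phi> ` (V \<inter> W)" if "t \<in> ?T" for t
        using \<phi>\<gamma>[of t] that by (metis (no_types, lifting) Diff_iff Int_iff imageI mem_Collect_eq)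
      have deriv: "((\<psi> \<circ> \<gamma>) has_vector_derivative frechet_derivative ?\<tau> (at (l t)) (\<phi> q - \<phi> p)) (at t)"
        if "t \<in> ?T" for t
      proof -
        have "?\<tau> differentiable (at (l t))"
          using smooth_on_differentiable[OF smooth] lVW[OF that] .
        then have D: "(?\<tau> has_derivative frechet_derivative ?\<tau> (at (l t))) (at (l t))"
          by (simp add: frechet_derivative_works)
        have "((?\<tau> \<circ> l) has_derivative
            (frechet_derivative ?\<tau> (at (l t)) \<circ> (\<lambda>h. h *\<^sub>R (\<phi> q - \<phi> p)))) (at t)"
          using l_deriv[unfolded has_vector_derivative_def] D by (rule diff_chain_at)
        moreover have "frechet_derivative ?\<tau> (at (l t)) \<circ> (\<lambda>h. h *\<^sub>R (\<phi> q - \<phi> p))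
            = (\<lambda>h. h *\<^sub>R frechet_derivative ?\<tau> (at (l t)) (\<phi> q - \<phi> p))"
          using linear_scale[OF has_derivative_linear[OF D]] by (simp add: fun_eq_iff)
        moreover have "?\<tau> \<circ> l = \<psi> \<circ> \<gamma>"
          by (simp add: fun_eq_iff \<gamma>_def)
        ultimately show ?thesis
          unfolding has_vector_derivative_def by simp
      qed
      moreover have "continuous_on ?T (\<lambda>t. frechet_derivative ?\<tau> (at (l t)) (\<phi> q - \<phi> p))"
        by (rule continuous_on_compose2[OF smooth_on_continuous_derivative[OF smooth] l_cont])
          (rule image_subsetI, rule lVW)
      ultimately show "(\<psi> \<circ> \<gamma>) C1_differentiable_on {t \<in> {0..1} - {0, 1}. \<gamma> t \<in> W}"
        unfolding C1_differentiable_on_def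
        by (intro exI[of _ "\<lambda>t. frechet_derivative ?\<tau> (at (l t)) (\<phi> q - \<phi> p)"] conjI ballI)
    qed
    have speed: "speed X g \<gamma> t \<le> C * dist (\<phi> p) (\<phi> q)" if "t \<in> {0<..<1}" for t
    proof -
      have t01: "t \<in> {0..1}"
        using that by auto
      have "((\<phi> \<circ> \<gamma>) has_vector_derivative (\<phi> q - \<phi> p)) (at t)"
        using l_deriv
        by (rule has_vector_derivative_transform_within_open[of _ _ _ "{0<..<1}"])
          (use that \<phi>\<gamma>(1) in \<open>simp_all add: o_def\<close>)
      from speed_eq[OF X g path that ch \<phi>\<gamma>(2)[OF t01] this]
      have "speed X g \<gamma> t = sqrt (g (V, \<phi>) (\<phi> (\<gamma> t)) (\<phi> q - \<phi> p) (\<phi> q - \<phi> p))" .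
      also have "\<dots> \<le> C * norm (\<phi> q - \<phi> p)"
        unfolding \<phi>\<gamma>(1)[OF t01] by (rule C(2)[OF lN[OF t01]])
      finally show ?thesis
        by (simp add: dist_norm norm_minus_commute)
    qed
    have "curve_length X g \<gamma> \<le> (\<integral>\<^sup>+t\<in>{0..1::real}. ennreal (C * dist (\<phi> p) (\<phi> q)) \<partial>lborel)"
      unfolding curve_length_def
    proof (rule nn_integral_mono_AE)
      \<comment> \<open>The speed is estimated at interior times only; the two end points form a
        null set.\<close>
      have "AE t in lborel. t \<noteq> (0::real) \<and> t \<noteq> 1"
        using AE_lborel_singleton by (intro AE_conjI)
      then show "AE t in lborel. ennreal (speed X g \<gamma> t) * indicator {0..1} t
          \<le> ennreal (C * dist (\<phi> p) (\<phi> q)) * indicator {0..1} t"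
      proof (rule AE_mp, intro AE_I2 impI)
        fix t :: real assume "t \<noteq> 0 \<and> t \<noteq> 1"
        then show "ennreal (speed X g \<gamma> t) * indicator {0..1} t
            \<le> ennreal (C * dist (\<phi> p) (\<phi> q)) * indicator {0..1} t"
          using speed[of t] by (auto simp: indicator_def intro!: ennreal_leI)
      qed
    qed
    also have "\<dots> = ennreal (C * dist (\<phi> p) (\<phi> q))"
      by (simp add: nn_integral_cmult_indicator)
    finally show "riem_dist X g p q \<le> ennreal (C * dist (\<phi> p) (\<phi> q))"
      unfolding riem_dist_def using curve ends by (intro INF_lower2[of \<gamma>]) auto
  qed
qed

text \<open>Closeness on the manifold becomes closeness of coordinates, for those \<epsilon> at
  which the first net is in \<open>L\<close>. The second net may lie outside \<open>L\<close>, but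
  for small \<epsilon> only within the larger compact \<open>L'\<close> of the same chart.\<close>

lemma point_close_chart:
  assumes X: "smooth_manifold X" and g: "riemannian_metric X g"
    and pq: "point_close X g p q"
    and ch: "(V, \<phi>) \<in> charts X" and L: "compact_in (points X) L V"
  obtains L' r where "0 < r" "compact_in (points X) L' V" "L \<subseteq> L'"
    "\<And>p x. p \<in> L \<Longrightarrow> dist (\<phi> p) x \<le> r \<Longrightarrow> x \<in> \<phi> ` L'"
    "\<forall>\<^sub>F \<epsilon> in at_right 0. p \<epsilon> \<in> L \<longrightarrow> q \<epsilon> \<in> L' \<and> dist (\<phi> (p \<epsilon>)) (\<phi> (q \<epsilon>)) \<le> r"
    "negl_on (\<lambda>\<epsilon>. p \<epsilon> \<in> L) (\<lambda>\<epsilon>. dist (\<phi> (p \<epsilon>)) (\<phi> (q \<epsilon>)))"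
proof -
  obtain \<delta> C r L' where L': "0 < \<delta>" "0 < C" "0 < r" "compact_in (points X) L' V" "L \<subseteq> L'"
    "\<And>p x. p \<in> L \<Longrightarrow> dist (\<phi> p) x \<le> r \<Longrightarrow> x \<in> \<phi> ` L'"
    "\<And>p q. p \<in> L \<Longrightarrow> riem_dist X g p q < ennreal \<delta> \<Longrightarrow>
      q \<in> L' \<and> dist (\<phi> p) (\<phi> q) \<le> r \<and> ennreal (dist (\<phi> p) (\<phi> q)) \<le> ennreal C * riem_dist X g p q"
    by (rule riem_dist_lower[OF X g ch L]) (rule that)
  have neg: "negligible_net (\<lambda>\<epsilon>. riem_dist X g (p \<epsilon>) (q \<epsilon>))"
    using pq unfolding point_close_def .
  have "\<forall>\<^sub>F \<epsilon> in at_right 0. riem_dist X g (p \<epsilon>) (q \<epsilon>) < ennreal \<delta>"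
    using order_tendstoD(2)[OF negligible_net_tendsto[OF neg], of "ennreal \<delta>"] L'(1) by simp
  then have ev: "\<forall>\<^sub>F \<epsilon> in at_right 0. p \<epsilon> \<in> L \<longrightarrow> q \<epsilon> \<in> L' \<and> dist (\<phi> (p \<epsilon>)) (\<phi> (q \<epsilon>)) \<le> r \<and>
      ennreal (dist (\<phi> (p \<epsilon>)) (\<phi> (q \<epsilon>))) \<le> ennreal C * riem_dist X g (p \<epsilon>) (q \<epsilon>)"
    by eventually_elim (use L'(7) in blast)
  show ?thesis
  proof (rule that[OF L'(3,4,5,6)])
    show "\<forall>\<^sub>F \<epsilon> in at_right 0. p \<epsilon> \<in> L \<longrightarrow> q \<epsilon> \<in> L' \<and> dist (\<phi> (p \<epsilon>)) (\<phi> (q \<epsilon>)) \<le> r"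
      using ev by eventually_elim blast
    show "negl_on (\<lambda>\<epsilon>. p \<epsilon> \<in> L) (\<lambda>\<epsilon>. dist (\<phi> (p \<epsilon>)) (\<phi> (q \<epsilon>)))"
      by (rule negligible_netD[OF negligible_net_cmult[OF neg L'(2)]]) (use ev in eventually_elim, blast)
  qed
qed

lemma point_close_self:
  assumes X: "smooth_manifold X" and p: "\<And>\<epsilon>. \<epsilon> \<in> idx \<Longrightarrow> p \<epsilon> \<in> topspace (points X)"
    and "\<And>\<epsilon>. \<epsilon> \<in> idx \<Longrightarrow> q \<epsilon> = p \<epsilon>"
  shows "point_close X g p q"
  unfolding point_close_def
proof (rule negligible_netI[OF negl_on_zero])
  show "\<forall>\<^sub>F \<epsilon> in at_right 0. riem_dist X g (p \<epsilon>) (q \<epsilon>) \<le> ennreal 0"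
    using eventually_idx by eventually_elim (simp add: assms riem_dist_self)
qed

section \<open>Vector bundle charts\<close>

text \<open>Real scalars act through \<open>of_real\<close>; the estimates use real linearity only,
  whatever the scalar field.\<close>

lemma scalar_linear_imp_linear:
  assumes "scalar_mult s" and "scalar_mult t" and "Vector_Spaces.linear s t f"
  shows "linear f"
proof (rule linearI)
  interpret Vector_Spaces.linear s t f
    by (rule assms(3))
  show "f (x + y) = f x + f y" for x y
    by (rule add)
  show "f (r *\<^sub>R x) = r *\<^sub>R f x" for r x
    using scale[of "of_real r" x] assms(1,2) unfolding scalar_mult_def by simp
qed

lemma vb_manifold: "vector_bundle E \<Longrightarrow> smooth_manifold (base E)"
  unfolding vector_bundle_def by simp

lemma vb_chart_base: "vector_bundle E \<Longrightarrow> (V, \<phi>, \<eta>) \<in> vb_charts E \<Longrightarrow> (V, \<phi>) \<in> charts (base E)"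
  unfolding vector_bundle_def is_vb_chart_def by fast

lemma vb_chart_is_chart:
  "vector_bundle E \<Longrightarrow> (V, \<phi>, \<eta>) \<in> vb_charts E \<Longrightarrow> is_chart (points (base E)) (V, \<phi>)"
  using smooth_manifold_chart vb_manifold vb_chart_base by blast

lemma vb_chart_total:
  assumes "vector_bundle E" and "(V, \<phi>, \<eta>) \<in> vb_charts E"
  shows "is_chart (total E) (over E V, \<lambda>z. (\<phi> (proj E z), \<eta> z))"
    and "(\<lambda>z. (\<phi> (proj E z), \<eta> z)) ` over E V = \<phi> ` V \<times> UNIV"
proof -
  have "is_vb_chart E (V, \<phi>, \<eta>)"
    using assms unfolding vector_bundle_def by blast
  then show "is_chart (total E) (over E V, \<lambda>z. (\<phi> (proj E z), \<eta> z))"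
    and "(\<lambda>z. (\<phi> (proj E z), \<eta> z)) ` over E V = \<phi> ` V \<times> UNIV"
    unfolding is_vb_chart_def total_chart_def by simp_all
qed

lemma vb_proj:
  "vector_bundle E \<Longrightarrow> z \<in> topspace (total E) \<Longrightarrow> proj E z \<in> topspace (points (base E))"
  unfolding vector_bundle_def continuous_map_def by auto

lemma vb_covered:
  "vector_bundle E \<Longrightarrow> p \<in> topspace (points (base E)) \<Longrightarrow> \<exists>(V, \<phi>, \<eta>)\<in>vb_charts E. p \<in> V"
  unfolding vector_bundle_def by auto

lemma vb_point_eq:
  "vb_point E (V, \<phi>, \<eta>) x \<xi> = inv_into (over E V) (\<lambda>z. (\<phi> (proj E z), \<eta> z)) (x, \<xi>)"
  unfolding vb_point_def total_chart_def by simp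

lemma vb_point_props:
  assumes E: "vector_bundle E" and c: "(V, \<phi>, \<eta>) \<in> vb_charts E" and p: "p \<in> V"
  shows "vb_point E (V, \<phi>, \<eta>) (\<phi> p) \<xi> \<in> topspace (total E)"
    and "proj E (vb_point E (V, \<phi>, \<eta>) (\<phi> p) \<xi>) = p"
    and "\<eta> (vb_point E (V, \<phi>, \<eta>) (\<phi> p) \<xi>) = \<xi>"
proof -
  let ?\<Phi> = "\<lambda>z. (\<phi> (proj E z), \<eta> z)" and ?z = "vb_point E (V, \<phi>, \<eta>) (\<phi> p) \<xi>"
  have in_img: "(\<phi> p, \<xi>) \<in> ?\<Phi> ` over E V"
    unfolding vb_chart_total(2)[OF E c] using p by auto
  have over: "?z \<in> over E V"
    unfolding vb_point_eq using inv_into_into[OF in_img] .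
  have "?\<Phi> ?z = (\<phi> p, \<xi>)"
    unfolding vb_point_eq using f_inv_into_f[OF in_img] .
  then have eq: "\<phi> (proj E ?z) = \<phi> p" "\<eta> ?z = \<xi>"
    by auto
  show "?z \<in> topspace (total E)" "\<eta> ?z = \<xi>"
    using over eq unfolding over_def by auto
  have "proj E ?z \<in> V"
    using over unfolding over_def by auto
  then show "proj E ?z = p"
    using inj_onD[OF is_chart_inj[OF vb_chart_is_chart[OF E c]] eq(1)] p by blast
qed

lemma vb_point_coords:
  assumes E: "vector_bundle E" and c: "(V, \<phi>, \<eta>) \<in> vb_charts E"
    and z: "z \<in> topspace (total E)" "proj E z \<in> V"
  shows "vb_point E (V, \<phi>, \<eta>) (\<phi> (proj E z)) (\<eta> z) = z"
  unfolding vb_point_eq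
  using inv_into_f_f[OF is_chart_inj[OF vb_chart_total(1)[OF E c]], of z] z unfolding over_def by simp

lemma vb_scalar_mult: "vector_bundle E \<Longrightarrow> scalar_mult (smul E)"
  unfolding vector_bundle_def by simp

lemma vb_transition_linear:
  assumes E: "vector_bundle E" and c: "(V, \<phi>, \<eta>) \<in> vb_charts E" and d: "(W, \<psi>, \<theta>) \<in> vb_charts E"
    and p: "p \<in> V" "p \<in> W"
  shows "linear (\<lambda>\<xi>. \<theta> (vb_point E (V, \<phi>, \<eta>) (\<phi> p) \<xi>))"
proof -
  have "vb_compatible E (V, \<phi>, \<eta>) (W, \<psi>, \<theta>)"
    using E c d unfolding vector_bundle_def by blast
  then have "Vector_Spaces.linear (smul E) (smul E) (\<lambda>\<xi>. \<theta> (vb_point E (V, \<phi>, \<eta>) (\<phi> p) \<xi>))"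
    using p unfolding vb_compatible_def by auto
  then show ?thesis
    using scalar_linear_imp_linear vb_scalar_mult[OF E] by blast
qed

lemma vb_transition_smooth:
  assumes E: "vector_bundle E" and c: "(V, \<phi>, \<eta>) \<in> vb_charts E" and d: "(W, \<psi>, \<theta>) \<in> vb_charts E"
  shows "open (\<phi> ` (V \<inter> W) \<times> (UNIV :: 'e::fin_dim_normed set))"
    and "smooth_on (\<phi> ` (V \<inter> W) \<times> (UNIV :: 'e set)) (\<lambda>y. \<theta> (vb_point E (V, \<phi>, \<eta>) (fst y) (snd y)))"
proof -
  let ?\<Phi> = "\<lambda>z. (\<phi> (proj E z), \<eta> z)" and ?\<Psi> = "\<lambda>z. (\<psi> (proj E z), \<theta> z)"
  show op: "open (\<phi> ` (V \<inter> W) \<times> (UNIV :: 'e set))"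
    using is_chart_open_image[OF vb_chart_is_chart[OF E c]] is_chart_open[OF vb_chart_is_chart[OF E d]]
    by (intro open_Times) auto
  have img: "?\<Phi> ` (over E V \<inter> over E W) = \<phi> ` (V \<inter> W) \<times> UNIV"
  proof safe
    fix p \<xi> assume "p \<in> V" "p \<in> W"
    then show "(\<phi> p, \<xi>) \<in> ?\<Phi> ` (over E V \<inter> over E W)"
      using vb_point_props[OF E c \<open>p \<in> V\<close>, of \<xi>] unfolding over_def
      by (intro image_eqI[of _ _ "vb_point E (V, \<phi>, \<eta>) (\<phi> p) \<xi>"]) auto
  qed (auto simp: over_def)
  have "vb_compatible E (V, \<phi>, \<eta>) (W, \<psi>, \<theta>)"
    using E c d unfolding vector_bundle_def by blast
  then have "smooth_on (\<phi> ` (V \<inter> W) \<times> UNIV) (?\<Psi> \<circ> inv_into (over E V) ?\<Phi>)"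
    unfolding vb_compatible_def compatible_def total_chart_def img[symmetric] by simp
  from smooth_on_bounded_linear[OF bounded_linear_snd op this]
  show "smooth_on (\<phi> ` (V \<inter> W) \<times> (UNIV :: 'e set)) (\<lambda>y. \<theta> (vb_point E (V, \<phi>, \<eta>) (fst y) (snd y)))"
    unfolding vb_point_eq by simp
qed

text \<open>Prescribing a coordinate vector \<open>f \<eta>\<close> for every chart at
  \<open>p\<close>, compatibly with the transition maps, is the same as prescribing one point of the
  fiber. This makes the definite descriptions behind \<open>vb_zero\<close> and
  \<open>vb_minus\<close> meaningful: zero and differences are preserved by linear transition
  maps.\<close>

lemma vb_fiber_ex:
  assumes E: "vector_bundle E" and p: "p \<in> topspace (points (base E))"
    and lin: "\<And>V \<phi> \<eta> W \<psi> \<theta>. (V, \<phi>, \<eta>) \<in> vb_charts E \<Longrightarrow> (W, \<psi>, \<theta>) \<in> vb_charts E \<Longrightarrow> p \<in> V \<Longrightarrow> p \<in> W \<Longrightarrow>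
      \<theta> (vb_point E (V, \<phi>, \<eta>) (\<phi> p) (f \<eta>)) = f \<theta>"
  shows "\<exists>!z. z \<in> topspace (total E) \<and> proj E z = p \<and> (\<forall>(V, \<phi>, \<eta>)\<in>vb_charts E. p \<in> V \<longrightarrow> \<eta> z = f \<eta>)"
proof -
  obtain V \<phi> \<eta> where c: "(V, \<phi>, \<eta>) \<in> vb_charts E" "p \<in> V"
    using vb_covered[OF E p] by blast
  show ?thesis
  proof (rule ex1I[of _ "vb_point E (V, \<phi>, \<eta>) (\<phi> p) (f \<eta>)"])
    fix z assume z: "z \<in> topspace (total E) \<and> proj E z = p \<and>
      (\<forall>(V, \<phi>, \<eta>)\<in>vb_charts E. p \<in> V \<longrightarrow> \<eta> z = f \<eta>)"
    then have "\<eta> z = f \<eta>"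
      using c by blast
    then show "z = vb_point E (V, \<phi>, \<eta>) (\<phi> p) (f \<eta>)"
      using vb_point_coords[OF E c(1), of z] z c(2) by simp
  qed (use vb_point_props[OF E c] lin[OF c(1) _ c(2)] in auto)
qed

lemma vb_zero_props:
  assumes E: "vector_bundle E" and p: "p \<in> topspace (points (base E))"
  shows "vb_zero E p \<in> topspace (total E)" and "proj E (vb_zero E p) = p"
    and "\<And>V \<phi> \<eta>. (V, \<phi>, \<eta>) \<in> vb_charts E \<Longrightarrow> p \<in> V \<Longrightarrow> \<eta> (vb_zero E p) = 0"
proof -
  have "\<exists>!z. z \<in> topspace (total E) \<and> proj E z = p \<and> (\<forall>(V, \<phi>, \<eta>)\<in>vb_charts E. p \<in> V \<longrightarrow> \<eta> z = 0)"
    by (rule vb_fiber_ex[OF E p, of "\<lambda>_. 0"]) (rule linear_0[OF vb_transition_linear[OF E]])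
  from theI'[OF this] show "vb_zero E p \<in> topspace (total E)" "proj E (vb_zero E p) = p"
    "\<And>V \<phi> \<eta>. (V, \<phi>, \<eta>) \<in> vb_charts E \<Longrightarrow> p \<in> V \<Longrightarrow> \<eta> (vb_zero E p) = 0"
    unfolding vb_zero_def by blast+
qed

lemma vb_minus_props:
  assumes E: "vector_bundle E" and z: "z \<in> topspace (total E)" "z' \<in> topspace (total E)"
    and pz: "proj E z' = proj E z"
  shows "vb_minus E z z' \<in> topspace (total E)" and "proj E (vb_minus E z z') = proj E z"
    and "\<And>V \<phi> \<eta>. (V, \<phi>, \<eta>) \<in> vb_charts E \<Longrightarrow> proj E z \<in> V \<Longrightarrow> \<eta> (vb_minus E z z') = \<eta> z - \<eta> z'"
proof -
  have "\<theta> (vb_point E (V, \<phi>, \<eta>) (\<phi> (proj E z)) (\<eta> z - \<eta> z')) = \<theta> z - \<theta> z'"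
    if c: "(V, \<phi>, \<eta>) \<in> vb_charts E" and d: "(W, \<psi>, \<theta>) \<in> vb_charts E"
      and p: "proj E z \<in> V" "proj E z \<in> W" for V \<phi> \<eta> W \<psi> \<theta>
    using linear_diff[OF vb_transition_linear[OF E c d p]] vb_point_coords[OF E c z(1)]
      vb_point_coords[OF E c z(2)] p pz by simp
  then have "\<exists>!w. w \<in> topspace (total E) \<and> proj E w = proj E z \<and>
      (\<forall>(V, \<phi>, \<eta>)\<in>vb_charts E. proj E z \<in> V \<longrightarrow> \<eta> w = \<eta> z - \<eta> z')"
    by (intro vb_fiber_ex[OF E vb_proj[OF E z(1)], of "\<lambda>\<eta>. \<eta> z - \<eta> z'"])
  from theI'[OF this] show "vb_minus E z z' \<in> topspace (total E)" "proj E (vb_minus E z z') = proj E z"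
    "\<And>V \<phi> \<eta>. (V, \<phi>, \<eta>) \<in> vb_charts E \<Longrightarrow> proj E z \<in> V \<Longrightarrow> \<eta> (vb_minus E z z') = \<eta> z - \<eta> z'"
    unfolding vb_minus_def by blast+
qed

section \<open>Fiber norms in charts\<close>

lemma fiber_norm_chart:
  fixes E :: "('x, 'a::fin_dim_normed, 'p, 'e::fin_dim_normed, 'k) vbundle"
  assumes "fiber_metric E h" and "(V, \<phi>, \<eta>) \<in> vb_charts E"
  obtains H :: "'a \<Rightarrow> 'e \<Rightarrow>\<^sub>L 'e \<Rightarrow>\<^sub>L real"
  where "continuous_on (\<phi> ` V) H" "\<And>x. x \<in> \<phi> ` V \<Longrightarrow> inner_form (H x)"
    "\<And>z. z \<in> topspace (total E) \<Longrightarrow> proj E z \<in> V \<Longrightarrow>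
      fiber_norm h z = sqrt (H (\<phi> (proj E z)) (\<eta> z) (\<eta> z))"
proof -
  obtain H :: "'a \<Rightarrow> 'e \<Rightarrow>\<^sub>L 'e \<Rightarrow>\<^sub>L real" where H:
      "smooth_on (\<phi> ` V) H" "\<forall>x\<in>\<phi> ` V. inner_form (H x)"
      "\<forall>z\<in>over E V. \<forall>z'\<in>over E V. proj E z = proj E z' \<longrightarrow> h z z' = H (\<phi> (proj E z)) (\<eta> z) (\<eta> z')"
    using assms unfolding fiber_metric_def by fast
  show ?thesis
    by (rule that[of H]) (use H smooth_on_continuous in \<open>auto simp: fiber_norm_def over_def\<close>)
qed

lemma fiber_norm_bounds:
  fixes E :: "('x, 'a::fin_dim_normed, 'p, 'e::fin_dim_normed, 'k::real_or_complex) vbundle"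
  assumes E: "vector_bundle E" and h: "fiber_metric E h" and c: "(V, \<phi>, \<eta>) \<in> vb_charts E"
    and L: "compact_in (points (base E)) L V"
  obtains C where "0 < C"
    "\<And>z. z \<in> topspace (total E) \<Longrightarrow> proj E z \<in> L \<Longrightarrow> norm (\<eta> z) \<le> C * fiber_norm h z"
    "\<And>z. z \<in> topspace (total E) \<Longrightarrow> proj E z \<in> L \<Longrightarrow> fiber_norm h z \<le> C * norm (\<eta> z)"
proof -
  obtain H :: "'a \<Rightarrow> 'e \<Rightarrow>\<^sub>L 'e \<Rightarrow>\<^sub>L real" where H:
    "continuous_on (\<phi> ` V) H" "\<And>x. x \<in> \<phi> ` V \<Longrightarrow> inner_form (H x)"
    "\<And>z. z \<in> topspace (total E) \<Longrightarrow> proj E z \<in> V \<Longrightarrow>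
      fiber_norm h z = sqrt (H (\<phi> (proj E z)) (\<eta> z) (\<eta> z))"
    by (rule fiber_norm_chart[OF h c]) (rule that)
  note im = compact_in_chart_image[OF vb_chart_is_chart[OF E c] L]
  obtain c' C where cC: "c' > 0" "C > 0"
    "\<And>x v. x \<in> \<phi> ` L \<Longrightarrow> c' * norm v \<le> sqrt (H x v v)"
    "\<And>x v. x \<in> \<phi> ` L \<Longrightarrow> sqrt (H x v v) \<le> C * norm v"
    using inner_form_bounds[OF im(1) continuous_on_subset[OF H(1) im(2)]] H(2) im(2) by (metis subsetD)
  have LV: "L \<subseteq> V"
    using L unfolding compact_in_def by simp
  show ?thesis
  proof (rule that[of "C + 1 / c'"])
    fix z assume z: "z \<in> topspace (total E)" "proj E z \<in> L"
    then have eq: "fiber_norm h z = sqrt (H (\<phi> (proj E z)) (\<eta> z) (\<eta> z))"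
      using H(3) LV by blast
    have "c' * norm (\<eta> z) \<le> fiber_norm h z" "fiber_norm h z \<le> C * norm (\<eta> z)"
      unfolding eq using cC(3,4) z(2) by blast+
    moreover from this have "0 \<le> fiber_norm h z"
      using cC(1) by (meson less_imp_le mult_nonneg_nonneg norm_ge_zero order_trans)
    ultimately show "norm (\<eta> z) \<le> (C + 1 / c') * fiber_norm h z" "fiber_norm h z \<le> (C + 1 / c') * norm (\<eta> z)"
      using cC(1,2) by (auto simp: field_simps add_increasing add_increasing2)
  qed (use cC in \<open>simp add: add_pos_pos\<close>)
qed

lemma fiber_norm_nonneg:
  fixes E :: "('x, 'a::fin_dim_normed, 'p, 'e::fin_dim_normed, 'k::real_or_complex) vbundle"
  assumes E: "vector_bundle E" and h: "fiber_metric E h" and z: "z \<in> topspace (total E)"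
  shows "0 \<le> fiber_norm h z"
proof -
  obtain V \<phi> \<eta> where c: "(V, \<phi>, \<eta>) \<in> vb_charts E" "proj E z \<in> V"
    using vb_covered[OF E vb_proj[OF E z]] by blast
  obtain H :: "'a \<Rightarrow> 'e \<Rightarrow>\<^sub>L 'e \<Rightarrow>\<^sub>L real" where
    H: "\<And>x. x \<in> \<phi> ` V \<Longrightarrow> inner_form (H x)"
    "\<And>z. z \<in> topspace (total E) \<Longrightarrow> proj E z \<in> V \<Longrightarrow>
      fiber_norm h z = sqrt (H (\<phi> (proj E z)) (\<eta> z) (\<eta> z))"
    by (rule fiber_norm_chart[OF h c(1)]) (rule that)
  have "inner_form (H (\<phi> (proj E z)))"
    using H(1) c(2) by blast
  then have "0 \<le> H (\<phi> (proj E z)) (\<eta> z) (\<eta> z)"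
    unfolding inner_form_def by (metis blinfun.zero_right less_imp_le order_refl)
  then show ?thesis
    using H(2)[OF z c(2)] by simp
qed

text \<open>The parallelogram identity with its nonnegative term in \<open>a + b\<close> dropped;
  the cross terms cancel, so no Cauchy-Schwarz inequality is involved. The constant 2 is crude, but
  only orders of growth matter.\<close>

lemma fiber_norm_diff_le:
  fixes E :: "('x, 'a::fin_dim_normed, 'p, 'e::fin_dim_normed, 'k::real_or_complex) vbundle"
  assumes E: "vector_bundle E" and h: "fiber_metric E h" and c: "(V, \<phi>, \<eta>) \<in> vb_charts E"
    and z: "z \<in> topspace (total E)" "z\<^sub>1 \<in> topspace (total E)" "z\<^sub>2 \<in> topspace (total E)"
    and pz: "proj E z \<in> V" "proj E z\<^sub>1 = proj E z" "proj E z\<^sub>2 = proj E z"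
    and eq: "\<eta> z = \<eta> z\<^sub>1 - \<eta> z\<^sub>2"
  shows "fiber_norm h z \<le> 2 * fiber_norm h z\<^sub>1 + 2 * fiber_norm h z\<^sub>2"
proof -
  obtain H' :: "'a \<Rightarrow> 'e \<Rightarrow>\<^sub>L 'e \<Rightarrow>\<^sub>L real" where
    H': "\<And>x. x \<in> \<phi> ` V \<Longrightarrow> inner_form (H' x)"
    "\<And>z. z \<in> topspace (total E) \<Longrightarrow> proj E z \<in> V \<Longrightarrow>
      fiber_norm h z = sqrt (H' (\<phi> (proj E z)) (\<eta> z) (\<eta> z))"
    by (rule fiber_norm_chart[OF h c]) (rule that)
  define H where "H = H' (\<phi> (proj E z))"
  define a b where "a = \<eta> z\<^sub>1" and "b = \<eta> z\<^sub>2"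
  have "inner_form H"
    unfolding H_def using H'(1) pz(1) by blast
  then have pos: "0 \<le> H v v" for v
    unfolding inner_form_def by (metis blinfun.zero_right less_imp_le order_refl)
  have "H (a - b) (a - b) + H (a + b) (a + b) = 2 * H a a + 2 * H b b"
    by (simp add: blinfun.diff_right blinfun.diff_left blinfun.add_right blinfun.add_left)
  then have "H (a - b) (a - b) \<le> 2 * H a a + 2 * H b b"
    using pos[of "a + b"] by linarith
  also have "\<dots> \<le> (2 * sqrt (H a a) + 2 * sqrt (H b b))\<^sup>2"
    using pos[of a] pos[of b] by (simp add: power2_sum power_mult_distrib)
  finally have "sqrt (H (a - b) (a - b)) \<le> 2 * sqrt (H a a) + 2 * sqrt (H b b)"
    using pos by (intro real_le_lsqrt) auto
  then show ?thesis
    using H'(2)[OF z(1) pz(1)] H'(2)[OF z(2)] H'(2)[OF z(3)] pz eq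
    unfolding a_def b_def H_def by simp
qed

lemma fiber_norm_zero:
  fixes E :: "('x, 'a::fin_dim_normed, 'p, 'e::fin_dim_normed, 'k::real_or_complex) vbundle"
  assumes E: "vector_bundle E" and h: "fiber_metric E h" and p: "p \<in> topspace (points (base E))"
  shows "fiber_norm h (vb_zero E p) = 0"
proof -
  obtain V \<phi> \<eta> where c: "(V, \<phi>, \<eta>) \<in> vb_charts E" "p \<in> V"
    using vb_covered[OF E p] by blast
  obtain H :: "'a \<Rightarrow> 'e \<Rightarrow>\<^sub>L 'e \<Rightarrow>\<^sub>L real" where
    H: "\<And>z. z \<in> topspace (total E) \<Longrightarrow> proj E z \<in> V \<Longrightarrow>
      fiber_norm h z = sqrt (H (\<phi> (proj E z)) (\<eta> z) (\<eta> z))"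
    by (rule fiber_norm_chart[OF h c(1)]) (rule that)
  show ?thesis
    using H[of "vb_zero E p"] vb_zero_props(1,2)[OF E p] vb_zero_props(3)[OF E p c] c(2)
    by (simp add: blinfun.zero_right)
qed

lemma vb_compactin_cover:
  assumes E: "vector_bundle E" and K: "compactin (points (base E)) K"
  obtains I where "finite I"
    "\<And>c L. (c, L) \<in> I \<Longrightarrow> c \<in> vb_charts E \<and> compact_in (points (base E)) L (fst c)"
    "\<And>p. p \<in> K \<Longrightarrow> \<exists>(c, L)\<in>I. p \<in> L"
proof (rule compactin_cover_charts[OF K, of "vb_charts E" fst "\<lambda>c. fst (snd c)"])
  show "is_chart (points (base E)) (fst c, fst (snd c))" if "c \<in> vb_charts E" for c
    using vb_chart_is_chart[OF E, of "fst c" "fst (snd c)" "snd (snd c)"] that by simp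
  show "\<exists>c\<in>vb_charts E. p \<in> fst c" if p: "p \<in> K" for p
  proof -
    obtain V \<phi> \<eta> where "(V, \<phi>, \<eta>) \<in> vb_charts E" "p \<in> V"
      using vb_covered[OF E, of p] compactin_subset_topspace[OF K] p by blast
    then show ?thesis
      by force
  qed
qed (rule that)

section \<open>Generalized vector bundle points\<close>

lemma vb_moderate_iff:
  "e \<in> vb_moderate E h \<longleftrightarrow> (\<forall>\<epsilon>\<in>idx. e \<epsilon> \<in> topspace (total E)) \<and>
     (\<exists>K. compactin (points (base E)) K \<and> (\<forall>\<^sub>F \<epsilon> in at_right 0. proj E (e \<epsilon>) \<in> K)) \<and>
     mod_on (\<lambda>_. True) (\<lambda>\<epsilon>. fiber_norm h (e \<epsilon>))"
  unfolding vb_moderate_def mod_on_def by simp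

lemma vb_point_equiv_iff:
  "(e, e') \<in> vb_point_equiv E g h \<longleftrightarrow> e \<in> vb_moderate E h \<and> e' \<in> vb_moderate E h \<and>
     point_close (base E) g (\<lambda>\<epsilon>. proj E (e \<epsilon>)) (\<lambda>\<epsilon>. proj E (e' \<epsilon>)) \<and>
     (\<forall>W \<psi> \<theta> L'. (W, \<psi>, \<theta>) \<in> vb_charts E \<longrightarrow> compact_in (points (base E)) L' W \<longrightarrow>
        negl_on (\<lambda>\<epsilon>. proj E (e \<epsilon>) \<in> L' \<and> proj E (e' \<epsilon>) \<in> L') (\<lambda>\<epsilon>. norm (\<theta> (e \<epsilon>) - \<theta> (e' \<epsilon>))))"
proof -
  let ?Q = "\<lambda>m \<theta> L'. \<exists>C>0. \<forall>\<^sub>F \<epsilon> in at_right 0. proj E (e \<epsilon>) \<in> L' \<and> proj E (e' \<epsilon>) \<in> L' \<longrightarrow>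
    norm (\<theta> (e \<epsilon>) - \<theta> (e' \<epsilon>)) \<le> C * \<epsilon> ^ m"
  have "(\<forall>m::nat. \<forall>(W, \<psi>, \<theta>)\<in>vb_charts E. \<forall>L'. compact_in (points (base E)) L' W \<longrightarrow> ?Q m \<theta> L')
    \<longleftrightarrow> (\<forall>W \<psi> \<theta> L'. (W, \<psi>, \<theta>) \<in> vb_charts E \<longrightarrow> compact_in (points (base E)) L' W \<longrightarrow> (\<forall>m. ?Q m \<theta> L'))"
    by fast
  then show ?thesis
    unfolding vb_point_equiv_def negl_on_def by simp
qed

lemma vb_moderate_topspace: "e \<in> vb_moderate E h \<Longrightarrow> \<epsilon> \<in> idx \<Longrightarrow> e \<epsilon> \<in> topspace (total E)"
  unfolding vb_moderate_iff by blast

lemma vb_point_equiv_refl: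
  assumes E: "vector_bundle E" and e: "e \<in> vb_moderate E h"
  shows "(e, e) \<in> vb_point_equiv E g h"
  unfolding vb_point_equiv_iff
proof (intro conjI allI impI e)
  show "point_close (base E) g (\<lambda>\<epsilon>. proj E (e \<epsilon>)) (\<lambda>\<epsilon>. proj E (e \<epsilon>))"
    using vb_proj[OF E vb_moderate_topspace[OF e]] by (intro point_close_self vb_manifold[OF E]) auto
qed (simp add: negl_on_zero)

text \<open>Since the two nets have the same base points, the distances to a third net coincide, and
  \<open>e \<epsilon>\<close> and \<open>e' \<epsilon>\<close> are always over the same compact set
  \<open>L'\<close>. The triangle inequality for fiber components therefore works in every chart
  separately, and the nets may wander through many charts.\<close>

lemma vb_class_same_base_subset:
  assumes e: "e \<in> vb_moderate E h" "e' \<in> vb_moderate E h"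
    and p: "\<And>\<epsilon>. \<epsilon> \<in> idx \<Longrightarrow> proj E (e' \<epsilon>) = proj E (e \<epsilon>)"
    and neg: "\<And>W \<psi> \<theta> L'. (W, \<psi>, \<theta>) \<in> vb_charts E \<Longrightarrow> compact_in (points (base E)) L' W \<Longrightarrow>
        negl_on (\<lambda>\<epsilon>. proj E (e \<epsilon>) \<in> L') (\<lambda>\<epsilon>. norm (\<theta> (e \<epsilon>) - \<theta> (e' \<epsilon>)))"
  shows "vb_class E g h e' \<subseteq> vb_class E g h e"
proof
  fix f assume "f \<in> vb_class E g h e'"
  then have f: "f \<in> vb_moderate E h"
      "point_close (base E) g (\<lambda>\<epsilon>. proj E (e' \<epsilon>)) (\<lambda>\<epsilon>. proj E (f \<epsilon>))"
      "\<And>W \<psi> \<theta> L'. (W, \<psi>, \<theta>) \<in> vb_charts E \<Longrightarrow> compact_in (points (base E)) L' W \<Longrightarrow>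
        negl_on (\<lambda>\<epsilon>. proj E (e' \<epsilon>) \<in> L' \<and> proj E (f \<epsilon>) \<in> L') (\<lambda>\<epsilon>. norm (\<theta> (e' \<epsilon>) - \<theta> (f \<epsilon>)))"
    unfolding vb_class_def by (auto simp: vb_point_equiv_iff)
  have "negligible_net (\<lambda>\<epsilon>. riem_dist (base E) g (proj E (e \<epsilon>)) (proj E (f \<epsilon>)))"
    unfolding negligible_net_def net_bigo_def
  proof
    fix m
    obtain C where "C > 0" and C: "\<forall>\<^sub>F \<epsilon> in at_right 0.
        riem_dist (base E) g (proj E (e' \<epsilon>)) (proj E (f \<epsilon>)) \<le> ennreal (C * \<epsilon> ^ m)"
      using f(2) unfolding point_close_def negligible_net_def net_bigo_def by blast
    have "\<forall>\<^sub>F \<epsilon> in at_right 0.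
        riem_dist (base E) g (proj E (e \<epsilon>)) (proj E (f \<epsilon>)) \<le> ennreal (C * \<epsilon> ^ m)"
      using C eventually_idx by eventually_elim (simp add: p)
    with \<open>C > 0\<close> show "\<exists>C>0. \<forall>\<^sub>F \<epsilon> in at_right 0.
        riem_dist (base E) g (proj E (e \<epsilon>)) (proj E (f \<epsilon>)) \<le> ennreal (C * \<epsilon> ^ m)"
      by blast
  qed
  moreover have "negl_on (\<lambda>\<epsilon>. proj E (e \<epsilon>) \<in> L' \<and> proj E (f \<epsilon>) \<in> L') (\<lambda>\<epsilon>. norm (\<theta> (e \<epsilon>) - \<theta> (f \<epsilon>)))"
    if c: "(W, \<psi>, \<theta>) \<in> vb_charts E" and L: "compact_in (points (base E)) L' W" for W \<psi> \<theta> L'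
  proof -
    have a: "negl_on (\<lambda>\<epsilon>. proj E (e \<epsilon>) \<in> L' \<and> proj E (f \<epsilon>) \<in> L') (\<lambda>\<epsilon>. norm (\<theta> (e \<epsilon>) - \<theta> (e' \<epsilon>)))"
      using neg[OF c L] by (rule negl_on_mono) simp
    have "\<forall>\<^sub>F \<epsilon> in at_right 0. proj E (e \<epsilon>) \<in> L' \<and> proj E (f \<epsilon>) \<in> L' \<longrightarrow>
        (proj E (e' \<epsilon>) \<in> L' \<and> proj E (f \<epsilon>) \<in> L') \<and> norm (\<theta> (e' \<epsilon>) - \<theta> (f \<epsilon>)) \<le> norm (\<theta> (e' \<epsilon>) - \<theta> (f \<epsilon>))"
      using eventually_idx by eventually_elim (simp add: p)
    from negl_on_add[OF a negl_on_mono[OF f(3)[OF c L] this]] show ?thesis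
      by (rule negl_on_mono) (auto intro!: always_eventually norm_diff_triangle)
  qed
  ultimately show "f \<in> vb_class E g h e"
    using f(1) e(1) unfolding vb_class_def point_close_def by (simp add: vb_point_equiv_iff point_close_def)
qed

lemma vb_class_same_base:
  assumes e: "e \<in> vb_moderate E h" "e' \<in> vb_moderate E h"
    and p: "\<And>\<epsilon>. \<epsilon> \<in> idx \<Longrightarrow> proj E (e' \<epsilon>) = proj E (e \<epsilon>)"
    and neg: "\<And>W \<psi> \<theta> L'. (W, \<psi>, \<theta>) \<in> vb_charts E \<Longrightarrow> compact_in (points (base E)) L' W \<Longrightarrow>
        negl_on (\<lambda>\<epsilon>. proj E (e \<epsilon>) \<in> L') (\<lambda>\<epsilon>. norm (\<theta> (e \<epsilon>) - \<theta> (e' \<epsilon>)))"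
  shows "vb_class E g h e = vb_class E g h e'"
proof
  show "vb_class E g h e' \<subseteq> vb_class E g h e"
    by (rule vb_class_same_base_subset[OF e p neg])
  show "vb_class E g h e \<subseteq> vb_class E g h e'"
  proof (rule vb_class_same_base_subset[OF e(2,1)])
    fix W \<psi> \<theta> L' assume "(W, \<psi>, \<theta>) \<in> vb_charts E" "compact_in (points (base E)) L' W"
    from neg[OF this] show
      "negl_on (\<lambda>\<epsilon>. proj E (e' \<epsilon>) \<in> L') (\<lambda>\<epsilon>. norm (\<theta> (e' \<epsilon>) - \<theta> (e \<epsilon>)))"
    proof (rule negl_on_mono)
      show "\<forall>\<^sub>F \<epsilon> in at_right 0. proj E (e' \<epsilon>) \<in> L' \<longrightarrow>
          proj E (e \<epsilon>) \<in> L' \<and> norm (\<theta> (e' \<epsilon>) - \<theta> (e \<epsilon>)) \<le> norm (\<theta> (e \<epsilon>) - \<theta> (e' \<epsilon>))"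
        using eventually_idx by eventually_elim (simp add: p norm_minus_commute)
    qed
  qed (simp add: p)
qed

text \<open>Smoothness gives a Lipschitz constant on compact sets only, whereas the fiber components
  of moderate nets may be unbounded. Linearity in the fiber reduces both kinds of change to vectors
  in the unit ball; the price is the factor \<open>norm (\<eta> z')\<close> in front of the distance
  of base points.\<close>

lemma vb_transition_lipschitz:
  fixes E :: "('x, 'a::fin_dim_normed, 'p, 'e::fin_dim_normed, 'k::real_or_complex) vbundle"
  assumes E: "vector_bundle E" and c: "(V, \<phi>, \<eta>) \<in> vb_charts E" and d: "(W, \<psi>, \<theta>) \<in> vb_charts E"
    and M: "compact_in (points (base E)) M (V \<inter> W)"
  obtains C where "0 < C"
    "\<And>z z'. z \<in> topspace (total E) \<Longrightarrow> z' \<in> topspace (total E) \<Longrightarrow> proj E z \<in> M \<Longrightarrow> proj E z' \<in> M \<Longrightarrow>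
      norm (\<theta> z - \<theta> z') \<le> C * (norm (\<eta> z - \<eta> z') + norm (\<eta> z') * dist (\<phi> (proj E z)) (\<phi> (proj E z')))"
proof -
  let ?T = "\<lambda>y. \<theta> (vb_point E (V, \<phi>, \<eta>) (fst y) (snd y))"
  have MV: "compact_in (points (base E)) M V" "M \<subseteq> V" "M \<subseteq> W"
    using M unfolding compact_in_def by auto
  have comp: "compact (\<phi> ` M \<times> cball (0::'e) 1)"
    using compact_in_chart_image(1)[OF vb_chart_is_chart[OF E c] MV(1)] by (intro compact_Times) auto
  have sub: "\<phi> ` M \<times> cball 0 1 \<subseteq> \<phi> ` (V \<inter> W) \<times> (UNIV :: 'e set)"
    using MV by auto
  from smooth_on_lipschitz_compact[OF vb_transition_smooth(2,1)[OF E c d] comp sub]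
  obtain C where C: "C > 0"
    "\<And>x y. x \<in> \<phi> ` M \<times> cball 0 1 \<Longrightarrow> y \<in> \<phi> ` M \<times> cball 0 1 \<Longrightarrow> norm (?T x - ?T y) \<le> C * norm (x - y)"
    by blast
  have lin: "linear (\<lambda>\<xi>. ?T (\<phi> p, \<xi>))" if "p \<in> M" for p
    using vb_transition_linear[OF E c d] that MV by auto
  have sgn_in: "(\<phi> p, sgn \<xi>) \<in> \<phi> ` M \<times> cball 0 1" "(\<phi> p, 0) \<in> \<phi> ` M \<times> cball 0 1" if "p \<in> M" for p and \<xi> :: 'e
    using that by (auto simp: norm_sgn)
  have scale: "?T (\<phi> p, \<xi>) = norm \<xi> *\<^sub>R ?T (\<phi> p, sgn \<xi>)" if "p \<in> M" for p \<xi>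
    using linear_scale[OF lin[OF that], of "norm \<xi>" "sgn \<xi>"]
    by (cases "\<xi> = 0") (simp_all add: sgn_div_norm linear_0[OF lin[OF that], simplified])
  have bd: "norm (?T (\<phi> p, \<xi>)) \<le> C * norm \<xi>" if p: "p \<in> M" for p \<xi>
  proof -
    have "norm (?T (\<phi> p, sgn \<xi>) - ?T (\<phi> p, 0)) \<le> C * norm ((\<phi> p, sgn \<xi>) - (\<phi> p, 0))"
      by (rule C(2)[OF sgn_in[OF p]])
    also have "\<dots> \<le> C * 1"
      using C(1) by (intro mult_left_mono) (auto simp: norm_sgn norm_Pair)
    finally have "norm (?T (\<phi> p, sgn \<xi>)) \<le> C"
      using linear_0[OF lin[OF p]] by simp
    then have "norm \<xi> * norm (?T (\<phi> p, sgn \<xi>)) \<le> norm \<xi> * C"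
      by (intro mult_left_mono) auto
    then show ?thesis
      unfolding scale[OF p, of \<xi>] by (simp add: mult.commute)
  qed
  have lip: "norm (?T (\<phi> p, \<xi>) - ?T (\<phi> q, \<xi>)) \<le> C * (norm \<xi> * dist (\<phi> p) (\<phi> q))"
    if p: "p \<in> M" and q: "q \<in> M" for p q \<xi>
  proof -
    have "norm (?T (\<phi> p, sgn \<xi>) - ?T (\<phi> q, sgn \<xi>)) \<le> C * norm ((\<phi> p, sgn \<xi>) - (\<phi> q, sgn \<xi>))"
      by (rule C(2)[OF sgn_in(1)[OF p] sgn_in(1)[OF q]])
    then have "norm (?T (\<phi> p, sgn \<xi>) - ?T (\<phi> q, sgn \<xi>)) \<le> C * dist (\<phi> p) (\<phi> q)"
      by (simp add: norm_Pair dist_norm)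
    then have "norm \<xi> * norm (?T (\<phi> p, sgn \<xi>) - ?T (\<phi> q, sgn \<xi>)) \<le> norm \<xi> * (C * dist (\<phi> p) (\<phi> q))"
      by (intro mult_left_mono) auto
    moreover have "norm (?T (\<phi> p, \<xi>) - ?T (\<phi> q, \<xi>)) = norm \<xi> * norm (?T (\<phi> p, sgn \<xi>) - ?T (\<phi> q, sgn \<xi>))"
      unfolding scale[OF p, of \<xi>] scale[OF q, of \<xi>] scaleR_diff_right[symmetric] by simp
    ultimately show ?thesis
      by (simp add: mult_ac)
  qed
  show ?thesis
  proof (rule that[OF C(1)])
    fix z z' assume z: "z \<in> topspace (total E)" "z' \<in> topspace (total E)" "proj E z \<in> M" "proj E z' \<in> M"
    have T: "\<theta> z = ?T (\<phi> (proj E z), \<eta> z)" "\<theta> z' = ?T (\<phi> (proj E z'), \<eta> z')"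
      using vb_point_coords[OF E c] z MV(2) by (auto simp: subset_iff)
    \<comment> \<open>The vector is changed first, over the base point of \<open>z\<close>; then the
      base point moves with the vector \<open>\<eta> z'\<close> held fixed.\<close>
    have "\<theta> z - \<theta> z' = ?T (\<phi> (proj E z), \<eta> z - \<eta> z')
        + (?T (\<phi> (proj E z), \<eta> z') - ?T (\<phi> (proj E z'), \<eta> z'))"
      unfolding T linear_diff[OF lin[OF z(3)]] by simp
    also have "norm \<dots> \<le> C * norm (\<eta> z - \<eta> z')
        + C * (norm (\<eta> z') * dist (\<phi> (proj E z)) (\<phi> (proj E z')))"
      using bd[OF z(3)] lip[OF z(3,4)] by (rule norm_triangle_mono)
    finally show "norm (\<theta> z - \<theta> z') \<le> C * (norm (\<eta> z - \<eta> z') + norm (\<eta> z') * dist (\<phi> (proj E z)) (\<phi> (proj E z')))"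
      by (simp add: distrib_left)
  qed
qed

lemma vb_moderate_fiber_component:
  assumes E: "vector_bundle E" and h: "fiber_metric E h" and c: "(V, \<phi>, \<eta>) \<in> vb_charts E"
    and L: "compact_in (points (base E)) L V" and e: "e \<in> vb_moderate E h"
  shows "mod_on (\<lambda>\<epsilon>. proj E (e \<epsilon>) \<in> L) (\<lambda>\<epsilon>. norm (\<eta> (e \<epsilon>)))"
proof -
  obtain C where C: "0 < C" "\<And>z. z \<in> topspace (total E) \<Longrightarrow> proj E z \<in> L \<Longrightarrow> norm (\<eta> z) \<le> C * fiber_norm h z"
    by (rule fiber_norm_bounds[OF E h c L]) (rule that)
  \<comment> \<open>The product rule wants a factor that is nonnegative for all \<epsilon>, while
    \<open>e \<epsilon>\<close> is a point of the bundle only for \<epsilon> in \<open>idx\<close>;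
    hence the absolute value.\<close>
  have "mod_on (\<lambda>_. True) (\<lambda>\<epsilon>. C * \<bar>fiber_norm h (e \<epsilon>)\<bar>)"
  proof (rule mod_on_mult[OF mod_on_const])
    have "mod_on (\<lambda>_. True) (\<lambda>\<epsilon>. fiber_norm h (e \<epsilon>))"
      using e unfolding vb_moderate_iff by blast
    then show "mod_on (\<lambda>_. True) (\<lambda>\<epsilon>. \<bar>fiber_norm h (e \<epsilon>)\<bar>)"
    proof (rule mod_on_mono)
      show "\<forall>\<^sub>F \<epsilon> in at_right 0. True \<longrightarrow> True \<and> \<bar>fiber_norm h (e \<epsilon>)\<bar> \<le> fiber_norm h (e \<epsilon>)"
        using eventually_idx
        by eventually_elim (use fiber_norm_nonneg[OF E h vb_moderate_topspace[OF e]] in simp)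
    qed
  qed simp
  then show ?thesis
  proof (rule mod_on_mono)
    show "\<forall>\<^sub>F \<epsilon> in at_right 0. proj E (e \<epsilon>) \<in> L \<longrightarrow>
        True \<and> norm (\<eta> (e \<epsilon>)) \<le> C * \<bar>fiber_norm h (e \<epsilon>)\<bar>"
      using eventually_idx
    proof eventually_elim
      case (elim \<epsilon>)
      show ?case
        using C(2)[OF vb_moderate_topspace[OF e elim]]
          fiber_norm_nonneg[OF E h vb_moderate_topspace[OF e elim]] by simp
    qed
  qed
qed

text \<open>Negligible differences in one chart remain negligible in all others: the change of chart
  multiplies the negligible base distance by the norm of a fiber component, which is
  moderate.\<close>

lemma vb_point_equivI_chart:
  assumes E: "vector_bundle E" and g: "riemannian_metric (base E) g" and h: "fiber_metric E h"
    and c: "(V, \<phi>, \<eta>) \<in> vb_charts E" and L: "compact_in (points (base E)) L V"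
    and z: "z \<in> vb_moderate E h" "z' \<in> vb_moderate E h"
    and inL: "\<forall>\<^sub>F \<epsilon> in at_right 0. proj E (z \<epsilon>) \<in> L \<and> proj E (z' \<epsilon>) \<in> L"
    and base: "negl_on (\<lambda>_. True) (\<lambda>\<epsilon>. dist (\<phi> (proj E (z \<epsilon>))) (\<phi> (proj E (z' \<epsilon>))))"
    and fib: "negl_on (\<lambda>_. True) (\<lambda>\<epsilon>. norm (\<eta> (z \<epsilon>) - \<eta> (z' \<epsilon>)))"
  shows "(z, z') \<in> vb_point_equiv E g h"
  unfolding vb_point_equiv_iff
proof (intro conjI allI impI z)
  note X = vb_manifold[OF E]
  have LV: "L \<subseteq> V" "compactin (points (base E)) L"
    using L unfolding compact_in_def by auto
  obtain \<delta> C where C: "0 < \<delta>" "0 < C" "\<And>p q. p \<in> L \<Longrightarrow> q \<in> V \<Longrightarrow> dist (\<phi> p) (\<phi> q) < \<delta> \<Longrightarrow>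
      riem_dist (base E) g p q \<le> ennreal (C * dist (\<phi> p) (\<phi> q))"
    by (rule riem_dist_upper[OF X g vb_chart_base[OF E c] L]) (rule that)
  show "point_close (base E) g (\<lambda>\<epsilon>. proj E (z \<epsilon>)) (\<lambda>\<epsilon>. proj E (z' \<epsilon>))"
    unfolding point_close_def
  proof (rule negligible_netI[OF negl_on_cmult[OF base, of C]])
    show "\<forall>\<^sub>F \<epsilon> in at_right 0. riem_dist (base E) g (proj E (z \<epsilon>)) (proj E (z' \<epsilon>))
        \<le> ennreal (C * dist (\<phi> (proj E (z \<epsilon>))) (\<phi> (proj E (z' \<epsilon>))))"
      using inL negl_on_small[OF base C(1)] by eventually_elim (use C(3) LV(1) in blast)
  qed simp
  fix W \<psi> \<theta> L' assume d: "(W, \<psi>, \<theta>) \<in> vb_charts E" and L': "compact_in (points (base E)) L' W"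
  \<comment> \<open>For small \<epsilon> both base points are in \<open>L\<close>, so a test set
    \<open>L'\<close> of another chart matters only through the intersection, which is compact
    because \<open>L'\<close> is closed in a Hausdorff space.\<close>
  have "compact_in (points (base E)) (L \<inter> L') (V \<inter> W)"
    using LV L' X unfolding compact_in_def smooth_manifold_def
    by (auto intro!: compact_Int_closedin compactin_imp_closedin)
  then obtain D where D: "0 < D"
    "\<And>z z'. z \<in> topspace (total E) \<Longrightarrow> z' \<in> topspace (total E) \<Longrightarrow> proj E z \<in> L \<inter> L' \<Longrightarrow> proj E z' \<in> L \<inter> L' \<Longrightarrow>
      norm (\<theta> z - \<theta> z') \<le> D * (norm (\<eta> z - \<eta> z') + norm (\<eta> z') * dist (\<phi> (proj E z)) (\<phi> (proj E z')))"
    by (rule vb_transition_lipschitz[OF E c d]) (rule that)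
  have "mod_on (\<lambda>_. True) (\<lambda>\<epsilon>. norm (\<eta> (z' \<epsilon>)))"
    by (rule mod_on_mono[OF vb_moderate_fiber_component[OF E h c L z(2)]])
      (use inL in eventually_elim, simp)
  then have "negl_on (\<lambda>_. True) (\<lambda>\<epsilon>. D * (norm (\<eta> (z \<epsilon>) - \<eta> (z' \<epsilon>))
      + norm (\<eta> (z' \<epsilon>)) * dist (\<phi> (proj E (z \<epsilon>))) (\<phi> (proj E (z' \<epsilon>)))))"
    by (intro negl_on_cmult negl_on_add fib negl_on_mod_mult base) auto
  then show "negl_on (\<lambda>\<epsilon>. proj E (z \<epsilon>) \<in> L' \<and> proj E (z' \<epsilon>) \<in> L') (\<lambda>\<epsilon>. norm (\<theta> (z \<epsilon>) - \<theta> (z' \<epsilon>)))"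
  proof (rule negl_on_mono)
    show "\<forall>\<^sub>F \<epsilon> in at_right 0. proj E (z \<epsilon>) \<in> L' \<and> proj E (z' \<epsilon>) \<in> L' \<longrightarrow> True \<and>
        norm (\<theta> (z \<epsilon>) - \<theta> (z' \<epsilon>)) \<le> D * (norm (\<eta> (z \<epsilon>) - \<eta> (z' \<epsilon>))
          + norm (\<eta> (z' \<epsilon>)) * dist (\<phi> (proj E (z \<epsilon>))) (\<phi> (proj E (z' \<epsilon>))))"
      using inL eventually_idx
    proof eventually_elim
      case (elim \<epsilon>)
      then show ?case
        using D(2)[OF vb_moderate_topspace[OF z(1)] vb_moderate_topspace[OF z(2)]] by blast
    qed
  qed
qed

text \<open>Only the first net is assumed to stay in \<open>L\<close>. Closeness carries the second
  one into a larger compact \<open>L'\<close>, and the fiber condition is then read off for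
  \<open>L'\<close>, which contains both.\<close>

lemma vb_point_equivD_chart:
  assumes E: "vector_bundle E" and g: "riemannian_metric (base E) g"
    and c: "(V, \<phi>, \<eta>) \<in> vb_charts E" and L: "compact_in (points (base E)) L V"
    and zz': "(z, z') \<in> vb_point_equiv E g h" and inL: "\<forall>\<^sub>F \<epsilon> in at_right 0. proj E (z \<epsilon>) \<in> L"
  obtains L' where "L \<subseteq> L'" "compact_in (points (base E)) L' V"
    "\<forall>\<^sub>F \<epsilon> in at_right 0. proj E (z' \<epsilon>) \<in> L'"
    "negl_on (\<lambda>_. True) (\<lambda>\<epsilon>. dist (\<phi> (proj E (z \<epsilon>))) (\<phi> (proj E (z' \<epsilon>))))"
    "negl_on (\<lambda>_. True) (\<lambda>\<epsilon>. norm (\<eta> (z \<epsilon>) - \<eta> (z' \<epsilon>)))"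
proof -
  have close: "point_close (base E) g (\<lambda>\<epsilon>. proj E (z \<epsilon>)) (\<lambda>\<epsilon>. proj E (z' \<epsilon>))"
    using zz' unfolding vb_point_equiv_iff by blast
  obtain L' r where L': "compact_in (points (base E)) L' V" "L \<subseteq> L'"
    "\<forall>\<^sub>F \<epsilon> in at_right 0. proj E (z \<epsilon>) \<in> L \<longrightarrow> proj E (z' \<epsilon>) \<in> L' \<and> dist (\<phi> (proj E (z \<epsilon>))) (\<phi> (proj E (z' \<epsilon>))) \<le> r"
    "negl_on (\<lambda>\<epsilon>. proj E (z \<epsilon>) \<in> L) (\<lambda>\<epsilon>. dist (\<phi> (proj E (z \<epsilon>))) (\<phi> (proj E (z' \<epsilon>))))"
    by (rule point_close_chart[OF vb_manifold[OF E] g close vb_chart_base[OF E c] L]) (rule that)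
  have inL': "\<forall>\<^sub>F \<epsilon> in at_right 0. proj E (z' \<epsilon>) \<in> L'"
    using L'(3) inL by eventually_elim simp
  show ?thesis
  proof (rule that[OF L'(2,1) inL'])
    show "negl_on (\<lambda>_. True) (\<lambda>\<epsilon>. dist (\<phi> (proj E (z \<epsilon>))) (\<phi> (proj E (z' \<epsilon>))))"
      by (rule negl_on_mono[OF L'(4)]) (use inL in eventually_elim, simp)
    have "negl_on (\<lambda>\<epsilon>. proj E (z \<epsilon>) \<in> L' \<and> proj E (z' \<epsilon>) \<in> L') (\<lambda>\<epsilon>. norm (\<eta> (z \<epsilon>) - \<eta> (z' \<epsilon>)))"
      using zz' c L'(1) unfolding vb_point_equiv_iff by blast
    then show "negl_on (\<lambda>_. True) (\<lambda>\<epsilon>. norm (\<eta> (z \<epsilon>) - \<eta> (z' \<epsilon>)))"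
    proof (rule negl_on_mono)
      show "\<forall>\<^sub>F \<epsilon> in at_right 0. True \<longrightarrow> (proj E (z \<epsilon>) \<in> L' \<and> proj E (z' \<epsilon>) \<in> L') \<and>
          norm (\<eta> (z \<epsilon>) - \<eta> (z' \<epsilon>)) \<le> norm (\<eta> (z \<epsilon>) - \<eta> (z' \<epsilon>))"
        using inL inL' by eventually_elim (use L'(2) in auto)
    qed
  qed
qed

text \<open>Transitivity of the equivalence is only needed, and only proved, for nets that stay in a
  compact subset of a single chart.\<close>

lemma vb_class_chart_subset:
  assumes E: "vector_bundle E" and g: "riemannian_metric (base E) g" and h: "fiber_metric E h"
    and c: "(V, \<phi>, \<eta>) \<in> vb_charts E" and L: "compact_in (points (base E)) L V"
    and z: "z \<in> vb_moderate E h" "z' \<in> vb_moderate E h"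
    and inL: "\<forall>\<^sub>F \<epsilon> in at_right 0. proj E (z \<epsilon>) \<in> L \<and> proj E (z' \<epsilon>) \<in> L"
    and base: "negl_on (\<lambda>_. True) (\<lambda>\<epsilon>. dist (\<phi> (proj E (z \<epsilon>))) (\<phi> (proj E (z' \<epsilon>))))"
    and fib: "negl_on (\<lambda>_. True) (\<lambda>\<epsilon>. norm (\<eta> (z \<epsilon>) - \<eta> (z' \<epsilon>)))"
  shows "vb_class E g h z' \<subseteq> vb_class E g h z"
proof
  fix w assume "w \<in> vb_class E g h z'"
  then have w: "(z', w) \<in> vb_point_equiv E g h" "w \<in> vb_moderate E h"
    unfolding vb_class_def by (auto simp: vb_point_equiv_iff)
  have "\<forall>\<^sub>F \<epsilon> in at_right 0. proj E (z' \<epsilon>) \<in> L"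
    using inL by eventually_elim simp
  \<comment> \<open>The third net need not stay in \<open>L\<close>, but it stays in the same chart,
    so the triangle inequality for coordinates replaces a change of charts.\<close>
  then obtain L' where L': "L \<subseteq> L'" "compact_in (points (base E)) L' V"
    "\<forall>\<^sub>F \<epsilon> in at_right 0. proj E (w \<epsilon>) \<in> L'"
    "negl_on (\<lambda>_. True) (\<lambda>\<epsilon>. dist (\<phi> (proj E (z' \<epsilon>))) (\<phi> (proj E (w \<epsilon>))))"
    "negl_on (\<lambda>_. True) (\<lambda>\<epsilon>. norm (\<eta> (z' \<epsilon>) - \<eta> (w \<epsilon>)))"
    by (rule vb_point_equivD_chart[OF E g c L w(1)])
  have "(z, w) \<in> vb_point_equiv E g h"
  proof (rule vb_point_equivI_chart[OF E g h c L'(2) z(1) w(2)])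
    show "\<forall>\<^sub>F \<epsilon> in at_right 0. proj E (z \<epsilon>) \<in> L' \<and> proj E (w \<epsilon>) \<in> L'"
      using inL L'(3) by eventually_elim (use L'(1) in auto)
    show "negl_on (\<lambda>_. True) (\<lambda>\<epsilon>. dist (\<phi> (proj E (z \<epsilon>))) (\<phi> (proj E (w \<epsilon>))))"
      by (rule negl_on_mono[OF negl_on_add[OF base L'(4)]]) (simp add: dist_triangle)
    show "negl_on (\<lambda>_. True) (\<lambda>\<epsilon>. norm (\<eta> (z \<epsilon>) - \<eta> (w \<epsilon>)))"
      by (rule negl_on_mono[OF negl_on_add[OF fib L'(5)]]) (auto intro!: always_eventually norm_diff_triangle)
  qed
  then show "w \<in> vb_class E g h z"
    unfolding vb_class_def by simp
qed

lemma vb_class_chart_eq: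
  assumes E: "vector_bundle E" and g: "riemannian_metric (base E) g" and h: "fiber_metric E h"
    and c: "(V, \<phi>, \<eta>) \<in> vb_charts E" and L: "compact_in (points (base E)) L V"
    and z: "z \<in> vb_moderate E h" "z' \<in> vb_moderate E h"
    and inL: "\<forall>\<^sub>F \<epsilon> in at_right 0. proj E (z \<epsilon>) \<in> L \<and> proj E (z' \<epsilon>) \<in> L"
    and base: "negl_on (\<lambda>_. True) (\<lambda>\<epsilon>. dist (\<phi> (proj E (z \<epsilon>))) (\<phi> (proj E (z' \<epsilon>))))"
    and fib: "negl_on (\<lambda>_. True) (\<lambda>\<epsilon>. norm (\<eta> (z \<epsilon>) - \<eta> (z' \<epsilon>)))"
  shows "vb_class E g h z = vb_class E g h z'"
proof
  show "vb_class E g h z' \<subseteq> vb_class E g h z"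
    by (rule vb_class_chart_subset[OF assms])
  show "vb_class E g h z \<subseteq> vb_class E g h z'"
    by (rule vb_class_chart_subset[OF E g h c L z(2,1)])
      (use inL base fib in \<open>simp_all add: dist_commute norm_minus_commute conj_commute\<close>)
qed

section \<open>Moderate homomorphisms\<close>

lemma smooth_map_topspace: "smooth_map X A Y B f \<Longrightarrow> x \<in> topspace X \<Longrightarrow> f x \<in> topspace Y"
  unfolding smooth_map_def continuous_map_def by auto

lemma vb_homs_topspace:
  assumes "f \<in> vb_homs E F" and "z \<in> topspace (total E)"
  shows "f z \<in> topspace (total F)" "proj F (f z) = base_map E F f (proj E z)"
proof -
  have f: "smooth_map (total E) (total_charts E) (total F) (total_charts F) f"
      "\<forall>z\<in>topspace (total E). proj F (f z) = base_map E F f (proj E z)"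
    using assms(1) unfolding vb_homs_def by simp_all
  show "f z \<in> topspace (total F)"
    by (rule smooth_map_topspace[OF f(1) assms(2)])
  show "proj F (f z) = base_map E F f (proj E z)"
    using f(2) assms(2) by blast
qed

lemma hom_rep_coords:
  assumes "vector_bundle E" and "(V, \<phi>, \<eta>) \<in> vb_charts E"
    and "z \<in> topspace (total E)" and "proj E z \<in> V"
  shows "\<theta> (f z) = hom_rep E F (V, \<phi>, \<eta>) (W, \<psi>, \<theta>) f (\<phi> (proj E z)) (\<eta> z)"
  unfolding hom_rep_def by (simp add: vb_point_coords[OF assms])

lemma hom_rep_linear:
  assumes E: "vector_bundle E" and F: "vector_bundle F" and f: "f \<in> vb_homs E F"
    and c: "(V, \<phi>, \<eta>) \<in> vb_charts E" and d: "(W, \<psi>, \<theta>) \<in> vb_charts F"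
    and p: "p \<in> V" "base_map E F f p \<in> W"
  shows "linear (hom_rep E F (V, \<phi>, \<eta>) (W, \<psi>, \<theta>) f (\<phi> p))"
proof (rule scalar_linear_imp_linear[OF vb_scalar_mult[OF E] vb_scalar_mult[OF F]])
  have "\<forall>(V, \<phi>, \<eta>)\<in>vb_charts E. \<forall>(W, \<psi>, \<theta>)\<in>vb_charts F. \<forall>p\<in>V. base_map E F f p \<in> W \<longrightarrow>
      Vector_Spaces.linear (smul E) (smul F) (hom_rep E F (V, \<phi>, \<eta>) (W, \<psi>, \<theta>) f (\<phi> p))"
    using f unfolding vb_homs_def by simp
  from bspec[OF bspec[OF this c, unfolded prod.case] d, unfolded prod.case] p
  show "Vector_Spaces.linear (smul E) (smul F) (hom_rep E F (V, \<phi>, \<eta>) (W, \<psi>, \<theta>) f (\<phi> p))"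
    by blast
qed

text \<open>Smoothness is given on the total space, jointly in base point and vector. Composing with
  the slice that fixes the vector and taking the fiber component gives differentiability in the base
  coordinate alone.\<close>

lemma hom_rep_differentiable:
  assumes E: "vector_bundle E" and f: "f \<in> vb_homs E F"
    and c: "(V, \<phi>, \<eta>) \<in> vb_charts E" and d: "(W, \<psi>, \<theta>) \<in> vb_charts F"
    and p: "p \<in> V" "base_map E F f p \<in> W"
  shows "(\<lambda>x. hom_rep E F (V, \<phi>, \<eta>) (W, \<psi>, \<theta>) f x \<xi>) differentiable (at (\<phi> p))"
proof -
  let ?\<Phi> = "\<lambda>z. (\<phi> (proj E z), \<eta> z)" and ?\<Psi> = "\<lambda>z. (\<psi> (proj F z), \<theta> z)"
  let ?z = "vb_point E (V, \<phi>, \<eta>) (\<phi> p) \<xi>" and ?G = "?\<Psi> \<circ> f \<circ> inv_into (over E V) ?\<Phi>"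
  note z = vb_point_props[OF E c p(1), of \<xi>]
  have "smooth_map (total E) (total_charts E) (total F) (total_charts F) f"
    using f unfolding vb_homs_def by simp
  moreover have "(over E V, ?\<Phi>) \<in> total_charts E" "(over F W, ?\<Psi>) \<in> total_charts F"
    using c d by (auto simp: total_chart_def intro!: rev_image_eqI)
  ultimately have "smooth_on (?\<Phi> ` (over E V \<inter> f -` over F W)) ?G"
    unfolding smooth_map_def by fast
  moreover have "?z \<in> over E V \<inter> f -` over F W"
    using z p vb_homs_topspace[OF f z(1)] by (simp add: over_def)
  then have "(\<phi> p, \<xi>) \<in> ?\<Phi> ` (over E V \<inter> f -` over F W)"
    using z by (intro rev_image_eqI) auto
  ultimately have "?G differentiable (at (\<phi> p, \<xi>))"
    by (rule smooth_on_differentiable)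
  then have "(?G \<circ> (\<lambda>x. (x, \<xi>))) differentiable (at (\<phi> p))"
    by (intro differentiable_chain_at) (auto intro!: derivative_intros simp: differentiable_def)
  then obtain D where "((?G \<circ> (\<lambda>x. (x, \<xi>))) has_derivative D) (at (\<phi> p))"
    unfolding differentiable_def by blast
  from has_derivative_snd[OF this] show ?thesis
    unfolding differentiable_def hom_rep_def vb_point_eq by (auto simp: o_def)
qed

section \<open>Estimates for moderate nets in charts\<close>

lemma moderate_homs_hom: "v \<in> moderate_homs E F \<Longrightarrow> \<epsilon> \<in> idx \<Longrightarrow> v \<epsilon> \<in> vb_homs E F"
  unfolding moderate_homs_def by blast

lemma moderate_homs_base:
  "v \<in> moderate_homs E F \<Longrightarrow> (\<lambda>\<epsilon>. base_map E F (v \<epsilon>)) \<in> moderate_maps (base E) (base F)"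
  unfolding moderate_homs_def by blast

lemma moderate_homs_bound:
  fixes E :: "('x, 'a::fin_dim_normed, 'p, 'e::fin_dim_normed, 'k::real_or_complex) vbundle"
    and F :: "('y, 'b::fin_dim_normed, 'q, 'f::fin_dim_normed, 'k) vbundle"
  assumes v: "v \<in> moderate_homs E F"
    and c: "(V, \<phi>, \<eta>) \<in> vb_charts E" and d: "(W, \<psi>, \<theta>) \<in> vb_charts F"
    and L: "compact_in (points (base E)) L V" and L': "compact_in (points (base F)) L' W"
  obtains M where "mod_on (\<lambda>_. True) M" "\<And>\<epsilon>. 0 \<le> M \<epsilon>"
    "\<forall>\<^sub>F \<epsilon> in at_right 0. \<forall>p\<in>L. base_map E F (v \<epsilon>) p \<in> L' \<longrightarrow> (\<forall>\<xi>. norm \<xi> \<le> 1 \<longrightarrow>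
       deriv_norm k (\<lambda>x. hom_rep E F (V, \<phi>, \<eta>) (W, \<psi>, \<theta>) (v \<epsilon>) x \<xi>) (\<phi> p) \<le> ennreal (M \<epsilon>))"
proof -
  let ?R = "\<lambda>\<epsilon>. hom_rep E F (V, \<phi>, \<eta>) (W, \<psi>, \<theta>) (v \<epsilon>)"
  have "moderate (\<lambda>\<epsilon>. SUP p \<in> L \<inter> base_map E F (v \<epsilon>) -` L'. hom_deriv_norm k (?R \<epsilon>) (\<phi> p))"
    using v c d L L' unfolding moderate_homs_def by fast
  then obtain M where M: "mod_on (\<lambda>_. True) M" "\<And>\<epsilon>. 0 \<le> M \<epsilon>"
    "\<forall>\<^sub>F \<epsilon> in at_right 0. (SUP p \<in> L \<inter> base_map E F (v \<epsilon>) -` L'. hom_deriv_norm k (?R \<epsilon>) (\<phi> p)) \<le> ennreal (M \<epsilon>)"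
    by (rule moderate_bound) (rule that)
  show ?thesis
  proof (rule that[OF M(1,2)])
    show "\<forall>\<^sub>F \<epsilon> in at_right 0. \<forall>p\<in>L. base_map E F (v \<epsilon>) p \<in> L' \<longrightarrow> (\<forall>\<xi>. norm \<xi> \<le> 1 \<longrightarrow>
       deriv_norm k (\<lambda>x. ?R \<epsilon> x \<xi>) (\<phi> p) \<le> ennreal (M \<epsilon>))"
      using M(3)
    proof (eventually_elim, intro ballI allI impI)
      fix \<epsilon> p and \<xi> :: 'e
      assume le: "(SUP p \<in> L \<inter> base_map E F (v \<epsilon>) -` L'. hom_deriv_norm k (?R \<epsilon>) (\<phi> p)) \<le> ennreal (M \<epsilon>)"
        and p: "p \<in> L" "base_map E F (v \<epsilon>) p \<in> L'" and \<xi>: "norm \<xi> \<le> 1"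
      have "deriv_norm k (\<lambda>x. ?R \<epsilon> x \<xi>) (\<phi> p) \<le> hom_deriv_norm k (?R \<epsilon>) (\<phi> p)"
        unfolding hom_deriv_norm_def using \<xi> by (intro SUP_upper) simp
      also have "\<dots> \<le> (SUP p \<in> L \<inter> base_map E F (v \<epsilon>) -` L'. hom_deriv_norm k (?R \<epsilon>) (\<phi> p))"
        using p by (intro SUP_upper) simp
      finally show "deriv_norm k (\<lambda>x. ?R \<epsilon> x \<xi>) (\<phi> p) \<le> ennreal (M \<epsilon>)"
        using le by (rule order_trans)
    qed
  qed
qed

lemma moderate_homs_fiber_bound:
  assumes E: "vector_bundle E" and F: "vector_bundle F" and v: "v \<in> moderate_homs E F"
    and c: "(V, \<phi>, \<eta>) \<in> vb_charts E" and d: "(W, \<psi>, \<theta>) \<in> vb_charts F"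
    and L: "compact_in (points (base E)) L V" and L': "compact_in (points (base F)) L' W"
  obtains M where "mod_on (\<lambda>_. True) M" "\<And>\<epsilon>. 0 \<le> M \<epsilon>"
    "\<forall>\<^sub>F \<epsilon> in at_right 0. \<forall>p\<in>L. base_map E F (v \<epsilon>) p \<in> L' \<longrightarrow>
       (\<forall>\<xi>. norm (hom_rep E F (V, \<phi>, \<eta>) (W, \<psi>, \<theta>) (v \<epsilon>) (\<phi> p) \<xi>) \<le> M \<epsilon> * norm \<xi>)"
proof -
  obtain M where M: "mod_on (\<lambda>_. True) M" "\<And>\<epsilon>. 0 \<le> M \<epsilon>"
    "\<forall>\<^sub>F \<epsilon> in at_right 0. \<forall>p\<in>L. base_map E F (v \<epsilon>) p \<in> L' \<longrightarrow> (\<forall>\<xi>. norm \<xi> \<le> 1 \<longrightarrow>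
       deriv_norm 0 (\<lambda>x. hom_rep E F (V, \<phi>, \<eta>) (W, \<psi>, \<theta>) (v \<epsilon>) x \<xi>) (\<phi> p) \<le> ennreal (M \<epsilon>))"
    by (rule moderate_homs_bound[OF v c d L L', of 0]) (rule that)
  show ?thesis
  proof (rule that[OF M(1,2)])
    show "\<forall>\<^sub>F \<epsilon> in at_right 0. \<forall>p\<in>L. base_map E F (v \<epsilon>) p \<in> L' \<longrightarrow>
       (\<forall>\<xi>. norm (hom_rep E F (V, \<phi>, \<eta>) (W, \<psi>, \<theta>) (v \<epsilon>) (\<phi> p) \<xi>) \<le> M \<epsilon> * norm \<xi>)"
      using M(3) eventually_idx
    proof (eventually_elim, intro ballI allI impI)
      fix \<epsilon> p \<xi>
      assume M': "\<forall>p\<in>L. base_map E F (v \<epsilon>) p \<in> L' \<longrightarrow> (\<forall>\<xi>. norm \<xi> \<le> 1 \<longrightarrow>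
          deriv_norm 0 (\<lambda>x. hom_rep E F (V, \<phi>, \<eta>) (W, \<psi>, \<theta>) (v \<epsilon>) x \<xi>) (\<phi> p) \<le> ennreal (M \<epsilon>))"
        and \<epsilon>: "\<epsilon> \<in> idx" and p: "p \<in> L" "base_map E F (v \<epsilon>) p \<in> L'"
      have "p \<in> V" "base_map E F (v \<epsilon>) p \<in> W"
        using p L L' unfolding compact_in_def by auto
      from hom_rep_linear[OF E F moderate_homs_hom[OF v \<epsilon>] c d this]
      show "norm (hom_rep E F (V, \<phi>, \<eta>) (W, \<psi>, \<theta>) (v \<epsilon>) (\<phi> p) \<xi>) \<le> M \<epsilon> * norm \<xi>"
        by (rule linear_bound_unit_ball) (use M' p M(2)[of \<epsilon>] in \<open>auto simp: deriv_norm_0\<close>)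
    qed
  qed
qed

text \<open>The moderate bound holds only at points of \<open>L\<close> that are mapped into
  \<open>L'\<close>. To integrate the derivative from \<open>p\<close> to \<open>q\<close> it must
  hold on a convex set containing both, whence the conditions that all of \<open>L\<close> is mapped
  into \<open>L'\<close> and that a ball about \<open>\<phi> p\<close> reaching
  \<open>\<phi> q\<close> has its preimage in \<open>L\<close>.\<close>

lemma moderate_homs_fiber_lipschitz:
  fixes E :: "('x, 'a::fin_dim_normed, 'p, 'e::fin_dim_normed, 'k::real_or_complex) vbundle"
    and F :: "('y, 'b::fin_dim_normed, 'q, 'f::fin_dim_normed, 'k) vbundle"
  assumes E: "vector_bundle E" and F: "vector_bundle F" and v: "v \<in> moderate_homs E F"
    and c: "(V, \<phi>, \<eta>) \<in> vb_charts E" and d: "(W, \<psi>, \<theta>) \<in> vb_charts F"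
    and L: "compact_in (points (base E)) L V" and L': "compact_in (points (base F)) L' W"
  obtains M where "mod_on (\<lambda>_. True) M" "\<And>\<epsilon>. 0 \<le> M \<epsilon>"
    "\<forall>\<^sub>F \<epsilon> in at_right 0. base_map E F (v \<epsilon>) ` L \<subseteq> L' \<longrightarrow>
       (\<forall>p\<in>L. \<forall>q\<in>L. cball (\<phi> p) (dist (\<phi> p) (\<phi> q)) \<subseteq> \<phi> ` L \<longrightarrow>
         (\<forall>\<xi>. norm (hom_rep E F (V, \<phi>, \<eta>) (W, \<psi>, \<theta>) (v \<epsilon>) (\<phi> p) \<xi>
           - hom_rep E F (V, \<phi>, \<eta>) (W, \<psi>, \<theta>) (v \<epsilon>) (\<phi> q) \<xi>) \<le> M \<epsilon> * dist (\<phi> p) (\<phi> q) * norm \<xi>))"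
proof -
  let ?R = "\<lambda>\<epsilon>. hom_rep E F (V, \<phi>, \<eta>) (W, \<psi>, \<theta>) (v \<epsilon>)"
  obtain M where M: "mod_on (\<lambda>_. True) M" "\<And>\<epsilon>. 0 \<le> M \<epsilon>"
    "\<forall>\<^sub>F \<epsilon> in at_right 0. \<forall>p\<in>L. base_map E F (v \<epsilon>) p \<in> L' \<longrightarrow> (\<forall>\<xi>. norm \<xi> \<le> 1 \<longrightarrow>
       deriv_norm 1 (\<lambda>x. ?R \<epsilon> x \<xi>) (\<phi> p) \<le> ennreal (M \<epsilon>))"
    by (rule moderate_homs_bound[OF v c d L L', of 1]) (rule that)
  have LV: "L \<subseteq> V" and LW: "L' \<subseteq> W"
    using L L' unfolding compact_in_def by auto
  show ?thesis
  proof (rule that[OF M(1,2)])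
    show "\<forall>\<^sub>F \<epsilon> in at_right 0. base_map E F (v \<epsilon>) ` L \<subseteq> L' \<longrightarrow>
       (\<forall>p\<in>L. \<forall>q\<in>L. cball (\<phi> p) (dist (\<phi> p) (\<phi> q)) \<subseteq> \<phi> ` L \<longrightarrow>
         (\<forall>\<xi>. norm (?R \<epsilon> (\<phi> p) \<xi> - ?R \<epsilon> (\<phi> q) \<xi>) \<le> M \<epsilon> * dist (\<phi> p) (\<phi> q) * norm \<xi>))"
      using M(3) eventually_idx
    proof (eventually_elim, intro ballI allI impI)
      fix \<epsilon> p q \<xi>
      assume M': "\<forall>p\<in>L. base_map E F (v \<epsilon>) p \<in> L' \<longrightarrow> (\<forall>\<xi>. norm \<xi> \<le> 1 \<longrightarrow>
          deriv_norm 1 (\<lambda>x. ?R \<epsilon> x \<xi>) (\<phi> p) \<le> ennreal (M \<epsilon>))"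
        and \<epsilon>: "\<epsilon> \<in> idx" and im: "base_map E F (v \<epsilon>) ` L \<subseteq> L'" and p: "p \<in> L" and q: "q \<in> L"
        and cb: "cball (\<phi> p) (dist (\<phi> p) (\<phi> q)) \<subseteq> \<phi> ` L"
      note hom = moderate_homs_hom[OF v \<epsilon>]
      have yW: "y \<in> V" "base_map E F (v \<epsilon>) y \<in> W" if "y \<in> L" for y
        using that im LV LW by auto
      have "linear (\<lambda>\<xi>. ?R \<epsilon> (\<phi> p) \<xi> - ?R \<epsilon> (\<phi> q) \<xi>)"
        using hom_rep_linear[OF E F hom c d yW[OF p]] hom_rep_linear[OF E F hom c d yW[OF q]]
        by (rule linear_compose_sub)
      then show "norm (?R \<epsilon> (\<phi> p) \<xi> - ?R \<epsilon> (\<phi> q) \<xi>) \<le> M \<epsilon> * dist (\<phi> p) (\<phi> q) * norm \<xi>"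
      proof (rule linear_bound_unit_ball)
        fix \<zeta> :: 'e assume \<zeta>: "norm \<zeta> \<le> 1"
        have diff: "(\<lambda>x. ?R \<epsilon> x \<zeta>) differentiable (at x)" if "x \<in> cball (\<phi> p) (dist (\<phi> p) (\<phi> q))" for x
          using that cb hom_rep_differentiable[OF E hom c d yW] by blast
        have bd: "norm (frechet_derivative (\<lambda>x. ?R \<epsilon> x \<zeta>) (at x) u) \<le> M \<epsilon> * norm u"
          if x: "x \<in> cball (\<phi> p) (dist (\<phi> p) (\<phi> q))" for x u
        proof -
          obtain y where y: "y \<in> L" "x = \<phi> y"
            using x cb by blast
          then have "deriv_norm 1 (\<lambda>x. ?R \<epsilon> x \<zeta>) x \<le> ennreal (M \<epsilon>)"
            using M' im \<zeta> by blast
          then show ?thesis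
            by (rule frechet_derivative_le_deriv_norm[OF diff[OF x] _ M(2)])
        qed
        have "norm (?R \<epsilon> (\<phi> p) \<zeta> - ?R \<epsilon> (\<phi> q) \<zeta>) \<le> M \<epsilon> * norm (\<phi> p - \<phi> q)"
          by (rule norm_diff_le_frechet_derivative[OF convex_cball diff bd M(2)]) auto
        then show "norm (?R \<epsilon> (\<phi> p) \<zeta> - ?R \<epsilon> (\<phi> q) \<zeta>) \<le> M \<epsilon> * dist (\<phi> p) (\<phi> q)"
          by (simp add: dist_norm)
      qed
    qed
  qed
qed

text \<open>The counterpart for base maps. Moderateness of maps bounds derivatives of order at least
  1, which is what a difference of values in one chart calls for.\<close>

lemma moderate_maps_lipschitz:
  assumes u: "u \<in> moderate_maps X Y" and X: "smooth_manifold X"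
    and c: "(V, \<phi>) \<in> charts X" and d: "(W, \<psi>) \<in> charts Y"
    and L: "compact_in (points X) L V" and L': "compact_in (points Y) L' W"
  obtains M where "mod_on (\<lambda>_. True) M" "\<And>\<epsilon>. 0 \<le> M \<epsilon>"
    "\<forall>\<^sub>F \<epsilon> in at_right 0. u \<epsilon> ` L \<subseteq> L' \<longrightarrow>
       (\<forall>p\<in>L. \<forall>q\<in>L. cball (\<phi> p) (dist (\<phi> p) (\<phi> q)) \<subseteq> \<phi> ` L \<longrightarrow>
         dist (\<psi> (u \<epsilon> p)) (\<psi> (u \<epsilon> q)) \<le> M \<epsilon> * dist (\<phi> p) (\<phi> q))"
proof -
  let ?f = "\<lambda>\<epsilon>. \<psi> \<circ> u \<epsilon> \<circ> inv_into V \<phi>"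
  have "\<And>k. k \<ge> 1 \<Longrightarrow> moderate (\<lambda>\<epsilon>. SUP p \<in> L \<inter> u \<epsilon> -` L'. deriv_norm k (?f \<epsilon>) (\<phi> p))"
    using u c d L L' unfolding moderate_maps_def by fast
  then have "moderate (\<lambda>\<epsilon>. SUP p \<in> L \<inter> u \<epsilon> -` L'. deriv_norm 1 (?f \<epsilon>) (\<phi> p))"
    by simp
  then obtain M where M: "mod_on (\<lambda>_. True) M" "\<And>\<epsilon>. 0 \<le> M \<epsilon>"
    "\<forall>\<^sub>F \<epsilon> in at_right 0. (SUP p \<in> L \<inter> u \<epsilon> -` L'. deriv_norm 1 (?f \<epsilon>) (\<phi> p)) \<le> ennreal (M \<epsilon>)"
    by (rule moderate_bound) (rule that)
  have LV: "L \<subseteq> V" and LW: "L' \<subseteq> W"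
    using L L' unfolding compact_in_def by auto
  note inv = is_chart_inv[OF smooth_manifold_chart[OF X c]]
  show ?thesis
  proof (rule that[OF M(1,2)])
    show "\<forall>\<^sub>F \<epsilon> in at_right 0. u \<epsilon> ` L \<subseteq> L' \<longrightarrow>
       (\<forall>p\<in>L. \<forall>q\<in>L. cball (\<phi> p) (dist (\<phi> p) (\<phi> q)) \<subseteq> \<phi> ` L \<longrightarrow>
         dist (\<psi> (u \<epsilon> p)) (\<psi> (u \<epsilon> q)) \<le> M \<epsilon> * dist (\<phi> p) (\<phi> q))"
      using M(3) eventually_idx
    proof (eventually_elim, intro ballI impI)
      fix \<epsilon> p q
      assume M': "(SUP p \<in> L \<inter> u \<epsilon> -` L'. deriv_norm 1 (?f \<epsilon>) (\<phi> p)) \<le> ennreal (M \<epsilon>)"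
        and \<epsilon>: "\<epsilon> \<in> idx" and im: "u \<epsilon> ` L \<subseteq> L'" and p: "p \<in> L" and q: "q \<in> L"
        and cb: "cball (\<phi> p) (dist (\<phi> p) (\<phi> q)) \<subseteq> \<phi> ` L"
      have "smooth_map (points X) (charts X) (points Y) (charts Y) (u \<epsilon>)"
        using u \<epsilon> unfolding moderate_maps_def by blast
      then have smooth: "smooth_on (\<phi> ` (V \<inter> u \<epsilon> -` W)) (?f \<epsilon>)"
        using c d unfolding smooth_map_def by fast
      have diff: "?f \<epsilon> differentiable (at x)" if "x \<in> cball (\<phi> p) (dist (\<phi> p) (\<phi> q))" for x
      proof (rule smooth_on_differentiable[OF smooth])
        show "x \<in> \<phi> ` (V \<inter> u \<epsilon> -` W)"
          using that cb im LV LW by blast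
      qed
      have bd: "norm (frechet_derivative (?f \<epsilon>) (at x) w) \<le> M \<epsilon> * norm w"
        if x: "x \<in> cball (\<phi> p) (dist (\<phi> p) (\<phi> q))" for x w
      proof -
        obtain y where y: "y \<in> L" "x = \<phi> y"
          using x cb by blast
        have "deriv_norm 1 (?f \<epsilon>) x \<le> (SUP p \<in> L \<inter> u \<epsilon> -` L'. deriv_norm 1 (?f \<epsilon>) (\<phi> p))"
          unfolding y(2) using y(1) im by (intro SUP_upper) auto
        also note M'
        finally show ?thesis
          by (rule frechet_derivative_le_deriv_norm[OF diff[OF x] _ M(2)])
      qed
      have "norm (?f \<epsilon> (\<phi> p) - ?f \<epsilon> (\<phi> q)) \<le> M \<epsilon> * norm (\<phi> p - \<phi> q)"
        by (rule norm_diff_le_frechet_derivative[OF convex_cball diff bd M(2)]) auto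
      then show "dist (\<psi> (u \<epsilon> p)) (\<psi> (u \<epsilon> q)) \<le> M \<epsilon> * dist (\<phi> p) (\<phi> q)"
        using p q LV inv by (simp add: dist_norm subset_iff)
    qed
  qed
qed

text \<open>Leaving \<open>J\<close> open lets the same bound serve the full equivalence, which
  enters the independence of representatives, and the zeroth order relation of the claim.\<close>

lemma maps_equiv_bound:
  assumes uv: "maps_equiv X Y g J u v" and J: "0 \<in> J" and X: "smooth_manifold X"
    and c: "(V, \<phi>) \<in> charts X" and d: "(W, \<psi>) \<in> charts Y"
    and L: "compact_in (points X) L V" and L': "compact_in (points Y) L' W"
  obtains N where "negl_on (\<lambda>_. True) N" "\<And>\<epsilon>. 0 \<le> N \<epsilon>"
    "\<forall>\<^sub>F \<epsilon> in at_right 0. \<forall>p\<in>L. u \<epsilon> p \<in> L' \<longrightarrow> v \<epsilon> p \<in> L' \<longrightarrow> dist (\<psi> (u \<epsilon> p)) (\<psi> (v \<epsilon> p)) \<le> N \<epsilon>"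
proof -
  let ?A = "\<lambda>\<epsilon>. L \<inter> u \<epsilon> -` L' \<inter> v \<epsilon> -` L'"
  let ?f = "\<lambda>\<epsilon> x. (\<psi> \<circ> u \<epsilon> \<circ> inv_into V \<phi>) x - (\<psi> \<circ> v \<epsilon> \<circ> inv_into V \<phi>) x"
  have "negligible_net (\<lambda>\<epsilon>. SUP p \<in> ?A \<epsilon>. deriv_norm 0 (?f \<epsilon>) (\<phi> p))"
    using uv J c d L L' unfolding maps_equiv_def by fast
  then obtain N where N: "negl_on (\<lambda>_. True) N" "\<And>\<epsilon>. 0 \<le> N \<epsilon>"
    "\<forall>\<^sub>F \<epsilon> in at_right 0. (SUP p \<in> ?A \<epsilon>. deriv_norm 0 (?f \<epsilon>) (\<phi> p)) \<le> ennreal (N \<epsilon>)"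
    by (rule negligible_bound) (rule that)
  show ?thesis
  proof (rule that[OF N(1,2)])
    show "\<forall>\<^sub>F \<epsilon> in at_right 0. \<forall>p\<in>L. u \<epsilon> p \<in> L' \<longrightarrow> v \<epsilon> p \<in> L' \<longrightarrow> dist (\<psi> (u \<epsilon> p)) (\<psi> (v \<epsilon> p)) \<le> N \<epsilon>"
      using N(3)
    proof (eventually_elim, intro ballI impI)
      fix \<epsilon> p
      assume le: "(SUP p \<in> ?A \<epsilon>. deriv_norm 0 (?f \<epsilon>) (\<phi> p)) \<le> ennreal (N \<epsilon>)"
        and p: "p \<in> L" "u \<epsilon> p \<in> L'" "v \<epsilon> p \<in> L'"
      have "inv_into V \<phi> (\<phi> p) = p"
        using is_chart_inv[OF smooth_manifold_chart[OF X c]] p(1) L unfolding compact_in_def by blast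
      then have "ennreal (dist (\<psi> (u \<epsilon> p)) (\<psi> (v \<epsilon> p))) = deriv_norm 0 (?f \<epsilon>) (\<phi> p)"
        by (simp add: deriv_norm_0 dist_norm)
      also have "\<dots> \<le> (SUP p \<in> ?A \<epsilon>. deriv_norm 0 (?f \<epsilon>) (\<phi> p))"
        using p by (intro SUP_upper) simp
      also note le
      finally show "dist (\<psi> (u \<epsilon> p)) (\<psi> (v \<epsilon> p)) \<le> N \<epsilon>"
        using N(2) by simp
    qed
  qed
qed

lemma homs_equiv_bound:
  fixes E :: "('x, 'a::fin_dim_normed, 'p, 'e::fin_dim_normed, 'k::real_or_complex) vbundle"
    and F :: "('y, 'b::fin_dim_normed, 'q, 'f::fin_dim_normed, 'k) vbundle"
  assumes E: "vector_bundle E" and F: "vector_bundle F"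
    and v: "v \<in> moderate_homs E F" and w: "w \<in> moderate_homs E F"
    and vw: "homs_equiv E F g J v w" and J: "0 \<in> J"
    and c: "(V, \<phi>, \<eta>) \<in> vb_charts E" and d: "(W, \<psi>, \<theta>) \<in> vb_charts F"
    and L: "compact_in (points (base E)) L V" and L': "compact_in (points (base F)) L' W"
  obtains N where "negl_on (\<lambda>_. True) N" "\<And>\<epsilon>. 0 \<le> N \<epsilon>"
    "\<forall>\<^sub>F \<epsilon> in at_right 0. \<forall>p\<in>L. base_map E F (v \<epsilon>) p \<in> L' \<longrightarrow> base_map E F (w \<epsilon>) p \<in> L' \<longrightarrow>
      (\<forall>\<xi>. norm (hom_rep E F (V, \<phi>, \<eta>) (W, \<psi>, \<theta>) (v \<epsilon>) (\<phi> p) \<xi>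
        - hom_rep E F (V, \<phi>, \<eta>) (W, \<psi>, \<theta>) (w \<epsilon>) (\<phi> p) \<xi>) \<le> N \<epsilon> * norm \<xi>)"
proof -
  let ?A = "\<lambda>\<epsilon>. L \<inter> base_map E F (v \<epsilon>) -` L' \<inter> base_map E F (w \<epsilon>) -` L'"
  let ?R = "\<lambda>\<epsilon>. hom_rep E F (V, \<phi>, \<eta>) (W, \<psi>, \<theta>) (v \<epsilon>)" and ?S = "\<lambda>\<epsilon>. hom_rep E F (V, \<phi>, \<eta>) (W, \<psi>, \<theta>) (w \<epsilon>)"
  have "negligible_net (\<lambda>\<epsilon>. SUP p \<in> ?A \<epsilon>. hom_deriv_norm 0 (\<lambda>x \<xi>. ?R \<epsilon> x \<xi> - ?S \<epsilon> x \<xi>) (\<phi> p))"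
    using vw J c d L L' unfolding homs_equiv_def by fast
  then obtain N where N: "negl_on (\<lambda>_. True) N" "\<And>\<epsilon>. 0 \<le> N \<epsilon>"
    "\<forall>\<^sub>F \<epsilon> in at_right 0. (SUP p \<in> ?A \<epsilon>. hom_deriv_norm 0 (\<lambda>x \<xi>. ?R \<epsilon> x \<xi> - ?S \<epsilon> x \<xi>) (\<phi> p)) \<le> ennreal (N \<epsilon>)"
    by (rule negligible_bound) (rule that)
  show ?thesis
  proof (rule that[OF N(1,2)])
    show "\<forall>\<^sub>F \<epsilon> in at_right 0. \<forall>p\<in>L. base_map E F (v \<epsilon>) p \<in> L' \<longrightarrow> base_map E F (w \<epsilon>) p \<in> L' \<longrightarrow>
        (\<forall>\<xi>. norm (?R \<epsilon> (\<phi> p) \<xi> - ?S \<epsilon> (\<phi> p) \<xi>) \<le> N \<epsilon> * norm \<xi>)"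
      using N(3) eventually_idx
    proof (eventually_elim, intro ballI impI allI)
      fix \<epsilon> p and \<xi> :: 'e
      assume le: "(SUP p \<in> ?A \<epsilon>. hom_deriv_norm 0 (\<lambda>x \<xi>. ?R \<epsilon> x \<xi> - ?S \<epsilon> x \<xi>) (\<phi> p)) \<le> ennreal (N \<epsilon>)"
        and \<epsilon>: "\<epsilon> \<in> idx" and p: "p \<in> L" "base_map E F (v \<epsilon>) p \<in> L'" "base_map E F (w \<epsilon>) p \<in> L'"
      have "p \<in> V" and pW: "base_map E F (v \<epsilon>) p \<in> W" "base_map E F (w \<epsilon>) p \<in> W"
        using p L L' unfolding compact_in_def by auto
      have "linear (\<lambda>\<xi>. ?R \<epsilon> (\<phi> p) \<xi> - ?S \<epsilon> (\<phi> p) \<xi>)"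
        using hom_rep_linear[OF E F moderate_homs_hom[OF v \<epsilon>] c d \<open>p \<in> V\<close> pW(1)]
          hom_rep_linear[OF E F moderate_homs_hom[OF w \<epsilon>] c d \<open>p \<in> V\<close> pW(2)]
        by (rule linear_compose_sub)
      then show "norm (?R \<epsilon> (\<phi> p) \<xi> - ?S \<epsilon> (\<phi> p) \<xi>) \<le> N \<epsilon> * norm \<xi>"
      proof (rule linear_bound_unit_ball)
        fix \<zeta> :: 'e assume \<zeta>: "norm \<zeta> \<le> 1"
        have "ennreal (norm (?R \<epsilon> (\<phi> p) \<zeta> - ?S \<epsilon> (\<phi> p) \<zeta>))
            = deriv_norm 0 (\<lambda>x. ?R \<epsilon> x \<zeta> - ?S \<epsilon> x \<zeta>) (\<phi> p)"
          by (simp add: deriv_norm_0)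
        also have "\<dots> \<le> hom_deriv_norm 0 (\<lambda>x \<xi>. ?R \<epsilon> x \<xi> - ?S \<epsilon> x \<xi>) (\<phi> p)"
          unfolding hom_deriv_norm_def using \<zeta> by (intro SUP_upper) simp
        also have "\<dots> \<le> (SUP p \<in> ?A \<epsilon>. hom_deriv_norm 0 (\<lambda>x \<xi>. ?R \<epsilon> x \<xi> - ?S \<epsilon> x \<xi>) (\<phi> p))"
          using p by (intro SUP_upper) simp
        also note le
        finally show "norm (?R \<epsilon> (\<phi> p) \<zeta> - ?S \<epsilon> (\<phi> p) \<zeta>) \<le> N \<epsilon>"
          using N(2) by simp
      qed
    qed
  qed
qed

text \<open>The main estimate, in one chart of the source and one of the target. Changing
  \<open>e\<close> to \<open>e'\<close> uses the moderate first derivatives of \<open>v\<close>;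
  changing \<open>v\<close> to \<open>w\<close> uses the zeroth order relation at the base point of
  \<open>e'\<close>. The condition \<open>P\<close> allows for a net that is in this source chart
  only for some \<epsilon>.\<close>

lemma hom_values_close_chart:
  fixes E :: "('x, 'a::fin_dim_normed, 'p, 'e::fin_dim_normed, 'k::real_or_complex) vbundle"
    and F :: "('y, 'b::fin_dim_normed, 'q, 'f::fin_dim_normed, 'k) vbundle"
  assumes E: "vector_bundle E" and F: "vector_bundle F" and h: "fiber_metric E h"
    and v: "v \<in> moderate_homs E F" and w: "w \<in> moderate_homs E F"
    and vw: "homs_equiv E F g' J v w" and J: "0 \<in> J"
    and c: "(V, \<phi>, \<eta>) \<in> vb_charts E" and d: "(W, \<psi>, \<theta>) \<in> vb_charts F"
    and L: "compact_in (points (base E)) L V" and L': "compact_in (points (base F)) L' W"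
    and im: "\<forall>\<^sub>F \<epsilon> in at_right 0. \<forall>y\<in>L. base_map E F (v \<epsilon>) y \<in> L' \<and> base_map E F (w \<epsilon>) y \<in> L'"
    and ee': "(e, e') \<in> vb_point_equiv E g h"
    and P: "\<forall>\<^sub>F \<epsilon> in at_right 0. P \<epsilon> \<longrightarrow> proj E (e \<epsilon>) \<in> L \<and> proj E (e' \<epsilon>) \<in> L \<and>
      cball (\<phi> (proj E (e \<epsilon>))) (dist (\<phi> (proj E (e \<epsilon>))) (\<phi> (proj E (e' \<epsilon>)))) \<subseteq> \<phi> ` L"
    and base: "negl_on P (\<lambda>\<epsilon>. dist (\<phi> (proj E (e \<epsilon>))) (\<phi> (proj E (e' \<epsilon>))))"
  shows "negl_on P (\<lambda>\<epsilon>. dist (\<psi> (proj F (v \<epsilon> (e \<epsilon>)))) (\<psi> (proj F (w \<epsilon> (e' \<epsilon>)))))"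
    and "negl_on P (\<lambda>\<epsilon>. norm (\<theta> (v \<epsilon> (e \<epsilon>)) - \<theta> (w \<epsilon> (e' \<epsilon>))))"
    and "mod_on P (\<lambda>\<epsilon>. norm (\<theta> (v \<epsilon> (e \<epsilon>))))"
proof -
  let ?p = "\<lambda>\<epsilon>. proj E (e \<epsilon>)" and ?q = "\<lambda>\<epsilon>. proj E (e' \<epsilon>)"
  let ?b = "\<lambda>\<epsilon>. base_map E F (v \<epsilon>)" and ?b' = "\<lambda>\<epsilon>. base_map E F (w \<epsilon>)"
  let ?R = "\<lambda>\<epsilon>. hom_rep E F (V, \<phi>, \<eta>) (W, \<psi>, \<theta>) (v \<epsilon>)" and ?S = "\<lambda>\<epsilon>. hom_rep E F (V, \<phi>, \<eta>) (W, \<psi>, \<theta>) (w \<epsilon>)"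
  let ?d = "\<lambda>\<epsilon>. dist (\<phi> (?p \<epsilon>)) (\<phi> (?q \<epsilon>))"
  have e: "e \<in> vb_moderate E h" "e' \<in> vb_moderate E h"
    and fib: "negl_on (\<lambda>\<epsilon>. ?p \<epsilon> \<in> L \<and> ?q \<epsilon> \<in> L) (\<lambda>\<epsilon>. norm (\<eta> (e \<epsilon>) - \<eta> (e' \<epsilon>)))"
    using ee' c L unfolding vb_point_equiv_iff by blast+
  have mW: "maps_equiv (base E) (base F) g' J ?b ?b'"
    using vw unfolding homs_equiv_def by simp
  have LV: "L \<subseteq> V" and LW: "L' \<subseteq> W"
    using L L' unfolding compact_in_def by auto
  have mod_True: "mod_on P r" if "mod_on (\<lambda>_. True) r" for r
    using that by (rule mod_on_mono) simp
  have negl_True: "negl_on P r" if "negl_on (\<lambda>_. True) r" for r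
    using that by (rule negl_on_mono) simp
  obtain Mb where Mb: "mod_on (\<lambda>_. True) Mb" "\<And>\<epsilon>. 0 \<le> Mb \<epsilon>"
    "\<forall>\<^sub>F \<epsilon> in at_right 0. ?b \<epsilon> ` L \<subseteq> L' \<longrightarrow>
       (\<forall>p\<in>L. \<forall>q\<in>L. cball (\<phi> p) (dist (\<phi> p) (\<phi> q)) \<subseteq> \<phi> ` L \<longrightarrow>
         dist (\<psi> (?b \<epsilon> p)) (\<psi> (?b \<epsilon> q)) \<le> Mb \<epsilon> * dist (\<phi> p) (\<phi> q))"
    by (rule moderate_maps_lipschitz[OF moderate_homs_base[OF v] vb_manifold[OF E] vb_chart_base[OF E c]
          vb_chart_base[OF F d] L L']) (rule that)
  obtain Nb where Nb: "negl_on (\<lambda>_. True) Nb" "\<And>\<epsilon>. 0 \<le> Nb \<epsilon>"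
    "\<forall>\<^sub>F \<epsilon> in at_right 0. \<forall>p\<in>L. ?b \<epsilon> p \<in> L' \<longrightarrow> ?b' \<epsilon> p \<in> L' \<longrightarrow> dist (\<psi> (?b \<epsilon> p)) (\<psi> (?b' \<epsilon> p)) \<le> Nb \<epsilon>"
    by (rule maps_equiv_bound[OF mW J vb_manifold[OF E] vb_chart_base[OF E c] vb_chart_base[OF F d] L L'])
      (rule that)
  obtain M0 where M0: "mod_on (\<lambda>_. True) M0" "\<And>\<epsilon>. 0 \<le> M0 \<epsilon>"
    "\<forall>\<^sub>F \<epsilon> in at_right 0. \<forall>p\<in>L. ?b \<epsilon> p \<in> L' \<longrightarrow> (\<forall>\<xi>. norm (?R \<epsilon> (\<phi> p) \<xi>) \<le> M0 \<epsilon> * norm \<xi>)"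
    by (rule moderate_homs_fiber_bound[OF E F v c d L L']) (rule that)
  obtain M1 where M1: "mod_on (\<lambda>_. True) M1" "\<And>\<epsilon>. 0 \<le> M1 \<epsilon>"
    "\<forall>\<^sub>F \<epsilon> in at_right 0. ?b \<epsilon> ` L \<subseteq> L' \<longrightarrow>
       (\<forall>p\<in>L. \<forall>q\<in>L. cball (\<phi> p) (dist (\<phi> p) (\<phi> q)) \<subseteq> \<phi> ` L \<longrightarrow>
         (\<forall>\<xi>. norm (?R \<epsilon> (\<phi> p) \<xi> - ?R \<epsilon> (\<phi> q) \<xi>) \<le> M1 \<epsilon> * dist (\<phi> p) (\<phi> q) * norm \<xi>))"
    by (rule moderate_homs_fiber_lipschitz[OF E F v c d L L']) (rule that)
  obtain N where N: "negl_on (\<lambda>_. True) N" "\<And>\<epsilon>. 0 \<le> N \<epsilon>"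
    "\<forall>\<^sub>F \<epsilon> in at_right 0. \<forall>p\<in>L. ?b \<epsilon> p \<in> L' \<longrightarrow> ?b' \<epsilon> p \<in> L' \<longrightarrow>
      (\<forall>\<xi>. norm (?R \<epsilon> (\<phi> p) \<xi> - ?S \<epsilon> (\<phi> p) \<xi>) \<le> N \<epsilon> * norm \<xi>)"
    by (rule homs_equiv_bound[OF E F v w vw J c d L L']) (rule that)
  have projs: "\<forall>\<^sub>F \<epsilon> in at_right 0. proj F (v \<epsilon> (e \<epsilon>)) = ?b \<epsilon> (?p \<epsilon>) \<and> proj F (w \<epsilon> (e' \<epsilon>)) = ?b' \<epsilon> (?q \<epsilon>)"
    using eventually_idx
  proof eventually_elim
    case (elim \<epsilon>)
    then show ?case
      using vb_homs_topspace(2) moderate_homs_hom v w vb_moderate_topspace e by metis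
  qed
  have fibs: "\<forall>\<^sub>F \<epsilon> in at_right 0. P \<epsilon> \<longrightarrow> \<theta> (v \<epsilon> (e \<epsilon>)) = ?R \<epsilon> (\<phi> (?p \<epsilon>)) (\<eta> (e \<epsilon>)) \<and>
      \<theta> (w \<epsilon> (e' \<epsilon>)) = ?S \<epsilon> (\<phi> (?q \<epsilon>)) (\<eta> (e' \<epsilon>))"
    using eventually_idx P
  proof (eventually_elim, intro impI)
    fix \<epsilon> assume \<epsilon>: "\<epsilon> \<in> idx" and "P \<epsilon>" and P': "P \<epsilon> \<longrightarrow> ?p \<epsilon> \<in> L \<and> ?q \<epsilon> \<in> L \<and> cball (\<phi> (?p \<epsilon>)) (?d \<epsilon>) \<subseteq> \<phi> ` L"
    then have pq: "?p \<epsilon> \<in> V" "?q \<epsilon> \<in> V"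
      using LV by auto
    show "\<theta> (v \<epsilon> (e \<epsilon>)) = ?R \<epsilon> (\<phi> (?p \<epsilon>)) (\<eta> (e \<epsilon>)) \<and> \<theta> (w \<epsilon> (e' \<epsilon>)) = ?S \<epsilon> (\<phi> (?q \<epsilon>)) (\<eta> (e' \<epsilon>))"
      using hom_rep_coords[OF E c vb_moderate_topspace[OF e(1) \<epsilon>] pq(1)]
        hom_rep_coords[OF E c vb_moderate_topspace[OF e(2) \<epsilon>] pq(2)] by blast
  qed
  have fibP: "negl_on P (\<lambda>\<epsilon>. norm (\<eta> (e \<epsilon>) - \<eta> (e' \<epsilon>)))"
    by (rule negl_on_mono[OF fib]) (use P in eventually_elim, simp)
  have modP: "mod_on P (\<lambda>\<epsilon>. norm (\<eta> (e \<epsilon>)))" "mod_on P (\<lambda>\<epsilon>. norm (\<eta> (e' \<epsilon>)))"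
    by (rule mod_on_mono[OF vb_moderate_fiber_component[OF E h c L e(1)]], use P in eventually_elim, simp)
      (rule mod_on_mono[OF vb_moderate_fiber_component[OF E h c L e(2)]], use P in eventually_elim, simp)
  \<comment> \<open>Moving the base point costs \<open>Mb\<close> times the distance; replacing the
    base map of \<open>v\<close> by that of \<open>w\<close> costs \<open>Nb\<close>.\<close>
  have "negl_on P (\<lambda>\<epsilon>. Mb \<epsilon> * ?d \<epsilon> + Nb \<epsilon>)"
    by (intro negl_on_add negl_on_mod_mult mod_True[OF Mb(1)] base negl_True[OF Nb(1)]) simp
  then show "negl_on P (\<lambda>\<epsilon>. dist (\<psi> (proj F (v \<epsilon> (e \<epsilon>)))) (\<psi> (proj F (w \<epsilon> (e' \<epsilon>)))))"
  proof (rule negl_on_mono)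
    show "\<forall>\<^sub>F \<epsilon> in at_right 0. P \<epsilon> \<longrightarrow> P \<epsilon> \<and>
        dist (\<psi> (proj F (v \<epsilon> (e \<epsilon>)))) (\<psi> (proj F (w \<epsilon> (e' \<epsilon>)))) \<le> Mb \<epsilon> * ?d \<epsilon> + Nb \<epsilon>"
      using Mb(3) Nb(3) projs P im
    proof eventually_elim
      case (elim \<epsilon>)
      have "dist (\<psi> (proj F (v \<epsilon> (e \<epsilon>)))) (\<psi> (proj F (w \<epsilon> (e' \<epsilon>)))) \<le> Mb \<epsilon> * ?d \<epsilon> + Nb \<epsilon>" if "P \<epsilon>"
      proof -
        from elim(4) that have pq: "?p \<epsilon> \<in> L" "?q \<epsilon> \<in> L" "cball (\<phi> (?p \<epsilon>)) (?d \<epsilon>) \<subseteq> \<phi> ` L"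
          by auto
        have "dist (\<psi> (?b \<epsilon> (?p \<epsilon>))) (\<psi> (?b \<epsilon> (?q \<epsilon>))) \<le> Mb \<epsilon> * ?d \<epsilon>"
          using elim(1,5) pq by blast
        moreover have "dist (\<psi> (?b \<epsilon> (?q \<epsilon>))) (\<psi> (?b' \<epsilon> (?q \<epsilon>))) \<le> Nb \<epsilon>"
          using elim(2,5) pq by blast
        ultimately show "dist (\<psi> (proj F (v \<epsilon> (e \<epsilon>)))) (\<psi> (proj F (w \<epsilon> (e' \<epsilon>)))) \<le> Mb \<epsilon> * ?d \<epsilon> + Nb \<epsilon>"
          using elim(3) dist_triangle[of "\<psi> (?b \<epsilon> (?p \<epsilon>))" "\<psi> (?b' \<epsilon> (?q \<epsilon>))" "\<psi> (?b \<epsilon> (?q \<epsilon>))"]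
          by simp
      qed
      then show ?case
        by simp
    qed
  qed
  have "negl_on P (\<lambda>\<epsilon>. M0 \<epsilon> * norm (\<eta> (e \<epsilon>) - \<eta> (e' \<epsilon>)) + M1 \<epsilon> * norm (\<eta> (e' \<epsilon>)) * ?d \<epsilon>
      + norm (\<eta> (e' \<epsilon>)) * N \<epsilon>)"
    by (intro negl_on_add negl_on_mod_mult mod_on_mult mod_True[OF M0(1)] mod_True[OF M1(1)]
        modP fibP base negl_True[OF N(1)]) (simp_all add: N(2))
  then show "negl_on P (\<lambda>\<epsilon>. norm (\<theta> (v \<epsilon> (e \<epsilon>)) - \<theta> (w \<epsilon> (e' \<epsilon>))))"
  proof (rule negl_on_mono)
    show "\<forall>\<^sub>F \<epsilon> in at_right 0. P \<epsilon> \<longrightarrow> P \<epsilon> \<and> norm (\<theta> (v \<epsilon> (e \<epsilon>)) - \<theta> (w \<epsilon> (e' \<epsilon>))) \<le>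
        M0 \<epsilon> * norm (\<eta> (e \<epsilon>) - \<eta> (e' \<epsilon>)) + M1 \<epsilon> * norm (\<eta> (e' \<epsilon>)) * ?d \<epsilon> + norm (\<eta> (e' \<epsilon>)) * N \<epsilon>"
      using M0(3) M1(3) N(3) fibs P im eventually_idx
    proof eventually_elim
      case (elim \<epsilon>)
      let ?x = "\<phi> (?p \<epsilon>)" and ?y = "\<phi> (?q \<epsilon>)" and ?\<xi> = "\<eta> (e \<epsilon>)" and ?\<zeta> = "\<eta> (e' \<epsilon>)"
      have "norm (\<theta> (v \<epsilon> (e \<epsilon>)) - \<theta> (w \<epsilon> (e' \<epsilon>))) \<le>
          M0 \<epsilon> * norm (\<eta> (e \<epsilon>) - \<eta> (e' \<epsilon>)) + M1 \<epsilon> * norm (\<eta> (e' \<epsilon>)) * ?d \<epsilon> + norm (\<eta> (e' \<epsilon>)) * N \<epsilon>"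
        if P\<epsilon>: "P \<epsilon>"
      proof -
        from elim(5) P\<epsilon> have pq: "?p \<epsilon> \<in> L" "?q \<epsilon> \<in> L" "cball ?x (?d \<epsilon>) \<subseteq> \<phi> ` L"
          by auto
        have lin: "linear (?R \<epsilon> ?x)"
          using pq(1) elim(6) LV LW
          by (intro hom_rep_linear[OF E F moderate_homs_hom[OF v elim(7)] c d]) auto
        \<comment> \<open>Three changes, one at a time: the vector at the base point of
          \<open>e\<close>, the base point with the vector of \<open>e'\<close> fixed, and the
          homomorphism at the base point of \<open>e'\<close>. Each is a moderate factor times a
          negligible one.\<close>
        have eq: "\<theta> (v \<epsilon> (e \<epsilon>)) - \<theta> (w \<epsilon> (e' \<epsilon>))
            = ?R \<epsilon> ?x (?\<xi> - ?\<zeta>) + (?R \<epsilon> ?x ?\<zeta> - ?R \<epsilon> ?y ?\<zeta>) + (?R \<epsilon> ?y ?\<zeta> - ?S \<epsilon> ?y ?\<zeta>)"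
          using elim(4) P\<epsilon> by (simp add: linear_diff[OF lin])
        have "norm (?R \<epsilon> ?x (?\<xi> - ?\<zeta>) + (?R \<epsilon> ?x ?\<zeta> - ?R \<epsilon> ?y ?\<zeta>) + (?R \<epsilon> ?y ?\<zeta> - ?S \<epsilon> ?y ?\<zeta>))
            \<le> M0 \<epsilon> * norm (?\<xi> - ?\<zeta>) + M1 \<epsilon> * ?d \<epsilon> * norm ?\<zeta> + N \<epsilon> * norm ?\<zeta>"
        proof (intro norm_triangle_mono)
          show "norm (?R \<epsilon> ?x (?\<xi> - ?\<zeta>)) \<le> M0 \<epsilon> * norm (?\<xi> - ?\<zeta>)"
            using elim(1,6) pq by blast
          show "norm (?R \<epsilon> ?x ?\<zeta> - ?R \<epsilon> ?y ?\<zeta>) \<le> M1 \<epsilon> * ?d \<epsilon> * norm ?\<zeta>"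
            using elim(2,6) pq by blast
          show "norm (?R \<epsilon> ?y ?\<zeta> - ?S \<epsilon> ?y ?\<zeta>) \<le> N \<epsilon> * norm ?\<zeta>"
            using elim(3,6) pq by blast
        qed
        then show ?thesis
          unfolding eq by (simp only: mult_ac)
      qed
      then show ?case
        by simp
    qed
  qed
  have "mod_on P (\<lambda>\<epsilon>. M0 \<epsilon> * norm (\<eta> (e \<epsilon>)))"
    by (intro mod_on_mult mod_True[OF M0(1)] modP) simp
  then show "mod_on P (\<lambda>\<epsilon>. norm (\<theta> (v \<epsilon> (e \<epsilon>))))"
  proof (rule mod_on_mono)
    show "\<forall>\<^sub>F \<epsilon> in at_right 0. P \<epsilon> \<longrightarrow> P \<epsilon> \<and> norm (\<theta> (v \<epsilon> (e \<epsilon>))) \<le> M0 \<epsilon> * norm (\<eta> (e \<epsilon>))"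
      using M0(3) fibs P im
    proof eventually_elim
      case (elim \<epsilon>)
      then show ?case
        by metis
    qed
  qed
qed

section \<open>Localization in the target and independence of representatives\<close>

lemma moderate_homs_base_topspace:
  assumes v: "v \<in> moderate_homs E F" and "\<epsilon> \<in> idx" and p: "p \<in> topspace (points (base E))"
  shows "base_map E F (v \<epsilon>) p \<in> topspace (points (base F))"
proof -
  have "smooth_map (points (base E)) (charts (base E)) (points (base F)) (charts (base F)) (base_map E F (v \<epsilon>))"
    using moderate_homs_base[OF v] \<open>\<epsilon> \<in> idx\<close> unfolding moderate_maps_def by blast
  then show ?thesis
    using p by (rule smooth_map_topspace)
qed

lemma base_map_in_closure_image:
  assumes v: "v \<in> moderate_homs E F" and K: "K \<subseteq> topspace (points (base E))"
    and \<epsilon>: "\<epsilon> \<in> idx" "\<epsilon> < \<epsilon>\<^sub>0" and y: "y \<in> K"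
  shows "base_map E F (v \<epsilon>) y \<in>
    points (base F) closure_of (\<Union>\<epsilon>\<in>idx \<inter> {..<\<epsilon>\<^sub>0}. base_map E F (v \<epsilon>) ` K)"
proof -
  have "base_map E F (v \<epsilon>) y \<in> topspace (points (base F))" if "\<epsilon> \<in> idx" "y \<in> K" for \<epsilon> y
    using moderate_homs_base_topspace[OF v that(1)] that(2) K by blast
  then have "(\<Union>\<epsilon>\<in>idx \<inter> {..<\<epsilon>\<^sub>0}. base_map E F (v \<epsilon>) ` K)
      \<subseteq> points (base F) closure_of (\<Union>\<epsilon>\<in>idx \<inter> {..<\<epsilon>\<^sub>0}. base_map E F (v \<epsilon>) ` K)"
    by (intro closure_of_subset) blast
  then show ?thesis
    using \<epsilon> y by blast
qed

text \<open>The localization concerns \<open>v\<close>. Distances between the base maps tend to 0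
  uniformly on \<open>K\<close>, so the values of \<open>w\<close> end up in a slightly larger
  compact subset of the same chart. This yields one chart for both nets, whereas separate
  localizations could use unrelated charts.\<close>

lemma base_localized_pair:
  assumes E: "vector_bundle E" and F: "vector_bundle F" and g: "riemannian_metric (base F) g"
    and v: "v \<in> moderate_homs E F" and loc: "base_localized E F v"
    and vw: "homs_equiv E F g J v w"
    and K: "compactin (points (base E)) K"
  obtains W \<psi> \<theta> L where "(W, \<psi>, \<theta>) \<in> vb_charts F" "compact_in (points (base F)) L W"
    "\<forall>\<^sub>F \<epsilon> in at_right 0. \<forall>y\<in>K. base_map E F (v \<epsilon>) y \<in> L \<and> base_map E F (w \<epsilon>) y \<in> L"
proof -
  obtain \<epsilon>\<^sub>0 W \<psi> \<theta> where "\<epsilon>\<^sub>0 > 0" and d: "(W, \<psi>, \<theta>) \<in> vb_charts F" and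
    L: "compact_in (points (base F))
      (points (base F) closure_of (\<Union>\<epsilon>\<in>idx \<inter> {..<\<epsilon>\<^sub>0}. base_map E F (v \<epsilon>) ` K)) W"
    using loc K unfolding base_localized_def by blast
  define L where "L = points (base F) closure_of (\<Union>\<epsilon>\<in>idx \<inter> {..<\<epsilon>\<^sub>0}. base_map E F (v \<epsilon>) ` K)"
  have "\<forall>\<^sub>F \<epsilon> in at_right 0. \<epsilon> < \<epsilon>\<^sub>0"
    using \<open>\<epsilon>\<^sub>0 > 0\<close> unfolding eventually_at_right_field by blast
  then have vL: "\<forall>\<^sub>F \<epsilon> in at_right 0. \<forall>y\<in>K. base_map E F (v \<epsilon>) y \<in> L"
    using eventually_idx
  proof eventually_elim
    case (elim \<epsilon>)
    then show ?case
      unfolding L_def using base_map_in_closure_image[OF v compactin_subset_topspace[OF K]] by blast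
  qed
  obtain \<delta> C r L' where L': "0 < \<delta>" "0 < C" "0 < r" "compact_in (points (base F)) L' W" "L \<subseteq> L'"
    "\<And>p x. p \<in> L \<Longrightarrow> dist (\<psi> p) x \<le> r \<Longrightarrow> x \<in> \<psi> ` L'"
    "\<And>p q. p \<in> L \<Longrightarrow> riem_dist (base F) g p q < ennreal \<delta> \<Longrightarrow> q \<in> L' \<and> dist (\<psi> p) (\<psi> q) \<le> r \<and>
      ennreal (dist (\<psi> p) (\<psi> q)) \<le> ennreal C * riem_dist (base F) g p q"
    by (rule riem_dist_lower[OF vb_manifold[OF F] g vb_chart_base[OF F d] L[folded L_def]]) (rule that)
  have "((\<lambda>\<epsilon>. SUP p\<in>K. riem_dist (base F) g (base_map E F (v \<epsilon>) p) (base_map E F (w \<epsilon>) p)) \<longlongrightarrow> 0) (at_right 0)"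
    using vw K unfolding homs_equiv_def maps_equiv_def by blast
  then have "\<forall>\<^sub>F \<epsilon> in at_right 0.
      (SUP p\<in>K. riem_dist (base F) g (base_map E F (v \<epsilon>) p) (base_map E F (w \<epsilon>) p)) < ennreal \<delta>"
    by (rule order_tendstoD(2)) (use L'(1) in simp)
  then have small: "\<forall>\<^sub>F \<epsilon> in at_right 0. \<forall>y\<in>K.
      riem_dist (base F) g (base_map E F (v \<epsilon>) y) (base_map E F (w \<epsilon>) y) < ennreal \<delta>"
  proof (eventually_elim, intro ballI)
    fix \<epsilon> y assume "(SUP p\<in>K. riem_dist (base F) g (base_map E F (v \<epsilon>) p) (base_map E F (w \<epsilon>) p)) < ennreal \<delta>"
      and "y \<in> K"
    then show "riem_dist (base F) g (base_map E F (v \<epsilon>) y) (base_map E F (w \<epsilon>) y) < ennreal \<delta>"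
      by (meson SUP_upper le_less_trans)
  qed
  show ?thesis
  proof (rule that[OF d L'(4)])
    show "\<forall>\<^sub>F \<epsilon> in at_right 0. \<forall>y\<in>K. base_map E F (v \<epsilon>) y \<in> L' \<and> base_map E F (w \<epsilon>) y \<in> L'"
      using vL small by eventually_elim (use L'(5,7) in blast)
  qed
qed

text \<open>Used three times: with \<open>J = UNIV\<close> for independence of representatives, with
  \<open>J = {0}\<close> for one implication of the claim, and with \<open>w = v\<close> for
  moderateness of values. The source is treated by finitely many charts, the target by a single one,
  where \<open>vb_class_chart_eq\<close> applies.\<close>

lemma hom_values_equal:
  fixes E :: "('x, 'a::fin_dim_normed, 'p, 'e::fin_dim_normed, 'k::real_or_complex) vbundle"
    and F :: "('y, 'b::fin_dim_normed, 'q, 'f::fin_dim_normed, 'k) vbundle"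
  assumes E: "vector_bundle E" and F: "vector_bundle F"
    and gX: "riemannian_metric (base E) gX" and gY: "riemannian_metric (base F) gY"
    and hE: "fiber_metric E hE" and hF: "fiber_metric F hF"
    and v: "v \<in> moderate_homs E F" and w: "w \<in> moderate_homs E F"
    and loc: "base_localized E F v" and vw: "homs_equiv E F gY J v w" and J: "0 \<in> J"
    and ee': "(e, e') \<in> vb_point_equiv E gX hE"
  shows "(\<lambda>\<epsilon>. v \<epsilon> (e \<epsilon>)) \<in> vb_moderate F hF"
    and "vb_class F gY hF (\<lambda>\<epsilon>. v \<epsilon> (e \<epsilon>)) = vb_class F gY hF (\<lambda>\<epsilon>. w \<epsilon> (e' \<epsilon>))"
proof -
  have e: "e \<in> vb_moderate E hE" "e' \<in> vb_moderate E hE"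
    and close: "point_close (base E) gX (\<lambda>\<epsilon>. proj E (e \<epsilon>)) (\<lambda>\<epsilon>. proj E (e' \<epsilon>))"
    using ee' unfolding vb_point_equiv_iff by blast+
  let ?p = "\<lambda>\<epsilon>. proj E (e \<epsilon>)" and ?q = "\<lambda>\<epsilon>. proj E (e' \<epsilon>)"
  obtain K where K: "compactin (points (base E)) K" "\<forall>\<^sub>F \<epsilon> in at_right 0. ?p \<epsilon> \<in> K"
    using e(1) unfolding vb_moderate_iff by blast
  obtain I where I: "finite I"
      "\<And>c L. (c, L) \<in> I \<Longrightarrow> c \<in> vb_charts E \<and> compact_in (points (base E)) L (fst c)"
      "\<And>p. p \<in> K \<Longrightarrow> \<exists>(c, L)\<in>I. p \<in> L"
    by (rule vb_compactin_cover[OF E K(1)]) (rule that)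
  \<comment> \<open>The data that \<open>point_close_chart\<close> provides for a compact set
    \<open>L\<close> in a chart \<open>c\<close>, in a form from which one pair of an enlarged set
    and a radius can be chosen for each member of the cover.\<close>
  let ?Pr = "\<lambda>c L L' r. (0::real) < r \<and> compact_in (points (base E)) L' (fst c) \<and> L \<subseteq> L' \<and>
      (\<forall>p\<in>L. \<forall>x. dist (fst (snd c) p) x \<le> r \<longrightarrow> x \<in> fst (snd c) ` L') \<and>
      (\<forall>\<^sub>F \<epsilon> in at_right 0. ?p \<epsilon> \<in> L \<longrightarrow> ?q \<epsilon> \<in> L' \<and> dist (fst (snd c) (?p \<epsilon>)) (fst (snd c) (?q \<epsilon>)) \<le> r) \<and>
      negl_on (\<lambda>\<epsilon>. ?p \<epsilon> \<in> L) (\<lambda>\<epsilon>. dist (fst (snd c) (?p \<epsilon>)) (fst (snd c) (?q \<epsilon>)))"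
  have ex: "\<exists>L' r. ?Pr (fst i) (snd i) L' r" if "i \<in> I" for i
  proof -
    obtain V \<phi> \<eta> L where i: "i = ((V, \<phi>, \<eta>), L)"
      by (cases i) auto
    have c: "(V, \<phi>, \<eta>) \<in> vb_charts E" and L: "compact_in (points (base E)) L V"
      using I(2) that unfolding i by auto
    obtain r L' where "0 < r" "compact_in (points (base E)) L' V" "L \<subseteq> L'"
      "\<And>p x. p \<in> L \<Longrightarrow> dist (\<phi> p) x \<le> r \<Longrightarrow> x \<in> \<phi> ` L'"
      "\<forall>\<^sub>F \<epsilon> in at_right 0. ?p \<epsilon> \<in> L \<longrightarrow> ?q \<epsilon> \<in> L' \<and> dist (\<phi> (?p \<epsilon>)) (\<phi> (?q \<epsilon>)) \<le> r"
      "negl_on (\<lambda>\<epsilon>. ?p \<epsilon> \<in> L) (\<lambda>\<epsilon>. dist (\<phi> (?p \<epsilon>)) (\<phi> (?q \<epsilon>)))"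
      by (rule point_close_chart[OF vb_manifold[OF E] gX close vb_chart_base[OF E c] L]) (rule that)
    then have "?Pr (V, \<phi>, \<eta>) L L' r"
      unfolding fst_conv snd_conv by blast
    then show ?thesis
      unfolding i fst_conv snd_conv by blast
  qed
  have "\<forall>i\<in>I. \<exists>x. ?Pr (fst i) (snd i) (fst x) (snd x)"
  proof
    fix i assume "i \<in> I"
    from ex[OF this] obtain L' r where "?Pr (fst i) (snd i) L' r"
      by (elim exE) (rule that)
    then have "?Pr (fst i) (snd i) (fst (L', r)) (snd (L', r))"
      unfolding fst_conv snd_conv .
    then show "\<exists>x. ?Pr (fst i) (snd i) (fst x) (snd x)"
      by (rule exI)
  qed
  from bchoice[OF this] obtain f where f: "\<forall>i\<in>I. ?Pr (fst i) (snd i) (fst (f i)) (snd (f i))"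
    by (elim exE)
  define L' r where "L' i = fst (f i)" and "r i = snd (f i)" for i
  have L': "?Pr (fst i) (snd i) (L' i) (r i)" if "i \<in> I" for i
    using f that unfolding L'_def r_def by (rule bspec)
  \<comment> \<open>Localization is applied to the union of the enlarged sets, not to
    \<open>K\<close>: they contain the base points of \<open>e'\<close> and the balls used in the
    mean value inequality, and all of them have to be mapped into the same target chart.\<close>
  define K' where "K' = (\<Union>i\<in>I. L' i)"
  have "compactin (points (base E)) K'"
    unfolding K'_def using I(1) L' by (intro compactin_Union) (auto simp: compact_in_def)
  then obtain W \<psi> \<theta> M where d: "(W, \<psi>, \<theta>) \<in> vb_charts F" and M: "compact_in (points (base F)) M W" and
    im: "\<forall>\<^sub>F \<epsilon> in at_right 0. \<forall>y\<in>K'. base_map E F (v \<epsilon>) y \<in> M \<and> base_map E F (w \<epsilon>) y \<in> M"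
    by (rule base_localized_pair[OF E F gY v loc vw]) (rule that)
  have local: "negl_on (\<lambda>\<epsilon>. ?p \<epsilon> \<in> snd i) (\<lambda>\<epsilon>. dist (\<psi> (proj F (v \<epsilon> (e \<epsilon>)))) (\<psi> (proj F (w \<epsilon> (e' \<epsilon>)))))
      \<and> negl_on (\<lambda>\<epsilon>. ?p \<epsilon> \<in> snd i) (\<lambda>\<epsilon>. norm (\<theta> (v \<epsilon> (e \<epsilon>)) - \<theta> (w \<epsilon> (e' \<epsilon>))))
      \<and> mod_on (\<lambda>\<epsilon>. ?p \<epsilon> \<in> snd i) (\<lambda>\<epsilon>. norm (\<theta> (v \<epsilon> (e \<epsilon>))))" if i: "i \<in> I" for i
  proof -
    obtain V \<phi> \<eta> L where i_eq: "i = ((V, \<phi>, \<eta>), L)"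
      by (cases i) auto
    have c: "(V, \<phi>, \<eta>) \<in> vb_charts E"
      using I(2) i unfolding i_eq by auto
    have Pr: "?Pr (V, \<phi>, \<eta>) L (L' i) (r i)"
      using L'[OF i] unfolding i_eq by simp
    have im': "\<forall>\<^sub>F \<epsilon> in at_right 0. \<forall>y\<in>L' i. base_map E F (v \<epsilon>) y \<in> M \<and> base_map E F (w \<epsilon>) y \<in> M"
      using im by eventually_elim (use i in \<open>auto simp: K'_def\<close>)
    have Lc: "compact_in (points (base E)) (L' i) V"
      using Pr by simp
    have "\<forall>\<^sub>F \<epsilon> in at_right 0. ?p \<epsilon> \<in> L \<longrightarrow> ?q \<epsilon> \<in> L' i \<and> dist (\<phi> (?p \<epsilon>)) (\<phi> (?q \<epsilon>)) \<le> r i"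
      using Pr by simp
    then have P: "\<forall>\<^sub>F \<epsilon> in at_right 0. ?p \<epsilon> \<in> L \<longrightarrow> ?p \<epsilon> \<in> L' i \<and> ?q \<epsilon> \<in> L' i \<and>
        cball (\<phi> (?p \<epsilon>)) (dist (\<phi> (?p \<epsilon>)) (\<phi> (?q \<epsilon>))) \<subseteq> \<phi> ` L' i"
    proof (eventually_elim, intro impI)
      fix \<epsilon> assume *: "?p \<epsilon> \<in> L \<longrightarrow> ?q \<epsilon> \<in> L' i \<and> dist (\<phi> (?p \<epsilon>)) (\<phi> (?q \<epsilon>)) \<le> r i" and p: "?p \<epsilon> \<in> L"
      have "x \<in> \<phi> ` L' i" if "x \<in> cball (\<phi> (?p \<epsilon>)) (dist (\<phi> (?p \<epsilon>)) (\<phi> (?q \<epsilon>)))" for x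
      proof -
        have "dist (\<phi> (?p \<epsilon>)) x \<le> r i"
          using that * p by (meson mem_cball order_trans)
        then show ?thesis
          using Pr p by simp
      qed
      moreover have "?p \<epsilon> \<in> L' i" "?q \<epsilon> \<in> L' i"
        using Pr p * by auto
      ultimately show "?p \<epsilon> \<in> L' i \<and> ?q \<epsilon> \<in> L' i \<and>
          cball (\<phi> (?p \<epsilon>)) (dist (\<phi> (?p \<epsilon>)) (\<phi> (?q \<epsilon>))) \<subseteq> \<phi> ` L' i"
        by blast
    qed
    have neg: "negl_on (\<lambda>\<epsilon>. ?p \<epsilon> \<in> L) (\<lambda>\<epsilon>. dist (\<phi> (?p \<epsilon>)) (\<phi> (?q \<epsilon>)))"
      using Pr by simp
    show ?thesis
      using hom_values_close_chart[OF E F hE v w vw J c d Lc M im' ee' P neg] unfolding i_eq by simp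
  qed
  have cover: "\<forall>\<^sub>F \<epsilon> in at_right 0. True \<longrightarrow> (\<exists>i\<in>I. ?p \<epsilon> \<in> snd i)"
    using K(2)
  proof eventually_elim
    case (elim \<epsilon>)
    then show ?case
      using I(3)[OF elim] by (auto intro: bexI[rotated])
  qed
  have base: "negl_on (\<lambda>_. True) (\<lambda>\<epsilon>. dist (\<psi> (proj F (v \<epsilon> (e \<epsilon>)))) (\<psi> (proj F (w \<epsilon> (e' \<epsilon>)))))"
    using local by (intro negl_on_finite[OF I(1) cover]) blast
  have fib: "negl_on (\<lambda>_. True) (\<lambda>\<epsilon>. norm (\<theta> (v \<epsilon> (e \<epsilon>)) - \<theta> (w \<epsilon> (e' \<epsilon>))))"
    using local by (intro negl_on_finite[OF I(1) cover]) blast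
  have mod: "mod_on (\<lambda>_. True) (\<lambda>\<epsilon>. norm (\<theta> (v \<epsilon> (e \<epsilon>))))"
    using local by (intro mod_on_finite[OF I(1) cover]) auto
  \<comment> \<open>The second value is moderate because it differs from the first by a negligible
    amount.\<close>
  have mod': "mod_on (\<lambda>_. True) (\<lambda>\<epsilon>. norm (\<theta> (w \<epsilon> (e' \<epsilon>))))"
  proof (rule mod_on_mono[OF mod_on_add[OF mod negl_imp_mod[OF fib]]])
    have "norm b \<le> norm a + norm (a - b)" for a b :: 'f
      using norm_triangle_sub[of b a] by (simp add: norm_minus_commute)
    then show "\<forall>\<^sub>F \<epsilon> in at_right 0. True \<longrightarrow> True \<and> norm (\<theta> (w \<epsilon> (e' \<epsilon>)))
        \<le> norm (\<theta> (v \<epsilon> (e \<epsilon>))) + norm (\<theta> (v \<epsilon> (e \<epsilon>)) - \<theta> (w \<epsilon> (e' \<epsilon>)))"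
      by simp
  qed
  have topv: "v \<epsilon> (e \<epsilon>) \<in> topspace (total F)" "proj F (v \<epsilon> (e \<epsilon>)) = base_map E F (v \<epsilon>) (?p \<epsilon>)" if "\<epsilon> \<in> idx" for \<epsilon>
    using vb_homs_topspace[OF moderate_homs_hom[OF v that] vb_moderate_topspace[OF e(1) that]] by auto
  have topw: "w \<epsilon> (e' \<epsilon>) \<in> topspace (total F)" "proj F (w \<epsilon> (e' \<epsilon>)) = base_map E F (w \<epsilon>) (?q \<epsilon>)" if "\<epsilon> \<in> idx" for \<epsilon>
    using vb_homs_topspace[OF moderate_homs_hom[OF w that] vb_moderate_topspace[OF e(2) that]] by auto
  have "\<forall>\<^sub>F \<epsilon> in at_right 0. \<forall>i\<in>I. ?p \<epsilon> \<in> snd i \<longrightarrow> ?p \<epsilon> \<in> L' i \<and> ?q \<epsilon> \<in> L' i"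
    unfolding eventually_ball_finite_distrib[OF I(1)]
  proof
    fix i assume "i \<in> I"
    then have "snd i \<subseteq> L' i" "\<forall>\<^sub>F \<epsilon> in at_right 0. ?p \<epsilon> \<in> snd i \<longrightarrow> ?q \<epsilon> \<in> L' i \<and>
        dist (fst (snd (fst i)) (?p \<epsilon>)) (fst (snd (fst i)) (?q \<epsilon>)) \<le> r i"
      using L' by blast+
    from this(2) show "\<forall>\<^sub>F \<epsilon> in at_right 0. ?p \<epsilon> \<in> snd i \<longrightarrow> ?p \<epsilon> \<in> L' i \<and> ?q \<epsilon> \<in> L' i"
      by eventually_elim (use \<open>snd i \<subseteq> L' i\<close> in blast)
  qed
  with im cover eventually_idx
  have inM: "\<forall>\<^sub>F \<epsilon> in at_right 0. proj F (v \<epsilon> (e \<epsilon>)) \<in> M \<and> proj F (w \<epsilon> (e' \<epsilon>)) \<in> M"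
  proof eventually_elim
    case (elim \<epsilon>)
    then have "?p \<epsilon> \<in> K'" "?q \<epsilon> \<in> K'"
      unfolding K'_def by blast+
    then show ?case
      using elim(1) topv(2)[OF elim(3)] topw(2)[OF elim(3)] by simp
  qed
  obtain C where C: "0 < C"
    "\<And>z. z \<in> topspace (total F) \<Longrightarrow> proj F z \<in> M \<Longrightarrow> norm (\<theta> z) \<le> C * fiber_norm hF z"
    "\<And>z. z \<in> topspace (total F) \<Longrightarrow> proj F z \<in> M \<Longrightarrow> fiber_norm hF z \<le> C * norm (\<theta> z)"
    by (rule fiber_norm_bounds[OF F hF d M]) (rule that)
  have "compactin (points (base F)) M"
    using M unfolding compact_in_def by simp
  have modF: "f \<in> vb_moderate F hF"
    if "\<And>\<epsilon>. \<epsilon> \<in> idx \<Longrightarrow> f \<epsilon> \<in> topspace (total F)" "\<forall>\<^sub>F \<epsilon> in at_right 0. proj F (f \<epsilon>) \<in> M"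
      "mod_on (\<lambda>_. True) (\<lambda>\<epsilon>. norm (\<theta> (f \<epsilon>)))" for f
    unfolding vb_moderate_iff
  proof (intro conjI ballI that(1) exI[of _ M] that(2))
    have "mod_on (\<lambda>_. True) (\<lambda>\<epsilon>. C * norm (\<theta> (f \<epsilon>)))"
      by (intro mod_on_mult mod_on_const that(3)) simp
    then show "mod_on (\<lambda>_. True) (\<lambda>\<epsilon>. fiber_norm hF (f \<epsilon>))"
    proof (rule mod_on_mono)
      show "\<forall>\<^sub>F \<epsilon> in at_right 0. True \<longrightarrow> True \<and> fiber_norm hF (f \<epsilon>) \<le> C * norm (\<theta> (f \<epsilon>))"
        using that(2) eventually_idx by eventually_elim (use C(3) that(1) in blast)
    qed
  qed (assumption | fact)+
  show modv: "(\<lambda>\<epsilon>. v \<epsilon> (e \<epsilon>)) \<in> vb_moderate F hF"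
  proof (rule modF[OF topv(1) _ mod])
    show "\<forall>\<^sub>F \<epsilon> in at_right 0. proj F (v \<epsilon> (e \<epsilon>)) \<in> M"
      using inM by eventually_elim blast
  qed
  have modw: "(\<lambda>\<epsilon>. w \<epsilon> (e' \<epsilon>)) \<in> vb_moderate F hF"
  proof (rule modF[OF topw(1) _ mod'])
    show "\<forall>\<^sub>F \<epsilon> in at_right 0. proj F (w \<epsilon> (e' \<epsilon>)) \<in> M"
      using inM by eventually_elim blast
  qed
  show "vb_class F gY hF (\<lambda>\<epsilon>. v \<epsilon> (e \<epsilon>)) = vb_class F gY hF (\<lambda>\<epsilon>. w \<epsilon> (e' \<epsilon>))"
    by (rule vb_class_chart_eq[OF F gY hF d M modv modw inM base fib])
qed

lemma homs_equiv_refl: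
  assumes E: "vector_bundle E" and F: "vector_bundle F" and v: "v \<in> moderate_homs E F"
  shows "homs_equiv E F g J v v"
proof -
  have neg0: "negligible_net (\<lambda>\<epsilon>. 0)"
    by (rule negligible_netI[OF negl_on_zero]) simp
  have SUP0: "(SUP a\<in>A. 0 :: ennreal) = 0" for A :: "'s set"
    by (cases "A = {}") (auto simp: bot_ennreal)
  have dist0: "((\<lambda>\<epsilon>. SUP p\<in>K. riem_dist (base F) g (base_map E F (v \<epsilon>) p) (base_map E F (v \<epsilon>) p)) \<longlongrightarrow> 0) (at_right 0)"
    if K: "compactin (points (base E)) K" for K
  proof (rule negligible_net_tendsto, rule negligible_netI[OF negl_on_zero])
    show "\<forall>\<^sub>F \<epsilon> in at_right 0. (SUP p\<in>K. riem_dist (base F) g (base_map E F (v \<epsilon>) p) (base_map E F (v \<epsilon>) p)) \<le> ennreal 0"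
      using eventually_idx
    proof eventually_elim
      case (elim \<epsilon>)
      then show ?case
        using moderate_homs_base_topspace[OF v elim] compactin_subset_topspace[OF K] riem_dist_self[OF vb_manifold[OF F]]
        by (intro SUP_least) (auto simp: subset_iff)
    qed
  qed
  show ?thesis
    unfolding homs_equiv_def maps_equiv_def hom_deriv_norm_def using dist0 neg0
    by (auto simp: deriv_norm_zero SUP0)
qed

text \<open>All localized representatives of the class and all representatives of the point give the
  same class, and \<open>v\<close> and \<open>e\<close> themselves are among them; so the union in
  the definition collapses.\<close>

lemma hom_value_eq:
  fixes E :: "('x, 'a::fin_dim_normed, 'p, 'e::fin_dim_normed, 'k::real_or_complex) vbundle"
    and F :: "('y, 'b::fin_dim_normed, 'q, 'f::fin_dim_normed, 'k) vbundle"
  assumes E: "vector_bundle E" and F: "vector_bundle F"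
    and gX: "riemannian_metric (base E) gX" and gY: "riemannian_metric (base F) gY"
    and hE: "fiber_metric E hE" and hF: "fiber_metric F hF"
    and v: "v \<in> moderate_homs E F" and loc: "base_localized E F v" and e: "e \<in> vb_moderate E hE"
  shows "hom_value E F gY hF (hom_class E F gY v) (vb_class E gX hE e) = vb_class F gY hF (\<lambda>\<epsilon>. v \<epsilon> (e \<epsilon>))"
proof
  show "hom_value E F gY hF (hom_class E F gY v) (vb_class E gX hE e) \<subseteq> vb_class F gY hF (\<lambda>\<epsilon>. v \<epsilon> (e \<epsilon>))"
  proof -
    have "vb_class F gY hF (\<lambda>\<epsilon>. w \<epsilon> (e' \<epsilon>)) = vb_class F gY hF (\<lambda>\<epsilon>. v \<epsilon> (e \<epsilon>))"
      if "w \<in> hom_class E F gY v" "e' \<in> vb_class E gX hE e" for w e'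
    proof -
      have "w \<in> moderate_homs E F" "homs_equiv E F gY UNIV v w" "(e, e') \<in> vb_point_equiv E gX hE"
        using that unfolding hom_class_def vb_equiv_def vb_class_def by auto
      from hom_values_equal(2)[OF E F gX gY hE hF v this(1) loc this(2) UNIV_I this(3)] show ?thesis
        by simp
    qed
    then show ?thesis
      unfolding hom_value_def by blast
  qed
  have "v \<in> hom_class E F gY v" "e \<in> vb_class E gX hE e"
    using v homs_equiv_refl[OF E F v] vb_point_equiv_refl[OF E e]
    unfolding hom_class_def vb_equiv_def vb_class_def by auto
  then show "vb_class F gY hF (\<lambda>\<epsilon>. v \<epsilon> (e \<epsilon>)) \<subseteq> hom_value E F gY hF (hom_class E F gY v) (vb_class E gX hE e)"
    unfolding hom_value_def using loc by blast
qed

section \<open>Homomorphisms detected by their point values\<close>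

lemma vb_zero_moderate:
  assumes E: "vector_bundle E" and h: "fiber_metric E h" and K: "compactin (points (base E)) K"
    and p: "\<And>\<epsilon>. p \<epsilon> \<in> topspace (points (base E))" "\<forall>\<^sub>F \<epsilon> in at_right 0. p \<epsilon> \<in> K"
  shows "(\<lambda>\<epsilon>. vb_zero E (p \<epsilon>)) \<in> vb_moderate E h"
  unfolding vb_moderate_iff
  using vb_zero_props[OF E p(1)] fiber_norm_zero[OF E h p(1)] K p(2) mod_on_const by auto

lemma vb_point_moderate:
  assumes E: "vector_bundle E" and h: "fiber_metric E h" and c: "(V, \<phi>, \<eta>) \<in> vb_charts E"
    and L: "compact_in (points (base E)) L V"
    and p: "\<And>\<epsilon>. p \<epsilon> \<in> L" and \<xi>: "\<And>\<epsilon>. norm (\<xi> \<epsilon>) \<le> 1"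
  shows "(\<lambda>\<epsilon>. vb_point E (V, \<phi>, \<eta>) (\<phi> (p \<epsilon>)) (\<xi> \<epsilon>)) \<in> vb_moderate E h"
proof -
  have "p \<epsilon> \<in> V" for \<epsilon>
    using p L unfolding compact_in_def by blast
  note z = vb_point_props[OF E c this]
  obtain C where C: "0 < C"
    "\<And>z. z \<in> topspace (total E) \<Longrightarrow> proj E z \<in> L \<Longrightarrow> norm (\<eta> z) \<le> C * fiber_norm h z"
    "\<And>z. z \<in> topspace (total E) \<Longrightarrow> proj E z \<in> L \<Longrightarrow> fiber_norm h z \<le> C * norm (\<eta> z)"
    by (rule fiber_norm_bounds[OF E h c L]) (rule that)
  have "fiber_norm h (vb_point E (V, \<phi>, \<eta>) (\<phi> (p \<epsilon>)) (\<xi> \<epsilon>)) \<le> C" for \<epsilon>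
  proof -
    have "fiber_norm h (vb_point E (V, \<phi>, \<eta>) (\<phi> (p \<epsilon>)) (\<xi> \<epsilon>)) \<le> C * norm (\<xi> \<epsilon>)"
      using C(3)[OF z(1)[of \<epsilon> "\<xi> \<epsilon>"]] z(2,3)[of \<epsilon> "\<xi> \<epsilon>"] p[of \<epsilon>] by simp
    also have "\<dots> \<le> C * 1"
      using \<xi> C(1) by (intro mult_left_mono) auto
    finally show ?thesis
      by simp
  qed
  then have "mod_on (\<lambda>_. True) (\<lambda>\<epsilon>. fiber_norm h (vb_point E (V, \<phi>, \<eta>) (\<phi> (p \<epsilon>)) (\<xi> \<epsilon>)))"
    by (intro mod_on_mono[OF mod_on_const[of "\<lambda>_. True" C]]) auto
  then show ?thesis
    unfolding vb_moderate_iff using z p L unfolding compact_in_def by auto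
qed

text \<open>Selected nets are turned into generalized bundle points. The conditions on base maps are
  tested on zero vectors, which need no trivialization over the chart at hand; the fiber condition
  is tested on vectors with coordinates in the unit ball, which are bounded over a compact set and
  hence moderate.\<close>

lemma vb_point_equiv_imp_homs_equiv:
  fixes E :: "('x, 'a::fin_dim_normed, 'p, 'e::fin_dim_normed, 'k::real_or_complex) vbundle"
    and F :: "('y, 'b::fin_dim_normed, 'q, 'f::fin_dim_normed, 'k) vbundle"
  assumes E: "vector_bundle E" and F: "vector_bundle F"
    and gY: "riemannian_metric (base F) gY" and hE: "fiber_metric E hE"
    and equiv: "\<And>e. e \<in> vb_moderate E hE \<Longrightarrow>
      ((\<lambda>\<epsilon>. v \<epsilon> (e \<epsilon>)), (\<lambda>\<epsilon>. w \<epsilon> (e \<epsilon>))) \<in> vb_point_equiv F gY hF"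
    and v: "v \<in> moderate_homs E F" and w: "w \<in> moderate_homs E F"
  shows "homs_equiv E F gY {0} v w"
proof -
  let ?b = "\<lambda>\<epsilon>. base_map E F (v \<epsilon>)" and ?b' = "\<lambda>\<epsilon>. base_map E F (w \<epsilon>)"
  have close: "point_close (base F) gY (\<lambda>\<epsilon>. ?b \<epsilon> (p \<epsilon>)) (\<lambda>\<epsilon>. ?b' \<epsilon> (p \<epsilon>))"
    if K: "compactin (points (base E)) K" and p: "\<And>\<epsilon>. p \<epsilon> \<in> K" for K p
  proof -
    have "p \<epsilon> \<in> topspace (points (base E))" for \<epsilon>
      using compactin_subset_topspace[OF K] p by blast
    from equiv[OF vb_zero_moderate[OF E hE K this]] p show ?thesis
      unfolding vb_point_equiv_iff base_map_def by simp
  qed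
  have "((\<lambda>\<epsilon>. SUP p\<in>K. riem_dist (base F) gY (?b \<epsilon> p) (?b' \<epsilon> p)) \<longlongrightarrow> 0) (at_right 0)"
    if K: "compactin (points (base E)) K" for K
  proof (rule negligible_net_tendsto, rule negligible_net_SUP)
    fix a assume a: "\<And>\<epsilon>::real. K \<noteq> {} \<Longrightarrow> a \<epsilon> \<in> K"
    show "\<exists>r. negl_on (\<lambda>\<epsilon>. K \<noteq> {}) r \<and> (\<forall>\<^sub>F \<epsilon> in at_right 0. K \<noteq> {} \<longrightarrow>
        riem_dist (base F) gY (?b \<epsilon> (a \<epsilon>)) (?b' \<epsilon> (a \<epsilon>)) \<le> ennreal (r \<epsilon>))"
    proof (cases "K = {}")
      case True
      then show ?thesis
        using negl_on_zero by auto
    next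
      case False
      then obtain r where r: "negl_on (\<lambda>_. True) r" "\<And>\<epsilon>. 0 \<le> r \<epsilon>"
        "\<forall>\<^sub>F \<epsilon> in at_right 0. riem_dist (base F) gY (?b \<epsilon> (a \<epsilon>)) (?b' \<epsilon> (a \<epsilon>)) \<le> ennreal (r \<epsilon>)"
        using negligible_bound[OF close[OF K, of a, unfolded point_close_def]] a by blast
      then show ?thesis
        using False by auto
    qed
  qed
  moreover have "negligible_net (\<lambda>\<epsilon>. SUP p \<in> L \<inter> ?b \<epsilon> -` L' \<inter> ?b' \<epsilon> -` L'.
      deriv_norm 0 (\<lambda>x. (\<psi> \<circ> ?b \<epsilon> \<circ> inv_into V \<phi>) x - (\<psi> \<circ> ?b' \<epsilon> \<circ> inv_into V \<phi>) x) (\<phi> p))"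
    if c: "(V, \<phi>) \<in> charts (base E)" and d: "(W, \<psi>) \<in> charts (base F)"
      and L: "compact_in (points (base E)) L V" and L': "compact_in (points (base F)) L' W" for V \<phi> W \<psi> L L'
  proof (rule negligible_net_SUP)
    let ?A = "\<lambda>\<epsilon>. L \<inter> ?b \<epsilon> -` L' \<inter> ?b' \<epsilon> -` L'"
    let ?f = "\<lambda>\<epsilon> x. (\<psi> \<circ> ?b \<epsilon> \<circ> inv_into V \<phi>) x - (\<psi> \<circ> ?b' \<epsilon> \<circ> inv_into V \<phi>) x"
    fix a assume a: "\<And>\<epsilon>. ?A \<epsilon> \<noteq> {} \<Longrightarrow> a \<epsilon> \<in> ?A \<epsilon>"
    show "\<exists>r. negl_on (\<lambda>\<epsilon>. ?A \<epsilon> \<noteq> {}) r \<and> (\<forall>\<^sub>F \<epsilon> in at_right 0. ?A \<epsilon> \<noteq> {} \<longrightarrow>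
        deriv_norm 0 (?f \<epsilon>) (\<phi> (a \<epsilon>)) \<le> ennreal (r \<epsilon>))"
    proof (cases "L = {}")
      case True
      then show ?thesis
        using negl_on_zero by auto
    next
      case False
      then obtain p0 where "p0 \<in> L"
        by blast
      \<comment> \<open>The selection is specified only where \<open>?A \<epsilon>\<close> is
        nonempty, whereas a test net needs a point of \<open>L\<close> at every \<epsilon>;
        \<open>p0\<close> fills the gaps, and the conclusion is used only where no gap was
        filled.\<close>
      define p where "p \<epsilon> = (if ?A \<epsilon> = {} then p0 else a \<epsilon>)" for \<epsilon>
      have pL: "p \<epsilon> \<in> L" for \<epsilon>
        using a[of \<epsilon>] \<open>p0 \<in> L\<close> unfolding p_def by auto
      have pA: "?A \<epsilon> \<noteq> {} \<Longrightarrow> p \<epsilon> = a \<epsilon> \<and> ?b \<epsilon> (p \<epsilon>) \<in> L'" for \<epsilon>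
        using a[of \<epsilon>] unfolding p_def by auto
      have "compactin (points (base E)) L"
        using L unfolding compact_in_def by simp
      note cl = close[OF this pL]
      \<comment> \<open>Coordinate closeness is obtained for all \<epsilon> at which the first base
        value is in \<open>L'\<close>; the set of \<epsilon> with \<open>?A \<epsilon>\<close>
        nonempty is contained in this.\<close>
      have neg: "negl_on (\<lambda>\<epsilon>. ?b \<epsilon> (p \<epsilon>) \<in> L') (\<lambda>\<epsilon>. dist (\<psi> (?b \<epsilon> (p \<epsilon>))) (\<psi> (?b' \<epsilon> (p \<epsilon>))))"
        by (rule point_close_chart[OF vb_manifold[OF F] gY cl d L'])
      have "negl_on (\<lambda>\<epsilon>. ?A \<epsilon> \<noteq> {}) (\<lambda>\<epsilon>. dist (\<psi> (?b \<epsilon> (p \<epsilon>))) (\<psi> (?b' \<epsilon> (p \<epsilon>))))"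
        by (rule negl_on_mono[OF neg], intro always_eventually allI impI conjI order_refl)
          (use pA in blast)
      moreover have "deriv_norm 0 (?f \<epsilon>) (\<phi> (a \<epsilon>)) \<le> ennreal (dist (\<psi> (?b \<epsilon> (p \<epsilon>))) (\<psi> (?b' \<epsilon> (p \<epsilon>))))"
        if "?A \<epsilon> \<noteq> {}" for \<epsilon>
      proof -
        have "inv_into V \<phi> (\<phi> (p \<epsilon>)) = p \<epsilon>"
          using is_chart_inv[OF smooth_manifold_chart[OF vb_manifold[OF E] c]] pL L
          unfolding compact_in_def by blast
        then show ?thesis
          using pA[OF that] by (simp add: deriv_norm_0 dist_norm)
      qed
      ultimately show ?thesis
        by (intro exI[of _ "\<lambda>\<epsilon>. dist (\<psi> (?b \<epsilon> (p \<epsilon>))) (\<psi> (?b' \<epsilon> (p \<epsilon>)))"] conjI always_eventually) auto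
    qed
  qed
  moreover have "negligible_net (\<lambda>\<epsilon>. SUP p \<in> L \<inter> ?b \<epsilon> -` L' \<inter> ?b' \<epsilon> -` L'.
      hom_deriv_norm 0 (\<lambda>x \<xi>. hom_rep E F (V, \<phi>, \<eta>) (W, \<psi>, \<theta>) (v \<epsilon>) x \<xi>
        - hom_rep E F (V, \<phi>, \<eta>) (W, \<psi>, \<theta>) (w \<epsilon>) x \<xi>) (\<phi> p))"
    if c: "(V, \<phi>, \<eta>) \<in> vb_charts E" and d: "(W, \<psi>, \<theta>) \<in> vb_charts F"
      and L: "compact_in (points (base E)) L V" and L': "compact_in (points (base F)) L' W"
    for V \<phi> \<eta> W \<psi> \<theta> L L'
  proof -
    \<comment> \<open>The operator norm is itself a supremum over the unit ball. Merging it with the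
      supremum over points into one over pairs lets a single selection choose base point and vector
      together.\<close>
    let ?A = "\<lambda>\<epsilon>. (L \<inter> ?b \<epsilon> -` L' \<inter> ?b' \<epsilon> -` L') \<times> {\<xi>::'e. norm \<xi> \<le> 1}"
    let ?z = "\<lambda>y. vb_point E (V, \<phi>, \<eta>) (\<phi> (fst y)) (snd y)"
    let ?g = "\<lambda>\<epsilon> y. ennreal (norm (\<theta> (v \<epsilon> (?z y)) - \<theta> (w \<epsilon> (?z y))))"
    have "negligible_net (\<lambda>\<epsilon>. SUP y \<in> ?A \<epsilon>. ?g \<epsilon> y)"
    proof (rule negligible_net_SUP)
      fix a assume a: "\<And>\<epsilon>. ?A \<epsilon> \<noteq> {} \<Longrightarrow> a \<epsilon> \<in> ?A \<epsilon>"
      show "\<exists>r. negl_on (\<lambda>\<epsilon>. ?A \<epsilon> \<noteq> {}) r \<and> (\<forall>\<^sub>F \<epsilon> in at_right 0. ?A \<epsilon> \<noteq> {} \<longrightarrow>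
          ?g \<epsilon> (a \<epsilon>) \<le> ennreal (r \<epsilon>))"
      proof (cases "L = {}")
        case True
        then show ?thesis
          using negl_on_zero by auto
      next
        case False
        then obtain p0 where "p0 \<in> L"
          by blast
        define y where "y \<epsilon> = (if ?A \<epsilon> = {} then (p0, 0) else a \<epsilon>)" for \<epsilon>
        have yA: "y \<epsilon> = a \<epsilon>" "?b \<epsilon> (fst (y \<epsilon>)) \<in> L'" "?b' \<epsilon> (fst (y \<epsilon>)) \<in> L'" if "?A \<epsilon> \<noteq> {}" for \<epsilon>
          using a[OF that] that unfolding y_def by auto
        have yL: "fst (y \<epsilon>) \<in> L" "norm (snd (y \<epsilon>)) \<le> 1" for \<epsilon>
          using a[of \<epsilon>] \<open>p0 \<in> L\<close> unfolding y_def by (cases "?A \<epsilon> = {}"; auto)+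
        define e where "e \<epsilon> = ?z (y \<epsilon>)" for \<epsilon>
        have e: "e \<in> vb_moderate E hE"
          unfolding e_def[abs_def] by (rule vb_point_moderate[OF E hE c L yL])
        have pe: "proj E (e \<epsilon>) = fst (y \<epsilon>)" for \<epsilon>
          unfolding e_def using vb_point_props(2)[OF E c] yL(1) L unfolding compact_in_def by blast
        have neg: "negl_on (\<lambda>\<epsilon>. proj F (v \<epsilon> (e \<epsilon>)) \<in> L' \<and> proj F (w \<epsilon> (e \<epsilon>)) \<in> L')
            (\<lambda>\<epsilon>. norm (\<theta> (v \<epsilon> (e \<epsilon>)) - \<theta> (w \<epsilon> (e \<epsilon>))))"
          using equiv[OF e] d L' unfolding vb_point_equiv_iff by blast
        have "negl_on (\<lambda>\<epsilon>. ?A \<epsilon> \<noteq> {}) (\<lambda>\<epsilon>. norm (\<theta> (v \<epsilon> (e \<epsilon>)) - \<theta> (w \<epsilon> (e \<epsilon>))))"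
        proof (rule negl_on_mono[OF neg])
          show "\<forall>\<^sub>F \<epsilon> in at_right 0. ?A \<epsilon> \<noteq> {} \<longrightarrow>
              (proj F (v \<epsilon> (e \<epsilon>)) \<in> L' \<and> proj F (w \<epsilon> (e \<epsilon>)) \<in> L') \<and>
              norm (\<theta> (v \<epsilon> (e \<epsilon>)) - \<theta> (w \<epsilon> (e \<epsilon>))) \<le> norm (\<theta> (v \<epsilon> (e \<epsilon>)) - \<theta> (w \<epsilon> (e \<epsilon>)))"
            using eventually_idx
          proof (eventually_elim, intro impI conjI order_refl)
            fix \<epsilon> assume \<epsilon>: "\<epsilon> \<in> idx" and A: "?A \<epsilon> \<noteq> {}"
            show "proj F (v \<epsilon> (e \<epsilon>)) \<in> L'" "proj F (w \<epsilon> (e \<epsilon>)) \<in> L'"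
              using vb_homs_topspace(2)[OF moderate_homs_hom[OF v \<epsilon>] vb_moderate_topspace[OF e \<epsilon>]]
                vb_homs_topspace(2)[OF moderate_homs_hom[OF w \<epsilon>] vb_moderate_topspace[OF e \<epsilon>]]
                yA(2,3)[OF A] pe by simp_all
          qed
        qed
        moreover have "?g \<epsilon> (a \<epsilon>) \<le> ennreal (norm (\<theta> (v \<epsilon> (e \<epsilon>)) - \<theta> (w \<epsilon> (e \<epsilon>))))"
          if "?A \<epsilon> \<noteq> {}" for \<epsilon>
          using yA(1)[OF that] by (simp add: e_def)
        ultimately show ?thesis
          by (intro exI[of _ "\<lambda>\<epsilon>. norm (\<theta> (v \<epsilon> (e \<epsilon>)) - \<theta> (w \<epsilon> (e \<epsilon>)))"] conjI always_eventually) blast+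
      qed
    qed
    then show ?thesis
    proof (rule negligible_net_mono)
      fix \<epsilon>
      show "(SUP p \<in> L \<inter> ?b \<epsilon> -` L' \<inter> ?b' \<epsilon> -` L'.
          hom_deriv_norm 0 (\<lambda>x \<xi>. hom_rep E F (V, \<phi>, \<eta>) (W, \<psi>, \<theta>) (v \<epsilon>) x \<xi>
            - hom_rep E F (V, \<phi>, \<eta>) (W, \<psi>, \<theta>) (w \<epsilon>) x \<xi>) (\<phi> p)) \<le> (SUP y \<in> ?A \<epsilon>. ?g \<epsilon> y)"
        unfolding hom_deriv_norm_def deriv_norm_0
      proof (intro SUP_least)
        fix p and \<xi> :: 'e assume "p \<in> L \<inter> ?b \<epsilon> -` L' \<inter> ?b' \<epsilon> -` L'" "\<xi> \<in> {\<xi>. norm \<xi> \<le> 1}"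
        then have "(p, \<xi>) \<in> ?A \<epsilon>"
          by simp
        from SUP_upper[OF this, of "?g \<epsilon>"]
        show "ennreal (norm (hom_rep E F (V, \<phi>, \<eta>) (W, \<psi>, \<theta>) (v \<epsilon>) (\<phi> p) \<xi>
            - hom_rep E F (V, \<phi>, \<eta>) (W, \<psi>, \<theta>) (w \<epsilon>) (\<phi> p) \<xi>)) \<le> (SUP y \<in> ?A \<epsilon>. ?g \<epsilon> y)"
          unfolding hom_rep_def by simp
      qed
    qed
  qed
  ultimately show ?thesis
    unfolding homs_equiv_def maps_equiv_def by auto
qed

lemma homs_equiv_iff_hom_values:
  fixes E :: "('x, 'a::fin_dim_normed, 'p, 'e::fin_dim_normed, 'k::real_or_complex) vbundle"
    and F :: "('y, 'b::fin_dim_normed, 'q, 'f::fin_dim_normed, 'k) vbundle"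
  assumes E: "vector_bundle E" and F: "vector_bundle F"
    and gX: "riemannian_metric (base E) gX" and gY: "riemannian_metric (base F) gY"
    and hE: "fiber_metric E hE" and hF: "fiber_metric F hF"
    and v: "v \<in> moderate_homs E F" and v': "v' \<in> moderate_homs E F"
    and loc: "base_localized E F v" and loc': "base_localized E F v'"
  shows "homs_equiv E F gY {0} v v' \<longleftrightarrow> (\<forall>e \<in> gen_vb_points E gX hE.
    hom_value E F gY hF (hom_class E F gY v) e = hom_value E F gY hF (hom_class E F gY v') e)"
proof -
  have "(\<forall>e \<in> gen_vb_points E gX hE.
      hom_value E F gY hF (hom_class E F gY v) e = hom_value E F gY hF (hom_class E F gY v') e)
    \<longleftrightarrow> (\<forall>e \<in> vb_moderate E hE. vb_class F gY hF (\<lambda>\<epsilon>. v \<epsilon> (e \<epsilon>)) = vb_class F gY hF (\<lambda>\<epsilon>. v' \<epsilon> (e \<epsilon>)))"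
    unfolding gen_vb_points_def quotient_def
    using hom_value_eq[OF E F gX gY hE hF v loc] hom_value_eq[OF E F gX gY hE hF v' loc']
    by (simp add: vb_class_def)
  also have "\<dots> \<longleftrightarrow> homs_equiv E F gY {0} v v'"
  proof
    assume *: "homs_equiv E F gY {0} v v'"
    show "\<forall>e \<in> vb_moderate E hE. vb_class F gY hF (\<lambda>\<epsilon>. v \<epsilon> (e \<epsilon>)) = vb_class F gY hF (\<lambda>\<epsilon>. v' \<epsilon> (e \<epsilon>))"
      using hom_values_equal(2)[OF E F gX gY hE hF v v' loc * _ vb_point_equiv_refl[OF E]] by blast
  next
    assume *: "\<forall>e \<in> vb_moderate E hE. vb_class F gY hF (\<lambda>\<epsilon>. v \<epsilon> (e \<epsilon>)) = vb_class F gY hF (\<lambda>\<epsilon>. v' \<epsilon> (e \<epsilon>))"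
    show "homs_equiv E F gY {0} v v'"
    proof (rule vb_point_equiv_imp_homs_equiv[OF E F gY hE _ v v'])
      fix e assume e: "e \<in> vb_moderate E hE"
      \<comment> \<open>Equal classes give equivalent representatives through reflexivity, which
        holds for moderate nets only; the localization of \<open>v'\<close> makes its values
        moderate.\<close>
      have "(\<lambda>\<epsilon>. v' \<epsilon> (e \<epsilon>)) \<in> vb_moderate F hF"
        by (rule hom_values_equal(1)[OF E F gX gY hE hF v' v' loc' homs_equiv_refl[OF E F v', of _ UNIV] UNIV_I
              vb_point_equiv_refl[OF E e]])
      from vb_point_equiv_refl[OF F this]
      have "(\<lambda>\<epsilon>. v' \<epsilon> (e \<epsilon>)) \<in> vb_class F gY hF (\<lambda>\<epsilon>. v' \<epsilon> (e \<epsilon>))"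
        unfolding vb_class_def by simp
      also have "\<dots> = vb_class F gY hF (\<lambda>\<epsilon>. v \<epsilon> (e \<epsilon>))"
        using * e by simp
      finally show "((\<lambda>\<epsilon>. v \<epsilon> (e \<epsilon>)), (\<lambda>\<epsilon>. v' \<epsilon> (e \<epsilon>))) \<in> vb_point_equiv F gY hF"
        unfolding vb_class_def by simp
    qed
  qed
  finally show ?thesis
    by simp
qed

section \<open>Generalized sections\<close>

text \<open>A relation between three maps, constraining them only over the base space and through
  charts. It can be rearranged, as in \<open>section_diff_undo\<close>, and passes through
  differential operators, whereas \<open>vb_minus\<close> would have to be unfolded each
  time.\<close>

definition section_diff ::
  "('x, 'a::fin_dim_normed, 'p, 'e::fin_dim_normed, 'k) vbundle
    \<Rightarrow> ('x \<Rightarrow> 'p) \<Rightarrow> ('x \<Rightarrow> 'p) \<Rightarrow> ('x \<Rightarrow> 'p) \<Rightarrow> bool" where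
  "section_diff E r s t \<longleftrightarrow> (\<forall>p\<in>topspace (points (base E)).
     r p \<in> topspace (total E) \<and> proj E (r p) = p \<and>
     (\<forall>V \<phi> \<eta>. (V, \<phi>, \<eta>) \<in> vb_charts E \<longrightarrow> p \<in> V \<longrightarrow> \<eta> (r p) = \<eta> (s p) - \<eta> (t p)))"

lemma section_diffD:
  assumes "section_diff E r s t" and "p \<in> topspace (points (base E))"
  shows "r p \<in> topspace (total E)" "proj E (r p) = p"
    "\<And>V \<phi> \<eta>. (V, \<phi>, \<eta>) \<in> vb_charts E \<Longrightarrow> p \<in> V \<Longrightarrow> \<eta> (r p) = \<eta> (s p) - \<eta> (t p)"
  using assms unfolding section_diff_def by blast+

lemma sectionD:
  assumes "s \<in> sections E" and "p \<in> topspace (points (base E))"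
  shows "s p \<in> topspace (total E)" "proj E (s p) = p"
  using assms smooth_map_topspace[of "points (base E)" _ "total E" _ s p] unfolding sections_def by blast+

lemma section_smooth:
  assumes E: "vector_bundle E" and s: "s \<in> sections E"
    and c: "(V, \<phi>) \<in> charts (base E)" and d: "(W, \<psi>, \<theta>) \<in> vb_charts E"
  shows "smooth_on (\<phi> ` (V \<inter> W)) ((\<lambda>z. (\<psi> (proj E z), \<theta> z)) \<circ> s \<circ> inv_into V \<phi>)"
proof -
  have "smooth_map (points (base E)) (charts (base E)) (total E) (total_charts E) s"
    using s unfolding sections_def by blast
  moreover have "(over E W, \<lambda>z. (\<psi> (proj E z), \<theta> z)) \<in> total_charts E"
    using d by (auto simp: total_chart_def intro!: rev_image_eqI)
  ultimately have "smooth_on (\<phi> ` (V \<inter> s -` over E W)) ((\<lambda>z. (\<psi> (proj E z), \<theta> z)) \<circ> s \<circ> inv_into V \<phi>)"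
    using c unfolding smooth_map_def by fast
  moreover have "V \<inter> s -` over E W = V \<inter> W"
    using sectionD[OF s] is_chart_subset[OF smooth_manifold_chart[OF vb_manifold[OF E] c]]
    unfolding over_def by auto
  ultimately show ?thesis
    by simp
qed

lemma section_component_smooth:
  assumes E: "vector_bundle E" and s: "s \<in> sections E" and c: "(V, \<phi>, \<eta>) \<in> vb_charts E"
  shows "open (\<phi> ` V)" "smooth_on (\<phi> ` V) (\<eta> \<circ> s \<circ> inv_into V \<phi>)"
proof -
  show op: "open (\<phi> ` V)"
    using vb_chart_is_chart[OF E c] unfolding is_chart_def by simp
  have "smooth_on (\<phi> ` V) ((\<lambda>z. (\<phi> (proj E z), \<eta> z)) \<circ> s \<circ> inv_into V \<phi>)"
    using section_smooth[OF E s vb_chart_base[OF E c] c] by simp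
  from smooth_on_bounded_linear[OF bounded_linear_snd op this]
  show "smooth_on (\<phi> ` V) (\<eta> \<circ> s \<circ> inv_into V \<phi>)"
    by (simp add: o_def)
qed

text \<open>Continuity is part of \<open>smooth_map\<close>, but over a bundle chart it follows from
  continuity of the coordinate expression; the pasting lemma over the open chart domains then yields
  global continuity.\<close>

lemma sectionI:
  assumes E: "vector_bundle E"
    and r: "\<And>p. p \<in> topspace (points (base E)) \<Longrightarrow> r p \<in> topspace (total E) \<and> proj E (r p) = p"
    and smooth: "\<And>V \<phi> W \<psi> \<theta>. (V, \<phi>) \<in> charts (base E) \<Longrightarrow> (W, \<psi>, \<theta>) \<in> vb_charts E \<Longrightarrow>
      smooth_on (\<phi> ` (V \<inter> W)) ((\<lambda>z. (\<psi> (proj E z), \<theta> z)) \<circ> r \<circ> inv_into V \<phi>)"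
  shows "r \<in> sections E"
proof -
  let ?X = "points (base E)"
  have "continuous_map ?X (total E) r"
  proof (rule pasting_lemma[of "vb_charts E" ?X fst "total E" "\<lambda>_. r"])
    fix c assume "c \<in> vb_charts E"
    then obtain W \<psi> \<theta> where c: "c = (W, \<psi>, \<theta>)" "(W, \<psi>, \<theta>) \<in> vb_charts E"
      by (cases c) auto
    let ?\<Psi> = "\<lambda>z. (\<psi> (proj E z), \<theta> z)"
    note ch = vb_chart_is_chart[OF E c(2)]
    show "openin ?X (fst c)"
      using is_chart_open[OF ch] c by simp
    have WX: "W \<subseteq> topspace ?X"
      using is_chart_subset[OF ch] .
    have rW: "r p \<in> over E W" if "p \<in> W" for p
      using r[of p] that WX unfolding over_def by auto
    have "continuous_on (\<psi> ` W) (?\<Psi> \<circ> r \<circ> inv_into W \<psi>)"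
      using smooth_on_continuous[OF smooth[OF vb_chart_base[OF E c(2)] c(2)]] by simp
    then have "continuous_map (top_of_set (\<psi> ` W)) (top_of_set (?\<Psi> ` over E W)) (?\<Psi> \<circ> r \<circ> inv_into W \<psi>)"
      using rW is_chart_inv[OF ch] by auto
    moreover have "continuous_map (subtopology ?X W) (top_of_set (\<psi> ` W)) \<psi>"
      using is_chart_continuous[OF ch] WX by (auto simp: continuous_map_in_subtopology)
    \<comment> \<open>Over \<open>W\<close> the map is recovered by passing to coordinates of the
      base, applying the local expression and returning by the inverse of the chart of the total
      space.\<close>
    ultimately have "continuous_map (subtopology ?X W) (top_of_set (?\<Psi> ` over E W)) ((?\<Psi> \<circ> r \<circ> inv_into W \<psi>) \<circ> \<psi>)"
      using continuous_map_compose by blast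
    from continuous_map_compose[OF this is_chart_continuous_inv[OF vb_chart_total(1)[OF E c(2)]]]
    have "continuous_map (subtopology ?X W) (total E)
        (inv_into (over E W) ?\<Psi> \<circ> ((?\<Psi> \<circ> r \<circ> inv_into W \<psi>) \<circ> \<psi>))" .
    then have "continuous_map (subtopology ?X W) (total E) r"
    proof (rule continuous_map_eq)
      fix p assume "p \<in> topspace (subtopology ?X W)"
      then show "(inv_into (over E W) ?\<Psi> \<circ> ((?\<Psi> \<circ> r \<circ> inv_into W \<psi>) \<circ> \<psi>)) p = r p"
        using is_chart_inv[OF ch] is_chart_inv[OF vb_chart_total(1)[OF E c(2)] rW] by simp
    qed
    then show "continuous_map (subtopology ?X (fst c)) (total E) r"
      using c(1) by simp
  next
    fix p assume "p \<in> topspace ?X"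
    then show "\<exists>c. c \<in> vb_charts E \<and> p \<in> fst c \<and> r p = r p"
      using vb_covered[OF E] by force
  qed simp
  moreover have "smooth_on (\<phi> ` (V \<inter> r -` C)) (\<rho> \<circ> r \<circ> inv_into V \<phi>)"
    if V: "(V, \<phi>) \<in> charts (base E)" and tc: "(C, \<rho>) \<in> total_charts E" for V \<phi> C \<rho>
  proof -
    obtain W \<psi> \<theta> where d: "(W, \<psi>, \<theta>) \<in> vb_charts E" and
      C: "C = over E W" "\<rho> = (\<lambda>z. (\<psi> (proj E z), \<theta> z))"
      using tc unfolding total_chart_def by auto
    have "V \<inter> r -` C = V \<inter> W"
      using r is_chart_subset[OF smooth_manifold_chart[OF vb_manifold[OF E] V]]
      unfolding C over_def by auto
    then show ?thesis
      using smooth[OF V d] unfolding C by simp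
  qed
  ultimately show ?thesis
    using r unfolding sections_def smooth_map_def by blast
qed

lemma section_diff_section:
  assumes E: "vector_bundle E" and s: "s \<in> sections E" and t: "t \<in> sections E"
    and r: "section_diff E r s t"
  shows "r \<in> sections E"
proof (rule sectionI[OF E])
  show "r p \<in> topspace (total E) \<and> proj E (r p) = p" if "p \<in> topspace (points (base E))" for p
    using section_diffD[OF r that] by blast
  fix V \<phi> W \<psi> \<theta> assume V: "(V, \<phi>) \<in> charts (base E)" and d: "(W, \<psi>, \<theta>) \<in> vb_charts E"
  let ?\<Psi> = "\<lambda>z. (\<psi> (proj E z), \<theta> z)"
  note chV = smooth_manifold_chart[OF vb_manifold[OF E] V]
  have op: "open (\<phi> ` (V \<inter> W))"
    using is_chart_open_image[OF chV] is_chart_open[OF vb_chart_is_chart[OF E d]] .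
  \<comment> \<open>The chart of the total space also records the base coordinate, which must
    survive the subtraction; so the base part of the second section is first replaced by 0.\<close>
  have "bounded_linear (\<lambda>y. (0, snd y))"
    by (intro bounded_linear_Pair bounded_linear_zero bounded_linear_snd)
  from smooth_on_diff[OF op section_smooth[OF E s V d]
      smooth_on_bounded_linear[OF this op section_smooth[OF E t V d]]]
  show "smooth_on (\<phi> ` (V \<inter> W)) (?\<Psi> \<circ> r \<circ> inv_into V \<phi>)"
  proof (rule smooth_on_cong[OF op, rotated])
    fix x assume "x \<in> \<phi> ` (V \<inter> W)"
    then obtain p where p: "p \<in> V" "p \<in> W" "x = \<phi> p"
      by blast
    have "p \<in> topspace (points (base E))"
      using is_chart_subset[OF chV] p(1) by blast
    then show "(?\<Psi> \<circ> s \<circ> inv_into V \<phi>) x - (0, snd ((?\<Psi> \<circ> t \<circ> inv_into V \<phi>) x)) = (?\<Psi> \<circ> r \<circ> inv_into V \<phi>) x"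
      using section_diffD[OF r] sectionD[OF s] d p is_chart_inv[OF chV p(1)] by simp
  qed
qed

text \<open>Additivity of \<open>P\<close> comes from its local form: iterated derivatives respect
  differences of smooth functions and the coefficients are linear. The sections involved are
  compared in each bundle chart separately.\<close>

lemma section_diff_operator:
  assumes E: "vector_bundle E" and P: "P \<in> diff_operators E"
    and s: "s \<in> sections E" and t: "t \<in> sections E" and r: "section_diff E r s t"
  shows "section_diff E (P r) (P s) (P t)"
  unfolding section_diff_def
proof (intro ballI conjI allI impI)
  fix p assume p: "p \<in> topspace (points (base E))"
  have rs: "r \<in> sections E"
    by (rule section_diff_section[OF E s t r])
  then have "P r \<in> sections E"
    using P unfolding diff_operators_def by blast
  from sectionD[OF this p] show "P r p \<in> topspace (total E)" "proj E (P r p) = p" .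
  fix V \<phi> \<eta> assume c: "(V, \<phi>, \<eta>) \<in> vb_charts E" and pV: "p \<in> V"
  obtain k where "\<forall>(V, \<phi>, \<eta>)\<in>vb_charts E. \<exists>D a. finite D \<and> (\<forall>vs\<in>D. length vs \<le> k) \<and>
      (\<forall>vs\<in>D. (\<forall>x\<in>\<phi> ` V. Vector_Spaces.linear (smul E) (smul E) (a vs x)) \<and>
              (\<forall>\<xi>. smooth_on (\<phi> ` V) (\<lambda>x. a vs x \<xi>))) \<and>
      (\<forall>s\<in>sections E. \<forall>p\<in>V.
         \<eta> (P s p) = (\<Sum>vs\<in>D. a vs (\<phi> p) (iter_deriv (\<eta> \<circ> s \<circ> inv_into V \<phi>) vs (\<phi> p))))"
    using P unfolding diff_operators_def by blast
  from bspec[OF this c, unfolded prod.case] obtain D a where Da: "finite D \<and> (\<forall>vs\<in>D. length vs \<le> k) \<and>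
      (\<forall>vs\<in>D. (\<forall>x\<in>\<phi> ` V. Vector_Spaces.linear (smul E) (smul E) (a vs x)) \<and>
              (\<forall>\<xi>. smooth_on (\<phi> ` V) (\<lambda>x. a vs x \<xi>))) \<and>
      (\<forall>s\<in>sections E. \<forall>p\<in>V.
         \<eta> (P s p) = (\<Sum>vs\<in>D. a vs (\<phi> p) (iter_deriv (\<eta> \<circ> s \<circ> inv_into V \<phi>) vs (\<phi> p))))"
    by (elim exE) (rule that)
  have lin: "Vector_Spaces.linear (smul E) (smul E) (a vs (\<phi> p))" if "vs \<in> D" for vs
    using Da that pV by simp
  have eq: "\<eta> (P s p) = (\<Sum>vs\<in>D. a vs (\<phi> p) (iter_deriv (\<eta> \<circ> s \<circ> inv_into V \<phi>) vs (\<phi> p)))"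
    if "s \<in> sections E" for s
    using Da that pV by simp
  note S = section_component_smooth[OF E s c] section_component_smooth(2)[OF E t c]
  note inv = is_chart_inv[OF vb_chart_is_chart[OF E c]]
  have comp: "(\<eta> \<circ> r \<circ> inv_into V \<phi>) x = (\<eta> \<circ> s \<circ> inv_into V \<phi>) x - (\<eta> \<circ> t \<circ> inv_into V \<phi>) x"
    if "x \<in> \<phi> ` V" for x
    using that section_diffD(3)[OF r _ c] inv is_chart_subset[OF vb_chart_is_chart[OF E c]] by auto
  have iter: "iter_deriv (\<eta> \<circ> r \<circ> inv_into V \<phi>) vs (\<phi> p)
      = iter_deriv (\<eta> \<circ> s \<circ> inv_into V \<phi>) vs (\<phi> p) - iter_deriv (\<eta> \<circ> t \<circ> inv_into V \<phi>) vs (\<phi> p)" for vs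
  proof -
    have x: "\<phi> p \<in> \<phi> ` V"
      using pV by blast
    have "iter_deriv (\<eta> \<circ> r \<circ> inv_into V \<phi>) vs (\<phi> p) = iter_deriv
        (\<lambda>x. (\<eta> \<circ> s \<circ> inv_into V \<phi>) x - (\<eta> \<circ> t \<circ> inv_into V \<phi>) x) vs (\<phi> p)"
      by (rule iter_deriv_cong[OF S(1) _ x]) (rule comp)
    then show ?thesis
      unfolding iter_deriv_diff[OF S x] .
  qed
  have "\<eta> (P r p) = (\<Sum>vs\<in>D. a vs (\<phi> p) (iter_deriv (\<eta> \<circ> s \<circ> inv_into V \<phi>) vs (\<phi> p))
      - a vs (\<phi> p) (iter_deriv (\<eta> \<circ> t \<circ> inv_into V \<phi>) vs (\<phi> p)))"
    unfolding eq[OF rs] iter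
    using linear_diff[OF scalar_linear_imp_linear[OF vb_scalar_mult[OF E] vb_scalar_mult[OF E] lin]]
    by (intro sum.cong refl) blast
  then show "\<eta> (P r p) = \<eta> (P s p) - \<eta> (P t p)"
    unfolding eq[OF s] eq[OF t] by (simp add: sum_subtractf)
qed

section \<open>Differences of moderate and of negligible sections\<close>

lemma fiber_norm_section_diff:
  assumes E: "vector_bundle E" and h: "fiber_metric E h" and s: "s \<in> sections E" and t: "t \<in> sections E"
    and r: "section_diff E r s t" and p: "p \<in> topspace (points (base E))"
  shows "fiber_norm h (r p) \<le> 2 * fiber_norm h (s p) + 2 * fiber_norm h (t p)"
proof -
  obtain V \<phi> \<eta> where c: "(V, \<phi>, \<eta>) \<in> vb_charts E" "p \<in> V"
    using vb_covered[OF E p] by blast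
  note z = section_diffD(1,2)[OF r p] sectionD[OF s p] sectionD[OF t p]
  show ?thesis
    using z c section_diffD(3)[OF r p c]
    by (intro fiber_norm_diff_le[OF E h c(1) z(1,3,5)]) simp_all
qed

lemma SUP_fiber_norm_section_diff:
  assumes E: "vector_bundle E" and h: "fiber_metric E h" and s: "s \<in> sections E" and t: "t \<in> sections E"
    and r: "section_diff E r s t" and K: "compactin (points (base E)) K"
    and b: "(SUP p\<in>K. ennreal (fiber_norm h (s p))) \<le> ennreal b" "(SUP p\<in>K. ennreal (fiber_norm h (t p))) \<le> ennreal c"
      "0 \<le> b" "0 \<le> c"
  shows "(SUP p\<in>K. ennreal (fiber_norm h (r p))) \<le> ennreal (2 * b + 2 * c)"
proof (rule SUP_least)
  fix p assume p: "p \<in> K"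
  have "ennreal (fiber_norm h (s p)) \<le> ennreal b" "ennreal (fiber_norm h (t p)) \<le> ennreal c"
    using b(1,2) p unfolding SUP_le_iff by blast+
  then have "fiber_norm h (s p) \<le> b" "fiber_norm h (t p) \<le> c"
    using b(3,4) by simp_all
  moreover have "fiber_norm h (r p) \<le> 2 * fiber_norm h (s p) + 2 * fiber_norm h (t p)"
    using fiber_norm_section_diff[OF E h s t r] compactin_subset_topspace[OF K] p by blast
  ultimately show "ennreal (fiber_norm h (r p)) \<le> ennreal (2 * b + 2 * c)"
    by (intro ennreal_leI) linarith
qed

lemma moderate_sections_diff:
  assumes E: "vector_bundle E" and h: "fiber_metric E h"
    and s: "s \<in> moderate_sections E h" and t: "t \<in> moderate_sections E h"
    and r: "\<And>\<epsilon>. \<epsilon> \<in> idx \<Longrightarrow> section_diff E (r \<epsilon>) (s \<epsilon>) (t \<epsilon>)"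
  shows "r \<in> moderate_sections E h"
  unfolding moderate_sections_def
proof (intro CollectI conjI ballI allI impI)
  have st: "s \<epsilon> \<in> sections E" "t \<epsilon> \<in> sections E" if "\<epsilon> \<in> idx" for \<epsilon>
    using s t that unfolding moderate_sections_def by blast+
  show "r \<epsilon> \<in> sections E" if "\<epsilon> \<in> idx" for \<epsilon>
    using section_diff_section[OF E st[OF that] r[OF that]] .
  fix P K assume P: "P \<in> diff_operators E" and K: "compactin (points (base E)) K"
  have mod: "moderate (\<lambda>\<epsilon>. SUP p\<in>K. ennreal (fiber_norm h (P (s \<epsilon>) p)))"
    "moderate (\<lambda>\<epsilon>. SUP p\<in>K. ennreal (fiber_norm h (P (t \<epsilon>) p)))"
    using s t P K unfolding moderate_sections_def by blast+
  obtain b where b: "mod_on (\<lambda>_. True) b" "\<And>\<epsilon>. 0 \<le> b \<epsilon>"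
    "\<forall>\<^sub>F \<epsilon> in at_right 0. (SUP p\<in>K. ennreal (fiber_norm h (P (s \<epsilon>) p))) \<le> ennreal (b \<epsilon>)"
    by (rule moderate_bound[OF mod(1)]) (rule that)
  obtain c where c: "mod_on (\<lambda>_. True) c" "\<And>\<epsilon>. 0 \<le> c \<epsilon>"
    "\<forall>\<^sub>F \<epsilon> in at_right 0. (SUP p\<in>K. ennreal (fiber_norm h (P (t \<epsilon>) p))) \<le> ennreal (c \<epsilon>)"
    by (rule moderate_bound[OF mod(2)]) (rule that)
  show "moderate (\<lambda>\<epsilon>. SUP p\<in>K. ennreal (fiber_norm h (P (r \<epsilon>) p)))"
  proof (rule moderateI)
    show "mod_on (\<lambda>_. True) (\<lambda>\<epsilon>. 2 * b \<epsilon> + 2 * c \<epsilon>)"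
      using b c by (intro mod_on_add mod_on_mult[OF mod_on_const]) auto
    show "\<forall>\<^sub>F \<epsilon> in at_right 0. (SUP p\<in>K. ennreal (fiber_norm h (P (r \<epsilon>) p))) \<le> ennreal (2 * b \<epsilon> + 2 * c \<epsilon>)"
      using b(3) c(3) eventually_idx
    proof eventually_elim
      case (elim \<epsilon>)
      have "P (s \<epsilon>) \<in> sections E" "P (t \<epsilon>) \<in> sections E"
        using P st[OF elim(3)] unfolding diff_operators_def by blast+
      from SUP_fiber_norm_section_diff[OF E h this section_diff_operator[OF E P st[OF elim(3)] r[OF elim(3)]]
          K elim(1,2) b(2) c(2)] show ?case .
    qed
  qed
qed

lemma negligible_sections_diff:
  assumes E: "vector_bundle E" and h: "fiber_metric E h"
    and s: "s \<in> negligible_sections E h" and t: "t \<in> negligible_sections E h"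
    and r: "\<And>\<epsilon>. \<epsilon> \<in> idx \<Longrightarrow> section_diff E (r \<epsilon>) (s \<epsilon>) (t \<epsilon>)"
  shows "r \<in> negligible_sections E h"
  unfolding negligible_sections_def
proof (intro CollectI conjI allI impI)
  have mod: "s \<in> moderate_sections E h" "t \<in> moderate_sections E h"
    using s t unfolding negligible_sections_def by auto
  then have st: "s \<epsilon> \<in> sections E" "t \<epsilon> \<in> sections E" if "\<epsilon> \<in> idx" for \<epsilon>
    using that unfolding moderate_sections_def by blast+
  show "r \<in> moderate_sections E h"
    by (rule moderate_sections_diff[OF E h mod r])
  fix K assume K: "compactin (points (base E)) K"
  have neg: "negligible_net (\<lambda>\<epsilon>. SUP p\<in>K. ennreal (fiber_norm h (s \<epsilon> p)))"
    "negligible_net (\<lambda>\<epsilon>. SUP p\<in>K. ennreal (fiber_norm h (t \<epsilon> p)))"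
    using s t K unfolding negligible_sections_def by blast+
  obtain b where b: "negl_on (\<lambda>_. True) b" "\<And>\<epsilon>. 0 \<le> b \<epsilon>"
    "\<forall>\<^sub>F \<epsilon> in at_right 0. (SUP p\<in>K. ennreal (fiber_norm h (s \<epsilon> p))) \<le> ennreal (b \<epsilon>)"
    by (rule negligible_bound[OF neg(1)]) (rule that)
  obtain c where c: "negl_on (\<lambda>_. True) c" "\<And>\<epsilon>. 0 \<le> c \<epsilon>"
    "\<forall>\<^sub>F \<epsilon> in at_right 0. (SUP p\<in>K. ennreal (fiber_norm h (t \<epsilon> p))) \<le> ennreal (c \<epsilon>)"
    by (rule negligible_bound[OF neg(2)]) (rule that)
  show "negligible_net (\<lambda>\<epsilon>. SUP p\<in>K. ennreal (fiber_norm h (r \<epsilon> p)))"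
  proof (rule negligible_netI)
    show "negl_on (\<lambda>_. True) (\<lambda>\<epsilon>. 2 * b \<epsilon> + 2 * c \<epsilon>)"
      using b c by (intro negl_on_add negl_on_cmult) auto
    show "\<forall>\<^sub>F \<epsilon> in at_right 0. (SUP p\<in>K. ennreal (fiber_norm h (r \<epsilon> p))) \<le> ennreal (2 * b \<epsilon> + 2 * c \<epsilon>)"
      using b(3) c(3) eventually_idx
      by eventually_elim (rule SUP_fiber_norm_section_diff[OF E h st r K _ _ b(2) c(2)])
  qed
qed

lemma section_diff_minus:
  assumes E: "vector_bundle E" and s: "s \<in> sections E" and t: "t \<in> sections E"
  shows "section_diff E (\<lambda>p. vb_minus E (s p) (t p)) s t"
  unfolding section_diff_def
proof (intro ballI conjI allI impI)
  fix p assume p: "p \<in> topspace (points (base E))"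
  have "proj E (t p) = proj E (s p)"
    using sectionD[OF s p] sectionD[OF t p] by simp
  note m = vb_minus_props[OF E sectionD(1)[OF s p] sectionD(1)[OF t p] this]
  show "vb_minus E (s p) (t p) \<in> topspace (total E)" "proj E (vb_minus E (s p) (t p)) = p"
    using m(1,2) sectionD[OF s p] by auto
  show "\<eta> (vb_minus E (s p) (t p)) = \<eta> (s p) - \<eta> (t p)" if "(V, \<phi>, \<eta>) \<in> vb_charts E" "p \<in> V" for V \<phi> \<eta>
    using m(3)[OF that(1)] sectionD[OF s p] that(2) by simp
qed

text \<open>It lets \<open>t\<close> be read as \<open>s\<close> minus the difference of
  \<open>s\<close> and \<open>t\<close>, so closure under differences also shows that a net
  equivalent to a negligible one is negligible.\<close>

lemma section_diff_undo:
  assumes r: "section_diff E r s t" and t: "t \<in> sections E"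
  shows "section_diff E t s r"
  unfolding section_diff_def
proof (intro ballI conjI allI impI)
  fix p assume p: "p \<in> topspace (points (base E))"
  show "t p \<in> topspace (total E)" "proj E (t p) = p"
    using sectionD[OF t p] .
  show "\<eta> (t p) = \<eta> (s p) - \<eta> (r p)" if "(V, \<phi>, \<eta>) \<in> vb_charts E" "p \<in> V" for V \<phi> \<eta>
    using section_diffD(3)[OF r p that] by simp
qed

text \<open>Any moderate net serves: the zero section is its difference with itself.\<close>

lemma zero_negligible_section:
  assumes E: "vector_bundle E" and h: "fiber_metric E h" and s: "s \<in> moderate_sections E h"
  shows "(\<lambda>\<epsilon>. vb_zero E) \<in> negligible_sections E h"
  unfolding negligible_sections_def
proof (intro CollectI conjI allI impI)
  show "(\<lambda>\<epsilon>. vb_zero E) \<in> moderate_sections E h"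
    by (rule moderate_sections_diff[OF E h s s])
      (use vb_zero_props[OF E] in \<open>simp add: section_diff_def\<close>)
  fix K assume "compactin (points (base E)) K"
  then have "fiber_norm h (vb_zero E p) = 0" if "p \<in> K" for p
    using fiber_norm_zero[OF E h] compactin_subset_topspace that by blast
  then have "(SUP p\<in>K. ennreal (fiber_norm h (vb_zero E p))) \<le> 0"
    by (intro SUP_least) simp
  then show "negligible_net (\<lambda>\<epsilon>. SUP p\<in>K. ennreal (fiber_norm h (vb_zero E p)))"
    by (intro negligible_netI[OF negl_on_zero]) simp
qed

text \<open>Negligible nets are closed under differences, so the class of any one of them is the set
  of all of them; in particular the zero class is that set.\<close>

lemma section_equiv_negligible:
  assumes E: "vector_bundle E" and h: "fiber_metric E h" and s: "s \<in> negligible_sections E h"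
  shows "section_equiv E h `` {s} = negligible_sections E h"
proof
  have smod: "s \<in> moderate_sections E h"
    using s unfolding negligible_sections_def by blast
  have sec: "f \<epsilon> \<in> sections E" if "f \<in> moderate_sections E h" "\<epsilon> \<in> idx" for f \<epsilon>
    using that unfolding moderate_sections_def by blast
  show "section_equiv E h `` {s} \<subseteq> negligible_sections E h"
  proof
    fix t assume "t \<in> section_equiv E h `` {s}"
    then have t: "t \<in> moderate_sections E h"
      "(\<lambda>\<epsilon> p. vb_minus E (s \<epsilon> p) (t \<epsilon> p)) \<in> negligible_sections E h"
      unfolding section_equiv_def by auto
    show "t \<in> negligible_sections E h"
      by (rule negligible_sections_diff[OF E h s t(2)])
        (use section_diff_undo[OF section_diff_minus[OF E]] sec[OF smod] sec[OF t(1)] in blast)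
  qed
  show "negligible_sections E h \<subseteq> section_equiv E h `` {s}"
  proof
    fix t assume t: "t \<in> negligible_sections E h"
    then have tmod: "t \<in> moderate_sections E h"
      unfolding negligible_sections_def by blast
    have "(\<lambda>\<epsilon> p. vb_minus E (s \<epsilon> p) (t \<epsilon> p)) \<in> negligible_sections E h"
      by (rule negligible_sections_diff[OF E h s t])
        (use section_diff_minus[OF E] sec[OF smod] sec[OF tmod] in blast)
    then show "t \<in> section_equiv E h `` {s}"
      using smod tmod unfolding section_equiv_def by simp
  qed
qed

lemma section_equiv_refl:
  assumes E: "vector_bundle E" and h: "fiber_metric E h" and s: "s \<in> moderate_sections E h"
  shows "(s, s) \<in> section_equiv E h"
proof -
  have sec: "s \<epsilon> \<in> sections E" if "\<epsilon> \<in> idx" for \<epsilon>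
    using s that unfolding moderate_sections_def by blast
  have z: "(\<lambda>\<epsilon>. vb_zero E) \<in> negligible_sections E h"
    by (rule zero_negligible_section[OF E h s])
  \<comment> \<open>The difference of a section with itself has zero components, so it is also a
    difference of zero sections, and negligible as such although \<open>s\<close> itself need not
    be.\<close>
  have "(\<lambda>\<epsilon> p. vb_minus E (s \<epsilon> p) (s \<epsilon> p)) \<in> negligible_sections E h"
  proof (rule negligible_sections_diff[OF E h z z])
    fix \<epsilon> :: real assume "\<epsilon> \<in> idx"
    from section_diff_minus[OF E sec[OF this] sec[OF this]]
    show "section_diff E (\<lambda>p. vb_minus E (s \<epsilon> p) (s \<epsilon> p)) (vb_zero E) (vb_zero E)"
      unfolding section_diff_def by simp
  qed
  then show ?thesis
    using s unfolding section_equiv_def by simp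
qed

lemma section_class_eq_zero_iff:
  assumes E: "vector_bundle E" and h: "fiber_metric E h" and s: "s \<in> moderate_sections E h"
  shows "section_equiv E h `` {s} = gen_section_zero E h \<longleftrightarrow> s \<in> negligible_sections E h"
proof -
  have "gen_section_zero E h = negligible_sections E h"
    unfolding gen_section_zero_def
    using section_equiv_negligible[OF E h zero_negligible_section[OF E h s]] by simp
  then show ?thesis
    using section_equiv_negligible[OF E h] section_equiv_refl[OF E h s] by blast
qed

text \<open>Moderateness of sections is stated through differential operators; the identity, of
  order 0, makes it a bound on the values themselves.\<close>

lemma id_diff_operator:
  assumes E: "vector_bundle E"
  shows "(\<lambda>s. s) \<in> diff_operators E"
  unfolding diff_operators_def
proof (intro CollectI conjI ballI exI[of _ 0])
  fix c assume "c \<in> vb_charts E"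
  then obtain V \<phi> \<eta> where c: "c = (V, \<phi>, \<eta>)" "(V, \<phi>, \<eta>) \<in> vb_charts E"
    by (cases c) auto
  have smul: "vector_space (smul E)"
    using vb_scalar_mult[OF E] unfolding scalar_mult_def by blast
  have "Vector_Spaces.linear (smul E) (smul E) (\<lambda>\<xi>. \<xi>)"
    by (rule vector_space.linear_ident[OF smul])
  moreover have "smooth_on A (\<lambda>x. \<xi>)" for A :: "'b set" and \<xi> :: 'd
  proof -
    have "\<exists>c. iter_deriv (\<lambda>x::'b. \<xi>) vs = (\<lambda>x. c)" for vs
      by (induction vs) (auto simp: frechet_derivative_const)
    then show ?thesis
      unfolding smooth_on_def by (metis differentiable_const)
  qed
  moreover have "inv_into V \<phi> (\<phi> p) = p" if "p \<in> V" for p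
    by (rule is_chart_inv[OF vb_chart_is_chart[OF E c(2)] that])
  ultimately show "case c of (V, \<phi>, \<eta>) \<Rightarrow> \<exists>D a. finite D \<and> (\<forall>vs\<in>D. length vs \<le> 0) \<and>
      (\<forall>vs\<in>D. (\<forall>x\<in>\<phi> ` V. Vector_Spaces.linear (smul E) (smul E) (a vs x)) \<and>
              (\<forall>\<xi>. smooth_on (\<phi> ` V) (\<lambda>x. a vs x \<xi>))) \<and>
      (\<forall>s\<in>sections E. \<forall>p\<in>V.
         \<eta> (s p) = (\<Sum>vs\<in>D. a vs (\<phi> p) (iter_deriv (\<eta> \<circ> s \<circ> inv_into V \<phi>) vs (\<phi> p))))"
    unfolding c(1) prod.case by (intro exI[of _ "{[]}"] exI[of _ "\<lambda>_ _ \<xi>. \<xi>"]) simp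
qed

section \<open>Point values of sections\<close>

lemma section_point_moderate:
  assumes E: "vector_bundle E" and h: "fiber_metric E h" and s: "s \<in> moderate_sections E h"
    and p: "p \<in> point_nets (base E)"
  shows "(\<lambda>\<epsilon>. s \<epsilon> (p \<epsilon>)) \<in> vb_moderate E h"
proof -
  have sec: "s \<epsilon> \<in> sections E" if "\<epsilon> \<in> idx" for \<epsilon>
    using s that unfolding moderate_sections_def by blast
  have pX: "p \<epsilon> \<in> topspace (points (base E))" if "\<epsilon> \<in> idx" for \<epsilon>
    using p that unfolding point_nets_def by blast
  obtain K where K: "compactin (points (base E)) K" "\<forall>\<^sub>F \<epsilon> in at_right 0. p \<epsilon> \<in> K"
    using p unfolding point_nets_def by blast
  have "moderate (\<lambda>\<epsilon>. SUP p\<in>K. ennreal (fiber_norm h (s \<epsilon> p)))"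
    using s id_diff_operator[OF E] K(1) unfolding moderate_sections_def by fastforce
  then have "mod_on (\<lambda>_. True) (\<lambda>\<epsilon>. fiber_norm h (s \<epsilon> (p \<epsilon>)))"
    by (rule moderateD) (use K(2) in \<open>eventually_elim, auto intro: SUP_upper\<close>)
  moreover have "\<forall>\<^sub>F \<epsilon> in at_right 0. proj E (s \<epsilon> (p \<epsilon>)) \<in> K"
    using K(2) eventually_idx by eventually_elim (simp add: sectionD(2)[OF sec pX])
  ultimately show ?thesis
    unfolding vb_moderate_iff using K(1) sectionD(1)[OF sec pX] by blast
qed

text \<open>The value and the zero vector lie in the same fiber, so
  \<open>vb_class_same_base\<close> applies and the point may pass through many charts; this is why
  sections require no localization.\<close>

lemma negligible_section_class:
  assumes E: "vector_bundle E" and h: "fiber_metric E h" and s: "s \<in> negligible_sections E h"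
    and p: "p \<in> point_nets (base E)"
  shows "vb_class E g h (\<lambda>\<epsilon>. s \<epsilon> (p \<epsilon>)) = vb_class E g h (\<lambda>\<epsilon>. vb_zero E (p \<epsilon>))"
proof (rule vb_class_same_base)
  have smod: "s \<in> moderate_sections E h"
    using s unfolding negligible_sections_def by blast
  have sec: "s \<epsilon> \<in> sections E" if "\<epsilon> \<in> idx" for \<epsilon>
    using smod that unfolding moderate_sections_def by blast
  have pX: "p \<epsilon> \<in> topspace (points (base E))" if "\<epsilon> \<in> idx" for \<epsilon>
    using p that unfolding point_nets_def by blast
  show "(\<lambda>\<epsilon>. s \<epsilon> (p \<epsilon>)) \<in> vb_moderate E h"
    by (rule section_point_moderate[OF E h smod p])
  have "(\<lambda>\<epsilon>. vb_zero E) \<in> moderate_sections E h"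
    using zero_negligible_section[OF E h smod] unfolding negligible_sections_def by blast
  from section_point_moderate[OF E h this p] show "(\<lambda>\<epsilon>. vb_zero E (p \<epsilon>)) \<in> vb_moderate E h" .
  show "proj E (vb_zero E (p \<epsilon>)) = proj E (s \<epsilon> (p \<epsilon>))" if "\<epsilon> \<in> idx" for \<epsilon>
    using vb_zero_props(2)[OF E pX[OF that]] sectionD(2)[OF sec pX] that by simp
  fix V \<phi> \<eta> L assume c: "(V, \<phi>, \<eta>) \<in> vb_charts E" and L: "compact_in (points (base E)) L V"
  obtain C where C: "0 < C"
    "\<And>z. z \<in> topspace (total E) \<Longrightarrow> proj E z \<in> L \<Longrightarrow> norm (\<eta> z) \<le> C * fiber_norm h z"
    "\<And>z. z \<in> topspace (total E) \<Longrightarrow> proj E z \<in> L \<Longrightarrow> fiber_norm h z \<le> C * norm (\<eta> z)"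
    by (rule fiber_norm_bounds[OF E h c L]) (rule that)
  have "negligible_net (\<lambda>\<epsilon>. SUP p\<in>L. ennreal (fiber_norm h (s \<epsilon> p)))"
    using s L unfolding negligible_sections_def compact_in_def by blast
  then obtain b where b: "negl_on (\<lambda>_. True) b" "\<And>\<epsilon>. 0 \<le> b \<epsilon>"
    "\<forall>\<^sub>F \<epsilon> in at_right 0. (SUP p\<in>L. ennreal (fiber_norm h (s \<epsilon> p))) \<le> ennreal (b \<epsilon>)"
    by (rule negligible_bound) (rule that)
  show "negl_on (\<lambda>\<epsilon>. proj E (s \<epsilon> (p \<epsilon>)) \<in> L) (\<lambda>\<epsilon>. norm (\<eta> (s \<epsilon> (p \<epsilon>)) - \<eta> (vb_zero E (p \<epsilon>))))"
  proof (rule negl_on_mono[OF negl_on_cmult[OF b(1,2), of C]])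
    show "\<forall>\<^sub>F \<epsilon> in at_right 0. proj E (s \<epsilon> (p \<epsilon>)) \<in> L \<longrightarrow>
        True \<and> norm (\<eta> (s \<epsilon> (p \<epsilon>)) - \<eta> (vb_zero E (p \<epsilon>))) \<le> C * b \<epsilon>"
      using b(3) eventually_idx
    proof (eventually_elim, intro impI conjI TrueI)
      fix \<epsilon> assume le: "(SUP p\<in>L. ennreal (fiber_norm h (s \<epsilon> p))) \<le> ennreal (b \<epsilon>)"
        and \<epsilon>: "\<epsilon> \<in> idx" and pL: "proj E (s \<epsilon> (p \<epsilon>)) \<in> L"
      note z = sectionD[OF sec[OF \<epsilon>] pX[OF \<epsilon>]]
      have "p \<epsilon> \<in> L" "p \<epsilon> \<in> V"
        using pL z(2) L unfolding compact_in_def by auto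
      have "ennreal (fiber_norm h (s \<epsilon> (p \<epsilon>))) \<le> ennreal (b \<epsilon>)"
        using le \<open>p \<epsilon> \<in> L\<close> unfolding SUP_le_iff by blast
      then have "fiber_norm h (s \<epsilon> (p \<epsilon>)) \<le> b \<epsilon>"
        using b(2) by simp
      then have "C * fiber_norm h (s \<epsilon> (p \<epsilon>)) \<le> C * b \<epsilon>"
        using C(1) by simp
      then show "norm (\<eta> (s \<epsilon> (p \<epsilon>)) - \<eta> (vb_zero E (p \<epsilon>))) \<le> C * b \<epsilon>"
        using C(2)[OF z(1) pL] vb_zero_props(3)[OF E pX[OF \<epsilon>] c \<open>p \<epsilon> \<in> V\<close>] by simp
    qed
  qed
qed

lemma point_equiv_refl:
  assumes "smooth_manifold X" and "p \<in> point_nets X"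
  shows "(p, p) \<in> point_equiv X g"
  using assms point_close_self[OF assms(1), of p p g] unfolding point_equiv_def point_nets_def by blast

text \<open>Equality of point values relates \<open>z\<close> only to the zero vector over some
  representative \<open>q\<close> of the same generalized point, not over \<open>p\<close> itself.
  Where \<open>p\<close> is in \<open>L\<close>, both points lie in a larger compact set of the same
  chart, and the zero vector has component 0 over either, so the fiber condition bounds the
  component of \<open>z\<close> directly.\<close>

lemma vb_class_zero_imp_negligible:
  assumes E: "vector_bundle E" and g: "riemannian_metric (base E) g" and h: "fiber_metric E h"
    and pq: "(p, q) \<in> point_equiv (base E) g"
    and z: "((\<lambda>\<epsilon>. vb_zero E (q \<epsilon>)), z) \<in> vb_point_equiv E g h"
    and pz: "\<And>\<epsilon>. \<epsilon> \<in> idx \<Longrightarrow> proj E (z \<epsilon>) = p \<epsilon>"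
  shows "negl_on (\<lambda>_. True) (\<lambda>\<epsilon>. fiber_norm h (z \<epsilon>))"
proof -
  have p: "p \<in> point_nets (base E)" "q \<in> point_nets (base E)" and close: "point_close (base E) g p q"
    using pq unfolding point_equiv_def by blast+
  have zmod: "z \<in> vb_moderate E h"
    using z unfolding vb_point_equiv_iff by blast
  have qX: "q \<epsilon> \<in> topspace (points (base E))" if "\<epsilon> \<in> idx" for \<epsilon>
    using p(2) that unfolding point_nets_def by blast
  obtain K where K: "compactin (points (base E)) K" "\<forall>\<^sub>F \<epsilon> in at_right 0. p \<epsilon> \<in> K"
    using p(1) unfolding point_nets_def by blast
  obtain I where I: "finite I"
      "\<And>c L. (c, L) \<in> I \<Longrightarrow> c \<in> vb_charts E \<and> compact_in (points (base E)) L (fst c)"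
      "\<And>p. p \<in> K \<Longrightarrow> \<exists>(c, L)\<in>I. p \<in> L"
    by (rule vb_compactin_cover[OF E K(1)]) (rule that)
  show ?thesis
  proof (rule negl_on_finite[OF I(1), of _ "\<lambda>i \<epsilon>. p \<epsilon> \<in> snd i"])
    show "\<forall>\<^sub>F \<epsilon> in at_right 0. True \<longrightarrow> (\<exists>i\<in>I. p \<epsilon> \<in> snd i)"
      using K(2)
    proof eventually_elim
      case (elim \<epsilon>)
      then show ?case
        using I(3)[OF elim] by (auto intro: bexI[rotated])
    qed
    fix i assume i: "i \<in> I"
    obtain V \<phi> \<eta> L where i_eq: "i = ((V, \<phi>, \<eta>), L)"
      by (cases i) auto
    have c: "(V, \<phi>, \<eta>) \<in> vb_charts E" and L: "compact_in (points (base E)) L V"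
      using I(2) i unfolding i_eq by auto
    obtain r L' where L': "0 < r" "compact_in (points (base E)) L' V" "L \<subseteq> L'"
      "\<And>p x. p \<in> L \<Longrightarrow> dist (\<phi> p) x \<le> r \<Longrightarrow> x \<in> \<phi> ` L'"
      "\<forall>\<^sub>F \<epsilon> in at_right 0. p \<epsilon> \<in> L \<longrightarrow> q \<epsilon> \<in> L' \<and> dist (\<phi> (p \<epsilon>)) (\<phi> (q \<epsilon>)) \<le> r"
      "negl_on (\<lambda>\<epsilon>. p \<epsilon> \<in> L) (\<lambda>\<epsilon>. dist (\<phi> (p \<epsilon>)) (\<phi> (q \<epsilon>)))"
      by (rule point_close_chart[OF vb_manifold[OF E] g close vb_chart_base[OF E c] L]) (rule that)
    obtain C where C: "0 < C"
      "\<And>z. z \<in> topspace (total E) \<Longrightarrow> proj E z \<in> L' \<Longrightarrow> norm (\<eta> z) \<le> C * fiber_norm h z"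
      "\<And>z. z \<in> topspace (total E) \<Longrightarrow> proj E z \<in> L' \<Longrightarrow> fiber_norm h z \<le> C * norm (\<eta> z)"
      by (rule fiber_norm_bounds[OF E h c L'(2)]) (rule that)
    have neg: "negl_on (\<lambda>\<epsilon>. proj E (vb_zero E (q \<epsilon>)) \<in> L' \<and> proj E (z \<epsilon>) \<in> L')
        (\<lambda>\<epsilon>. norm (\<eta> (vb_zero E (q \<epsilon>)) - \<eta> (z \<epsilon>)))"
      using z c L'(2) unfolding vb_point_equiv_iff by blast
    have "negl_on (\<lambda>\<epsilon>. p \<epsilon> \<in> L) (\<lambda>\<epsilon>. fiber_norm h (z \<epsilon>))"
    proof (rule negl_on_mono[OF negl_on_cmult[OF neg, of C]])
      show "\<forall>\<^sub>F \<epsilon> in at_right 0. p \<epsilon> \<in> L \<longrightarrow> (proj E (vb_zero E (q \<epsilon>)) \<in> L' \<and> proj E (z \<epsilon>) \<in> L') \<and>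
          fiber_norm h (z \<epsilon>) \<le> C * norm (\<eta> (vb_zero E (q \<epsilon>)) - \<eta> (z \<epsilon>))"
        using L'(5) eventually_idx
      proof (eventually_elim, intro impI)
        fix \<epsilon> assume qL: "p \<epsilon> \<in> L \<longrightarrow> q \<epsilon> \<in> L' \<and> dist (\<phi> (p \<epsilon>)) (\<phi> (q \<epsilon>)) \<le> r"
          and \<epsilon>: "\<epsilon> \<in> idx" and pL: "p \<epsilon> \<in> L"
        have "p \<epsilon> \<in> L'" "q \<epsilon> \<in> L'" "q \<epsilon> \<in> V"
          using pL qL L'(2,3) unfolding compact_in_def by auto
        then show "(proj E (vb_zero E (q \<epsilon>)) \<in> L' \<and> proj E (z \<epsilon>) \<in> L') \<and>
            fiber_norm h (z \<epsilon>) \<le> C * norm (\<eta> (vb_zero E (q \<epsilon>)) - \<eta> (z \<epsilon>))"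
          using C(3)[OF vb_moderate_topspace[OF zmod \<epsilon>]] pz[OF \<epsilon>]
            vb_zero_props(2)[OF E qX[OF \<epsilon>]] vb_zero_props(3)[OF E qX[OF \<epsilon>] c] by simp
      qed
    qed simp
    then show "negl_on (\<lambda>\<epsilon>. p \<epsilon> \<in> snd i) (\<lambda>\<epsilon>. fiber_norm h (z \<epsilon>))"
      unfolding i_eq by simp
  qed
qed

lemma section_zero_iff_values_zero:
  assumes E: "vector_bundle E" and g: "riemannian_metric (base E) g" and h: "fiber_metric E h"
    and u: "u \<in> gen_sections E h"
  shows "u = gen_section_zero E h \<longleftrightarrow>
    (\<forall>p \<in> gen_points (base E) g. section_value E g h u p = zero_value E g h p)"
proof -
  obtain s where s: "s \<in> moderate_sections E h" and u_eq: "u = section_equiv E h `` {s}"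
    using u unfolding gen_sections_def by (rule quotientE)
  have zero_iff: "u = gen_section_zero E h \<longleftrightarrow> s \<in> negligible_sections E h"
    unfolding u_eq by (rule section_class_eq_zero_iff[OF E h s])
  show ?thesis
  proof
    assume "u = gen_section_zero E h"
    then have u_neg: "u = negligible_sections E h" and sneg: "s \<in> negligible_sections E h"
      using zero_iff section_equiv_negligible[OF E h] unfolding u_eq by auto
    show "\<forall>p \<in> gen_points (base E) g. section_value E g h u p = zero_value E g h p"
    proof
      fix P assume "P \<in> gen_points (base E) g"
      then have "P \<subseteq> point_nets (base E)"
        unfolding gen_points_def quotient_def point_equiv_def by auto
      \<comment> \<open>The zero class consists of all negligible nets, so every representative
        \<open>t\<close> in the outer union already contributes the whole of
        \<open>zero_value E g h P\<close>.\<close>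
      then have "(\<Union>p\<in>P. vb_class E g h (\<lambda>\<epsilon>. t \<epsilon> (p \<epsilon>))) = zero_value E g h P" if "t \<in> u" for t
        unfolding zero_value_def using negligible_section_class[OF E h] that unfolding u_neg by blast
      then show "section_value E g h u P = zero_value E g h P"
        unfolding section_value_def using sneg u_neg by auto
    qed
  next
    assume eq: "\<forall>p \<in> gen_points (base E) g. section_value E g h u p = zero_value E g h p"
    have sec: "s \<epsilon> \<in> sections E" if "\<epsilon> \<in> idx" for \<epsilon>
      using s that unfolding moderate_sections_def by blast
    have "negligible_net (\<lambda>\<epsilon>. SUP p\<in>K. ennreal (fiber_norm h (s \<epsilon> p)))"
      if K: "compactin (points (base E)) K" for K
    proof (rule negligible_net_SUP)
      fix a assume a: "\<And>\<epsilon>::real. K \<noteq> {} \<Longrightarrow> a \<epsilon> \<in> K"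
      show "\<exists>r. negl_on (\<lambda>\<epsilon>. K \<noteq> {}) r \<and> (\<forall>\<^sub>F \<epsilon> in at_right 0. K \<noteq> {} \<longrightarrow>
          ennreal (fiber_norm h (s \<epsilon> (a \<epsilon>))) \<le> ennreal (r \<epsilon>))"
      proof (cases "K = {}")
        case True
        then show ?thesis
          using negl_on_zero by auto
      next
        case False
        have "a \<in> point_nets (base E)"
          using a[OF False] K compactin_subset_topspace[OF K] unfolding point_nets_def by auto
        define P where "P = point_equiv (base E) g `` {a}"
        have "P \<in> gen_points (base E) g" "a \<in> P"
          using \<open>a \<in> point_nets (base E)\<close> point_equiv_refl[OF vb_manifold[OF E]]
          unfolding P_def gen_points_def by (auto intro: quotientI)
        have smod: "(\<lambda>\<epsilon>. s \<epsilon> (a \<epsilon>)) \<in> vb_moderate E h"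
          by (rule section_point_moderate[OF E h s \<open>a \<in> point_nets (base E)\<close>])
        have "s \<in> u"
          unfolding u_eq using section_equiv_refl[OF E h s] by simp
        have "(\<lambda>\<epsilon>. s \<epsilon> (a \<epsilon>)) \<in> vb_class E g h (\<lambda>\<epsilon>. s \<epsilon> (a \<epsilon>))"
          using vb_point_equiv_refl[OF E smod] unfolding vb_class_def by simp
        then have "(\<lambda>\<epsilon>. s \<epsilon> (a \<epsilon>)) \<in> section_value E g h u P"
          unfolding section_value_def using \<open>s \<in> u\<close> \<open>a \<in> P\<close> by blast
        then have "(\<lambda>\<epsilon>. s \<epsilon> (a \<epsilon>)) \<in> zero_value E g h P"
          using eq \<open>P \<in> gen_points (base E) g\<close> by simp
        \<comment> \<open>Membership in the union that defines \<open>zero_value\<close> yields a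
          representative \<open>q\<close> of the class of \<open>a\<close>, which may differ from
          \<open>a\<close>.\<close>
        then obtain q where q: "(a, q) \<in> point_equiv (base E) g"
          "((\<lambda>\<epsilon>. vb_zero E (q \<epsilon>)), (\<lambda>\<epsilon>. s \<epsilon> (a \<epsilon>))) \<in> vb_point_equiv E g h"
          unfolding zero_value_def vb_class_def P_def by auto
        have "negl_on (\<lambda>_. True) (\<lambda>\<epsilon>. fiber_norm h (s \<epsilon> (a \<epsilon>)))"
        proof (rule vb_class_zero_imp_negligible[OF E g h q])
          show "proj E (s \<epsilon> (a \<epsilon>)) = a \<epsilon>" if "\<epsilon> \<in> idx" for \<epsilon>
            using sectionD(2)[OF sec[OF that]] a[OF False] compactin_subset_topspace[OF K] by blast
        qed
        then show ?thesis
          using False by auto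
      qed
    qed
    then show "u = gen_section_zero E h"
      unfolding zero_iff using s unfolding negligible_sections_def by blast
  qed
qed

theorem theorem3p7:
  fixes E :: "('x, 'a::fin_dim_normed, 'p, 'e::fin_dim_normed, 'k::real_or_complex) vbundle"
    and F :: "('y, 'b::fin_dim_normed, 'q, 'f::fin_dim_normed, 'k) vbundle"
    and gX :: "('x, 'a) metric_tensor" and gY :: "('y, 'b) metric_tensor"
    and hE :: "'p \<Rightarrow> 'p \<Rightarrow> real" and hF :: "'q \<Rightarrow> 'q \<Rightarrow> real"
  assumes "vector_bundle E" and "vector_bundle F"
    and "riemannian_metric (base E) gX" and "riemannian_metric (base F) gY"
    and "fiber_metric E hE" and "fiber_metric F hF"
  shows
    "(\<forall>u \<in> gen_sections E hE.
        u = gen_section_zero E hE \<longleftrightarrow>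
        (\<forall>p \<in> gen_points (base E) gX. section_value E gX hE u p = zero_value E gX hE p))
     \<and>
     (\<forall>v v'. v \<in> moderate_homs E F \<and> v' \<in> moderate_homs E F \<and>
        base_localized E F v \<and> base_localized E F v' \<longrightarrow>
        (homs_equiv E F gY {0} v v' \<longleftrightarrow>
         (\<forall>e \<in> gen_vb_points E gX hE.
            hom_value E F gY hF (hom_class E F gY v) e =
            hom_value E F gY hF (hom_class E F gY v') e)))"
proof (intro conjI ballI allI impI)
  show "u = gen_section_zero E hE \<longleftrightarrow>
      (\<forall>p \<in> gen_points (base E) gX. section_value E gX hE u p = zero_value E gX hE p)"
    if "u \<in> gen_sections E hE" for u
    by (rule section_zero_iff_values_zero[OF assms(1,3,5) that])
  show "homs_equiv E F gY {0} v v' \<longleftrightarrow> (\<forall>e \<in> gen_vb_points E gX hE.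
      hom_value E F gY hF (hom_class E F gY v) e = hom_value E F gY hF (hom_class E F gY v') e)"
    if "v \<in> moderate_homs E F \<and> v' \<in> moderate_homs E F \<and> base_localized E F v \<and> base_localized E F v'"
    for v v'
    using that by (intro homs_equiv_iff_hom_values[OF assms]) simp_all
qed

end
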